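(* Let $\rho_{A\bar AB\bar B}$ be any four-party quantum state. Then $$I(A|\bar A:B|\bar B)_\rho\;\geq\;D_{\mathsf{ALL}}\Big(\rho_{A\bar AB\bar B}\,\Big\|\,\int_{-\infty}^{\infty}\mathrm d\beta_0(t)\,\big(\mathcal R^{[t]}_{\bar A\to A\bar A}\otimes\mathcal R^{[t]}_{\bar B\to B\bar B}\big)(\rho_{\bar A\bar B})\Big)$$ and $$I(A|\bar A:B|\bar B)_\rho\;\geq\;-\int_{-\infty}^{\infty}\mathrm d\beta_0(t)\,\log F\Big(\rho_{A\bar AB\bar B},\big(\mathcal R^{[t]}_{\bar A\to A\bar A}\otimes\mathcal R^{[t]}_{\bar B\to B\bar B}\big)(\rho_{\bar A\bar B})\Big),$$ with the local maps $$\mathcal R^{[t]}_{\bar A\to A\bar A}(\cdot):=\rho_{A\bar A}^{\frac{1+it}{2}}\rho_{\bar A}^{-\frac{1+it}{2}}(\cdot)\rho_{\bar A}^{-\frac{1-it}{2}}\rho_{A\bar A}^{\frac{1-it}{2}},\qquad \mathcal R^{[t]}_{\bar B\to B\bar B}(\cdot):=\rho_{B\bar B}^{\frac{1+it}{2}}\rho_{\bar B}^{-\frac{1+it}{2}}(\cdot)\rho_{\bar B}^{-\frac{1-it}{2}}\rho_{B\bar B}^{\frac{1-it}{2}},$$ and the probability density $\beta_0(t)=\frac{\pi}{2}(\cosh(\pi t)+1)^{-1}$ on $\mathbb R$.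
   Context: All Hilbert spaces are finite-dimensional; quantum states are positive semidefinite operators of unit trace; marginals are denoted by subscripts and obtained by partial trace; identity operators are omitted, e.g. $X_{\bar A}Y_{A\bar A}$ means $(1_A\otimes X_{\bar A})Y_{A\bar A}$. (Complex) powers and inverses of positive semidefinite operators are taken on the support (generalized inverse). $\log$ is the natural logarithm, and $\mathrm d\beta_0(t)$ means $\beta_0(t)\,\mathrm dt$. $H(A)_\rho=-\operatorname{tr}[\rho_A\log\rho_A]$, $I(A:B)_\rho=H(A)_\rho+H(B)_\rho-H(AB)_\rho$, and $I(A|\bar A:B|\bar B)_\rho:=I(A\bar A:B\bar B)_\rho-I(\bar A:\bar B)_\rho$. $D_{\mathsf{ALL}}(\rho\|\sigma)=\sup_M\sum_z\operatorname{tr}[\rho M^z]\log\frac{\operatorname{tr}[\rho M^z]}{\operatorname{tr}[\sigma M^z]}$ is the measured relative entropy, the supremum over all POVMs $M=\{M^z\}_z$ (finite families of positive semidefinite operators summing to the identity), with the usual conventions ($0\log\frac0q=0$, value $+\infty$ if $\operatorname{tr}[\rho M^z]>0=\operatorname{tr}[\sigma M^z]$ for some $z$). $F(\rho,\sigma)=\|\sqrt\rho\sqrt\sigma\|_1^2$ is the quantum fidelity, with $\|\cdot\|_1$ the trace norm. *)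

theory Defs
  imports "HOL-Analysis.Analysis"
begin

text \<open>
  A finite-dimensional Hilbert space is represented as \<open>complex ^ 'n\<close> with its standard inner
  product, and a tensor product of two spaces by the product of their index types.
\<close>

type_synonym 'n cmat = "complex ^ 'n ^ 'n"

definition adj :: "'n::finite cmat \<Rightarrow> 'n cmat" where
  "adj A = (\<chi> i j. cnj (A $ j $ i))"

definition unitary :: "'n::finite cmat \<Rightarrow> bool" where
  "unitary U \<longleftrightarrow> adj U ** U = mat 1 \<and> U ** adj U = mat 1"

definition psd :: "'n::finite cmat \<Rightarrow> bool" where
  "psd A \<longleftrightarrow> adj A = A \<and> (\<forall>v. 0 \<le> Re (\<Sum>i\<in>UNIV. cnj (v $ i) * (A *v v) $ i))"

definition quantum_state :: "'n::finite cmat \<Rightarrow> bool" where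
  "quantum_state \<rho> \<longleftrightarrow> psd \<rho> \<and> trace \<rho> = 1"

definition diag :: "('n \<Rightarrow> complex) \<Rightarrow> 'n::finite cmat" where
  "diag d = (\<chi> i j. if i = j then d i else 0)"

text \<open>
  Functional calculus of a Hermitian matrix. The result does not depend on the
  diagonalization (lemma \<open>mfun_eq\<close>); for matrices that are not Hermitian the value is unspecified.
\<close>

definition mfun :: "(real \<Rightarrow> complex) \<Rightarrow> 'n::finite cmat \<Rightarrow> 'n cmat" where
  "mfun f A = (THE B. \<exists>U d. unitary U \<and> A = U ** diag (\<lambda>i. of_real (d i)) ** adj U
                          \<and> B = U ** diag (\<lambda>i. f (d i)) ** adj U)"

lemma diag_mult_left: "(diag d ** A) $ i $ j = d i * A $ i $ j"
  by (simp add: diag_def matrix_matrix_mult_def if_distrib[where f="\<lambda>x. x * _"] cong: if_cong)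

lemma diag_mult_right: "(A ** diag d) $ i $ j = A $ i $ j * d j"
  by (simp add: diag_def matrix_matrix_mult_def if_distrib[where f="\<lambda>x. _ * x"] cong: if_cong)

lemma mfun_eq:
  fixes U :: "'n::finite cmat"
  assumes U: "unitary U"
  shows "mfun f (U ** diag (\<lambda>i. of_real (d i)) ** adj U) = U ** diag (\<lambda>i. f (d i)) ** adj U"
proof -
  have "V ** diag (\<lambda>i. f (e i)) ** adj V = U ** diag (\<lambda>i. f (d i)) ** adj U"
    if V: "unitary V"
      and eq: "U ** diag (\<lambda>i. of_real (d i)) ** adj U = V ** diag (\<lambda>i. of_real (e i)) ** adj V"
    for V :: "'n cmat" and e
  proof -
    let ?W = "adj V ** U"
    have inv: "adj U ** U = mat 1" "adj V ** V = mat 1" "U ** adj U = mat 1" "V ** adj V = mat 1"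
      using U V by (auto simp: unitary_def)
    have "adj V ** (U ** diag (\<lambda>i. of_real (d i)) ** adj U) ** U
        = adj V ** (V ** diag (\<lambda>i. of_real (e i)) ** adj V) ** U"
      by (simp only: eq)
    hence "?W ** diag (\<lambda>i. of_real (d i)) ** (adj U ** U)
        = (adj V ** V) ** diag (\<lambda>i. of_real (e i)) ** ?W"
      by (simp only: matrix_mul_assoc)
    hence W: "?W ** diag (\<lambda>i. of_real (d i)) = diag (\<lambda>i. of_real (e i)) ** ?W"
      by (simp add: inv)
    have "?W ** diag (\<lambda>i. f (d i)) = diag (\<lambda>i. f (e i)) ** ?W"
    proof -
      have "?W $ i $ j * f (d j) = f (e i) * ?W $ i $ j" for i j
      proof (cases "?W $ i $ j = 0")
        case False
        have "?W $ i $ j * of_real (d j) = of_real (e i) * ?W $ i $ j"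
          using arg_cong[OF W, of "\<lambda>M. M $ i $ j"] by (simp only: diag_mult_left diag_mult_right)
        with False have "d j = e i" by simp
        thus ?thesis by simp
      qed simp
      thus ?thesis
        by (simp add: vec_eq_iff diag_mult_left diag_mult_right del: mult_eq_0_iff)
    qed
    hence "V ** (?W ** diag (\<lambda>i. f (d i))) ** adj U = V ** (diag (\<lambda>i. f (e i)) ** ?W) ** adj U"
      by (simp only:)
    hence "(V ** adj V) ** U ** diag (\<lambda>i. f (d i)) ** adj U
        = V ** diag (\<lambda>i. f (e i)) ** adj V ** (U ** adj U)"
      by (simp only: matrix_mul_assoc)
    thus ?thesis by (simp add: inv)
  qed
  thus ?thesis
    unfolding mfun_def using U by (intro the_equality) blast+
qed

text \<open>
  Powers are taken on the support: \<open>0 powr z = 0\<close> for every complex \<open>z\<close>, including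
  \<open>z = 0\<close> and exponents with negative real part.
\<close>

definition mpow :: "'n::finite cmat \<Rightarrow> complex \<Rightarrow> 'n cmat" where
  "mpow A z = mfun (\<lambda>x. of_real x powr z) A"

definition msqrt :: "'n::finite cmat \<Rightarrow> 'n cmat" where
  "msqrt A = mfun (\<lambda>x. of_real (sqrt x)) A"

definition mlog :: "'n::finite cmat \<Rightarrow> 'n cmat" where
  "mlog A = mfun (\<lambda>x. of_real (ln x)) A"

definition trace_norm :: "'n::finite cmat \<Rightarrow> real" where
  "trace_norm X = Re (trace (msqrt (adj X ** X)))"

definition kron :: "'x::finite cmat \<Rightarrow> 'y::finite cmat \<Rightarrow> ('x \<times> 'y) cmat" where
  "kron A B = (\<chi> p q. A $ fst p $ fst q * B $ snd p $ snd q)"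

definition matrix_unit :: "'n::finite \<Rightarrow> 'n \<Rightarrow> 'n cmat" where
  "matrix_unit i j = (\<chi> k l. if k = i \<and> l = j then 1 else 0)"

text \<open>
  Tensor product of linear maps, evaluated by expanding
  \<open>X = (\<Sum>i j k l. X (i,k) (j,l) (E i j \<otimes> E k l))\<close>.
\<close>

definition tensor_map ::
  "('y::finite cmat \<Rightarrow> 'x::finite cmat) \<Rightarrow> ('w::finite cmat \<Rightarrow> 'z::finite cmat)
    \<Rightarrow> ('y \<times> 'w) cmat \<Rightarrow> ('x \<times> 'z) cmat" where
  "tensor_map R S X = (\<chi> p q. \<Sum>i\<in>UNIV. \<Sum>j\<in>UNIV. \<Sum>k\<in>UNIV. \<Sum>l\<in>UNIV.
     X $ (i, k) $ (j, l) * kron (R (matrix_unit i j)) (S (matrix_unit k l)) $ p $ q)"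

definition marg_fst :: "('x::finite \<times> 'y::finite) cmat \<Rightarrow> 'x cmat" where
  "marg_fst \<rho> = (\<chi> i j. \<Sum>y\<in>UNIV. \<rho> $ (i, y) $ (j, y))"

definition marg_snd :: "('x::finite \<times> 'y::finite) cmat \<Rightarrow> 'y cmat" where
  "marg_snd \<rho> = (\<chi> i j. \<Sum>x\<in>UNIV. \<rho> $ (x, i) $ (x, j))"

text \<open>
  In a four-party system indexed by \<open>('a \<times> 'ab) \<times> ('b \<times> 'bb)\<close> the type variables \<open>'a\<close>, \<open>'ab\<close>,
  \<open>'b\<close>, \<open>'bb\<close> index the parties \<open>A\<close>, A-bar, \<open>B\<close>, B-bar. The following marginal keeps the two
  barred parties.
\<close>

definition marg_bars ::
  "(('a::finite \<times> 'ab::finite) \<times> ('b::finite \<times> 'bb::finite)) cmat \<Rightarrow> ('ab \<times> 'bb) cmat" where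
  "marg_bars \<rho> = (\<chi> p q. \<Sum>a\<in>UNIV. \<Sum>b\<in>UNIV.
     \<rho> $ ((a, fst p), (b, snd p)) $ ((a, fst q), (b, snd q)))"

definition entropy :: "'n::finite cmat \<Rightarrow> real" where
  "entropy \<rho> = - Re (trace (\<rho> ** mlog \<rho>))"

definition mutual_info :: "('x::finite \<times> 'y::finite) cmat \<Rightarrow> real" where
  "mutual_info \<rho> = entropy (marg_fst \<rho>) + entropy (marg_snd \<rho>) - entropy \<rho>"

definition bipartite_cond_mutual_info ::
  "(('a::finite \<times> 'ab::finite) \<times> ('b::finite \<times> 'bb::finite)) cmat \<Rightarrow> real" where
  "bipartite_cond_mutual_info \<rho> = mutual_info \<rho> - mutual_info (marg_bars \<rho>)"

definition povm :: "'n::finite cmat list \<Rightarrow> bool" where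
  "povm M \<longleftrightarrow> (\<forall>E\<in>set M. psd E) \<and> sum_list M = mat 1"

definition rel_term :: "real \<Rightarrow> real \<Rightarrow> ereal" where
  "rel_term p q = (if p = 0 then 0 else if q = 0 then \<infinity> else ereal (p * ln (p / q)))"

definition measured_rel_entropy :: "'n::finite cmat \<Rightarrow> 'n cmat \<Rightarrow> ereal" where
  "measured_rel_entropy \<rho> \<sigma> =
     (SUP M\<in>{M. povm M}. \<Sum>E\<leftarrow>M. rel_term (Re (trace (\<rho> ** E))) (Re (trace (\<sigma> ** E))))"

definition fidelity :: "'n::finite cmat \<Rightarrow> 'n cmat \<Rightarrow> real" where
  "fidelity \<rho> \<sigma> = (trace_norm (msqrt \<rho> ** msqrt \<sigma>))\<^sup>2"

text \<open>
  For \<open>\<sigma>\<close> on \<open>X \<otimes> Y\<close> this is the map from operators on \<open>Y\<close> to operators on \<open>X \<otimes> Y\<close>, with the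
  identity on \<open>X\<close> made explicit.
\<close>

definition recovery :: "real \<Rightarrow> ('x::finite \<times> 'y::finite) cmat \<Rightarrow> 'y cmat \<Rightarrow> ('x \<times> 'y) cmat" where
  "recovery t \<sigma> X =
     mpow \<sigma> ((1 + \<i> * of_real t) / 2)
     ** kron (mat 1)
          (mpow (marg_snd \<sigma>) (- ((1 + \<i> * of_real t) / 2)) ** X
           ** mpow (marg_snd \<sigma>) (- ((1 - \<i> * of_real t) / 2)))
     ** mpow \<sigma> ((1 - \<i> * of_real t) / 2)"

definition recovered ::
  "real \<Rightarrow> (('a::finite \<times> 'ab::finite) \<times> ('b::finite \<times> 'bb::finite)) cmat
    \<Rightarrow> (('a \<times> 'ab) \<times> ('b \<times> 'bb)) cmat" where
  "recovered t \<rho> =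
     tensor_map (recovery t (marg_fst \<rho>)) (recovery t (marg_snd \<rho>)) (marg_bars \<rho>)"

definition beta0 :: "real \<Rightarrow> real" where
  "beta0 t = pi / 2 * inverse (cosh (pi * t) + 1)"

definition elog :: "real \<Rightarrow> ereal" where
  "elog x = (if x \<le> 0 then - \<infinity> else ereal (ln x))"

text \<open>
  Integral of an extended-real function as positive part minus negative part
  (\<open>e2ennreal\<close> maps negative values to 0). Unlike the Bochner integral, it takes the value
  \<open>\<plusminus>\<infinity>\<close>, instead of 0, on a measurable function one of whose parts has infinite integral.
\<close>

definition eintegral :: "'a measure \<Rightarrow> ('a \<Rightarrow> ereal) \<Rightarrow> ereal" where
  "eintegral M f = enn2ereal (\<integral>\<^sup>+ x. e2ennreal (f x) \<partial>M) - enn2ereal (\<integral>\<^sup>+ x. e2ennreal (- f x) \<partial>M)"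

end

(*
  Let S, T, Y be the marginals of the state on the two halves and on the two barred parties, and
  let a, b be the marginals on the single barred parties, all included into the full space.  With
  W(z) = S^(z/2) T^(z/2) a^(-z/2) b^(-z/2) Y^(z/2), the rotated recovered state is
  W(1+it) W(1+it)^*.  For a POVM E and real numbers c_i consider the scalar entire function
    g(z) = tr[(sum_i exp(z c_i / 2) E_i) W(z) rho^(1 - z/2)].
  It satisfies g(0) = 1 and |g| <= 1 on Re z = 0, and 2 Re g'(0) is sum_i c_i tr[rho E_i] minus the
  conditional mutual information.  The boundary version of Hirschman's theorem at 0, namely
  Re g'(0) <= int beta0(t) log |g(1+it)| dt, therefore bounds the mutual information from below.
  If E is trivial, |g(1+it)|^2 is at most the fidelity with the recovered state, which gives the
  second inequality.  In general Kadison's inequality gives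
  |g(1+it)|^2 <= sum_i exp(c_i) tr[R_t E_i], and c_i = log(p_i / q_i) gives the first one.
*)

theory Submission
  imports Defs "HOL-Complex_Analysis.Conformal_Mappings"
begin

section \<open>Analytic functions on a strip\<close>

text \<open>The inequality for g'(0) is obtained at the boundary point 0 itself. g is multiplied by
  the exponential of an analytic potential whose real part vanishes on Re z = 0 and nearly cancels
  log |g| on Re z = 1. The product is bounded by 1 on the strip and equals 1 at 0, so its derivative
  there has nonpositive real part. The weight \<open>beta0\<close> is the normal derivative at 0 of
  the Poisson kernel of the strip. Working at 0 is what produces entropies: there the derivative of
  a product of noncommuting powers is a sum of logarithms, and under the trace against the state
  their order is irrelevant. Two obstacles shape the details. First, g may vanish on Re z = 1, so
  log |g| is always replaced by a continuous finite majorant: a truncation for the fidelity, an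
  affine function of the recovered state for the measured entropy. Second, powers are generalized
  inverses, so at z = 0 the factors of W are support projections and not identities. The support of
  each included marginal contains that of the state, hence these projections are absorbed by the
  state.\<close>

definition strip :: "complex set" where
  "strip = {z. 0 \<le> Re z \<and> Re z \<le> 1}"

text \<open>The Phragmen-Lindelof argument: a Gaussian factor that decays with the imaginary part
  reduces the unbounded strip to a tall rectangle, and the factor is removed by letting
  \<open>\<eta>\<close> tend to 0.\<close>

lemma strip_maximum_principle:
  fixes f :: "complex \<Rightarrow> complex"
  assumes hol: "f holomorphic_on strip"
    and bdd: "\<And>z. z \<in> strip \<Longrightarrow> norm (f z) \<le> B"
    and left: "\<And>y. norm (f (Complex 0 y)) \<le> 1"
    and right: "\<And>y. norm (f (Complex 1 y)) \<le> 1"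
    and z0: "z0 \<in> strip"
  shows "norm (f z0) \<le> 1"
proof -
  have B0: "0 \<le> B"
    using bdd[OF z0] norm_ge_zero order_trans by blast
  have est: "norm (f z0) * exp (\<eta> * (Re (z0\<^sup>2) - 1)) \<le> 1" if \<eta>: "\<eta> > 0" for \<eta> :: real
  proof -
    \<comment> \<open>The factor has modulus at most 1 on both lines; the -1 in the exponent is
      there for Re z = 1.\<close>
    define h where "h z = f z * exp (of_real \<eta> * (z\<^sup>2 - 1))" for z
    have nh: "norm (h z) = norm (f z) * exp (\<eta> * ((Re z)\<^sup>2 - (Im z)\<^sup>2 - 1))" for z
      by (simp add: h_def norm_mult power2_eq_square)
    \<comment> \<open>This height gives B \<le> \<eta> Y \<le> \<eta> Y^2, so the Gaussian beats the
      bound B on the horizontal sides.\<close>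
    define Y where "Y = \<bar>Im z0\<bar> + 1 + B / \<eta>"
    have Y1: "Y \<ge> 1" "\<bar>Im z0\<bar> < Y" "B / \<eta> \<le> Y"
      using B0 \<eta> by (auto simp: Y_def add_pos_nonneg intro: add_nonneg_nonneg)
    have expB: "B * exp (- (\<eta> * Y\<^sup>2)) \<le> 1"
    proof -
      have "B \<le> \<eta> * Y" using Y1(3) \<eta> by (simp add: field_simps)
      also have "\<dots> \<le> \<eta> * Y\<^sup>2" using Y1(1) \<eta> by (simp add: power2_eq_square)
      finally have "B \<le> exp (\<eta> * Y\<^sup>2)"
        using exp_ge_add_one_self[of "\<eta> * Y\<^sup>2"] by linarith
      thus ?thesis by (simp add: exp_minus field_simps)
    qed
    let ?R = "cbox (Complex 0 (-Y)) (Complex 1 Y)"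
    have sub: "?R \<subseteq> strip"
      by (auto simp: strip_def in_cbox_complex_iff)
    have "norm (h z0) \<le> 1"
    proof (rule maximum_modulus_frontier[where S = ?R and f = h])
      have hol': "h holomorphic_on ?R"
        unfolding h_def by (intro holomorphic_intros holomorphic_on_subset[OF hol sub])
      show "h holomorphic_on interior ?R"
        by (rule holomorphic_on_subset[OF hol' interior_subset])
      show "continuous_on (closure ?R) h"
        using hol' by (simp add: holomorphic_on_imp_continuous_on)
      show "bounded ?R" by simp
      show "z0 \<in> ?R"
        using z0 Y1 by (auto simp: strip_def in_cbox_complex_iff)
      fix z assume "z \<in> frontier ?R"
      hence zR: "z \<in> ?R" and nb: "z \<notin> box (Complex 0 (-Y)) (Complex 1 Y)"
        by (auto simp: frontier_def interior_cbox)
      hence zs: "z \<in> strip" using sub by blast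
      hence re: "0 \<le> Re z" "Re z \<le> 1" by (auto simp: strip_def)
      consider "Re z = 0" | "Re z = 1" | "(Im z)\<^sup>2 = Y\<^sup>2"
        using zR nb by (force simp: in_cbox_complex_iff in_box_complex_iff power2_eq_iff)
      thus "norm (h z) \<le> 1"
      proof cases
        case 1
        hence "z = Complex 0 (Im z)" by (simp add: complex_eq_iff)
        hence "norm (f z) \<le> 1" using left by metis
        moreover have "exp (\<eta> * ((Re z)\<^sup>2 - (Im z)\<^sup>2 - 1)) \<le> 1"
          using mult_nonneg_nonpos[of \<eta> "- (Im z)\<^sup>2 - 1"] 1 \<eta> zero_le_power2[of "Im z"] by simp
        ultimately show ?thesis by (simp add: nh mult_le_one)
      next
        case 2
        hence "z = Complex 1 (Im z)" by (simp add: complex_eq_iff)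
        hence "norm (f z) \<le> 1" using right by metis
        moreover have "exp (\<eta> * ((Re z)\<^sup>2 - (Im z)\<^sup>2 - 1)) \<le> 1"
          using 2 \<eta> by simp
        ultimately show ?thesis by (simp add: nh mult_le_one)
      next
        case 3
        have "(Re z)\<^sup>2 \<le> 1" using re by (simp add: power_le_one)
        hence "\<eta> * ((Re z)\<^sup>2 - (Im z)\<^sup>2 - 1) \<le> \<eta> * (- Y\<^sup>2)"
          using 3 \<eta> by (intro mult_left_mono) auto
        hence "norm (h z) \<le> B * exp (- (\<eta> * Y\<^sup>2))"
          unfolding nh using bdd[OF zs] B0 by (intro mult_mono) auto
        thus ?thesis using expB by linarith
      qed
    qed
    thus ?thesis by (simp add: nh power2_eq_square)
  qed
  have "((\<lambda>\<eta>. norm (f z0) * exp (\<eta> * (Re (z0\<^sup>2) - 1))) \<longlongrightarrow>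
      norm (f z0) * exp (0 * (Re (z0\<^sup>2) - 1))) (at_right 0)"
    by (intro tendsto_intros)
  moreover have "eventually (\<lambda>\<eta>. norm (f z0) * exp (\<eta> * (Re (z0\<^sup>2) - 1)) \<le> 1) (at_right 0)"
    using eventually_at_right_less[of "0::real"] by eventually_elim (rule est)
  ultimately have "norm (f z0) * exp (0 * (Re (z0\<^sup>2) - 1)) \<le> 1"
    by (rule tendsto_upperbound) simp
  thus ?thesis by simp
qed

section \<open>The Poisson kernel of the strip as the real part of a tangent\<close>

lemma Re_tan_complex:
  "Re (tan z) = sin (Re z) * cos (Re z) / ((cos (Re z))\<^sup>2 + (sinh (Im z))\<^sup>2)"
proof -
  define a b where "a = Re z" and "b = Im z"
  have s: "sin z = Complex (sin a * cosh b) (cos a * sinh b)"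
    by (simp add: complex_eq_iff Re_sin Im_sin a_def b_def cosh_field_def sinh_field_def)
  have c: "cos z = Complex (cos a * cosh b) (- (sin a * sinh b))"
    by (simp add: complex_eq_iff Re_cos Im_cos a_def b_def cosh_field_def sinh_field_def
        right_diff_distrib diff_divide_distrib)
  have n: "(cos a * cosh b)\<^sup>2 + (- (sin a * sinh b))\<^sup>2 = (cos a)\<^sup>2 + (sinh b)\<^sup>2"
  proof -
    have "(cos a * cosh b)\<^sup>2 + (- (sin a * sinh b))\<^sup>2
      = (cos a)\<^sup>2 * ((sinh b)\<^sup>2 + 1) + (1 - (cos a)\<^sup>2) * (sinh b)\<^sup>2"
      by (simp add: power_mult_distrib cosh_square_eq sin_squared_eq)
    thus ?thesis by (simp add: algebra_simps)
  qed
  have m: "sin a * cosh b * (cos a * cosh b) + cos a * sinh b * (- (sin a * sinh b)) = sin a * cos a"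
  proof -
    have "sin a * cosh b * (cos a * cosh b) + cos a * sinh b * (- (sin a * sinh b))
       = sin a * cos a * ((cosh b)\<^sup>2 - (sinh b)\<^sup>2)" by (simp add: power2_eq_square algebra_simps)
    thus ?thesis by (simp add: cosh_square_eq)
  qed
  show ?thesis
    unfolding tan_def s c using n m by (simp add: Re_divide a_def[symmetric] b_def[symmetric])
qed

lemma cos_complex_nonzero:
  fixes z :: complex
  assumes "\<bar>Re z\<bar> < pi / 2"
  shows "cos z \<noteq> 0"
proof
  assume "cos z = 0"
  hence "(norm (cos z))\<^sup>2 = 0" by simp
  hence "(cos (Re z))\<^sup>2 + (exp (Im z) - inverse (exp (Im z)))\<^sup>2 / 4 = 0"
    by (simp add: norm_cos_squared)
  hence "(cos (Re z))\<^sup>2 \<le> 0"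
    by (smt (verit) zero_le_power2 divide_nonneg_pos)
  moreover have "cos (Re z) > 0"
    using assms by (intro cos_gt_zero_pi) auto
  ultimately show False by simp
qed

text \<open>The real part of tan(x + iy). With both arguments scaled by pi/2, half of it is the
  classical kernel sin(pi x) / (2 (cosh(pi y) + cos(pi x))) for the line Re z = 1.\<close>

definition strip_kernel :: "real \<Rightarrow> real \<Rightarrow> real" where
  "strip_kernel x y = sin x * cos x / ((cos x)\<^sup>2 + (sinh y)\<^sup>2)"

lemma strip_kernel_nonneg:
  assumes "0 \<le> x" "x < pi / 2"
  shows "0 \<le> strip_kernel x y"
  using assms unfolding strip_kernel_def
  by (intro divide_nonneg_nonneg mult_nonneg_nonneg sin_ge_zero cos_ge_zero add_nonneg_nonneg) auto

text \<open>The primitive is minus the argument of cos(x + iy) = cos x cosh y - i sin x sinh y: the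
  y-derivative of -log cos(x + iy) is i tan(x + iy).\<close>

lemma has_derivative_strip_kernel:
  assumes "0 \<le> x" "x < pi / 2"
  shows "((\<lambda>y. arctan (tan x * tanh y)) has_real_derivative strip_kernel x y) (at y)"
proof -
  have c: "cos x > 0" using assms by (intro cos_gt_zero_pi) auto
  have h: "cosh y > 0" by simp
  have e: "(cos x)\<^sup>2 + (sinh y)\<^sup>2 = (cos x)\<^sup>2 * (cosh y)\<^sup>2 + (sin x)\<^sup>2 * (sinh y)\<^sup>2"
    by (simp add: cosh_square_eq sin_squared_eq algebra_simps)
  have d: "(tan x * (1 - (tanh y)\<^sup>2)) / (1 + (tan x * tanh y)\<^sup>2) = strip_kernel x y"
  proof -
    have t: "1 - (tanh y)\<^sup>2 = 1 / (cosh y)\<^sup>2"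
    proof -
      have "(cosh y)\<^sup>2 > 0" using h by simp
      moreover have "(sinh y)\<^sup>2 = (cosh y)\<^sup>2 - 1" by (simp add: cosh_square_eq)
      ultimately show ?thesis by (simp add: tanh_def power_divide diff_divide_distrib)
    qed
    have u: "1 + (tan x * tanh y)\<^sup>2 = ((cos x)\<^sup>2 + (sinh y)\<^sup>2) / ((cos x)\<^sup>2 * (cosh y)\<^sup>2)"
      unfolding e using h c by (simp add: tanh_def tan_def power_divide power_mult_distrib field_simps)
    have "(cos x)\<^sup>2 + (sinh y)\<^sup>2 > 0" using c by (intro add_pos_nonneg) auto
    thus ?thesis
      unfolding t u strip_kernel_def using c h
      by (simp add: tan_def divide_simps) (simp add: power2_eq_square)
  qed
  show ?thesis
    unfolding d[symmetric] by (auto intro!: derivative_eq_intros simp: divide_inverse algebra_simps)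
qed

lemma continuous_on_strip_kernel:
  assumes "0 \<le> x" "x < pi / 2" "continuous_on S f"
  shows "continuous_on S (\<lambda>t. strip_kernel x (f t))"
proof -
  have c: "cos x > 0" using assms by (intro cos_gt_zero_pi) auto
  have "(cos x)\<^sup>2 + (sinh y)\<^sup>2 \<noteq> 0" for y
    using c by (smt (verit) zero_less_power2 zero_le_power2)
  thus ?thesis unfolding strip_kernel_def by (intro continuous_intros assms) auto
qed

text \<open>The arctan primitive varies by at most pi, whatever T and y are. This is the source of
  the normalization k / pi in \<open>tan_potential\<close>.\<close>

lemma integral_strip_kernel_le:
  assumes x: "0 \<le> x" "x < pi / 2" and k: "k > 0" and T: "T \<ge> 0"
  shows "integral {-T..T} (\<lambda>t. strip_kernel x (k * (y - t))) \<le> pi / k"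
proof -
  let ?F = "\<lambda>t. - arctan (tan x * tanh (k * (y - t))) / k"
  have "((\<lambda>t. strip_kernel x (k * (y - t))) has_integral (?F T - ?F (-T))) {-T..T}"
  proof (rule fundamental_theorem_of_calculus)
    show "-T \<le> T" using T by simp
    fix t
    have "((\<lambda>t. arctan (tan x * tanh (k * (y - t)))) has_real_derivative
        strip_kernel x (k * (y - t)) * (- k)) (at t)"
      by (rule DERIV_chain2[OF has_derivative_strip_kernel[OF x]])
        (auto intro!: derivative_eq_intros)
    from DERIV_cdivide[OF DERIV_minus[OF this], of k]
    have "(?F has_real_derivative strip_kernel x (k * (y - t))) (at t)"
      using k by simp
    thus "(?F has_vector_derivative strip_kernel x (k * (y - t))) (at t within {-T..T})"
      by (simp add: has_real_derivative_iff_has_vector_derivative has_vector_derivative_at_within)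
  qed
  hence "integral {-T..T} (\<lambda>t. strip_kernel x (k * (y - t))) = ?F T - ?F (-T)" by blast
  also have "\<dots> \<le> pi / k"
  proof -
    have "arctan a - arctan b \<le> pi" for a b
      using arctan_lbound[of b] arctan_ubound[of a] by linarith
    hence "(arctan (tan x * tanh (k * (y + T))) - arctan (tan x * tanh (k * (y - T)))) / k \<le> pi / k"
      using k by (intro divide_right_mono) auto
    thus ?thesis by (simp add: diff_divide_distrib)
  qed
  finally show ?thesis .
qed

text \<open>Away from its centre the kernel on the line Re z = 1 is uniformly small as k approaches
  pi/2, because cos k tends to 0 while |sinh s| \<ge> |s|. Together with the mass bound this makes
  it an approximate identity.\<close>

lemma strip_kernel_tail:
  assumes x: "1 \<le> k" "k < pi / 2" and s: "\<eta> \<le> \<bar>s\<bar>" "0 < \<eta>"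
  shows "strip_kernel k (k * s) \<le> cos k / \<eta>\<^sup>2"
proof -
  have c: "cos k > 0" using x by (intro cos_gt_zero_pi) auto
  have "\<eta> \<le> \<bar>k * s\<bar>"
    using s x mult_mono[of 1 k \<eta> "\<bar>s\<bar>"] by (simp add: abs_mult)
  also have "\<dots> \<le> \<bar>sinh (k * s)\<bar>"
    using real_le_abs_sinh[of "k * s"] by (simp add: sinh_field_def exp_minus)
  finally have "\<eta>\<^sup>2 \<le> (sinh (k * s))\<^sup>2"
    using s(2) by (metis abs_le_square_iff abs_of_pos)
  hence "\<eta>\<^sup>2 \<le> (cos k)\<^sup>2 + (sinh (k * s))\<^sup>2" by (simp add: add_increasing)
  hence "strip_kernel k (k * s) \<le> (1 * cos k) / \<eta>\<^sup>2"
    unfolding strip_kernel_def using c s(2)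
    by (intro frac_le mult_right_mono mult_nonneg_nonneg) auto
  thus ?thesis by simp
qed

text \<open>Only points to the right of 0 are compared, since 0 lies on the boundary of the
  strip.\<close>

lemma Re_deriv_nonpos:
  fixes H :: "complex \<Rightarrow> complex"
  assumes der: "(H has_field_derivative D) (at 0)"
    and le: "\<And>x. 0 < x \<Longrightarrow> x < 1 \<Longrightarrow> Re (H (of_real x)) \<le> Re (H 0)"
  shows "Re D \<le> 0"
proof (rule ccontr)
  assume "\<not> Re D \<le> 0"
  have "((\<lambda>x. H (of_real x)) has_vector_derivative D) (at 0)"
    using has_vector_derivative_real_field[of H D 0] der by simp
  hence "((\<lambda>x. Re (H (of_real x))) has_vector_derivative Re D) (at 0)"
    by (rule bounded_linear.has_vector_derivative[OF bounded_linear_Re])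
  hence "((\<lambda>x. Re (H (of_real x))) has_real_derivative Re D) (at 0)"
    by (simp add: has_real_derivative_iff_has_vector_derivative)
  from DERIV_pos_inc_right[OF this] \<open>\<not> Re D \<le> 0\<close> obtain d where
    d: "d > 0" "\<And>h. 0 < h \<Longrightarrow> h < d \<Longrightarrow> Re (H 0) < Re (H (of_real h))"
    by auto
  define h where "h = min d 1 / 2"
  have "0 < h" "h < d" "h < 1" using d(1) by (auto simp: h_def)
  with d(2)[of h] le[of h] show False by simp
qed

text \<open>The half-angle form is the one that meets the derivative of tan, since cos becomes cosh
  on the imaginary axis.\<close>

lemma beta0_eq: "beta0 t = pi / 4 / (cosh (pi / 2 * t))\<^sup>2"
proof -
  have *: "cosh (pi * t) + 1 = 2 * (cosh (pi / 2 * t))\<^sup>2"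
  proof -
    have "2 * (pi / 2 * t) = pi * t" by simp
    thus ?thesis using cosh_double_cosh[of "pi / 2 * t"] by (simp only:)
  qed
  show ?thesis unfolding beta0_def * by (simp add: field_simps)
qed

lemma beta0_pos: "beta0 t > 0"
  unfolding beta0_eq by simp

lemma continuous_on_beta0: "continuous_on S beta0"
  unfolding beta0_eq[abs_def] by (intro continuous_intros) auto

text \<open>
  The real part of \<open>tan\<close> is the Poisson kernel of the strip with respect to the line \<open>Re z = 1\<close>, up
  to scaling. Taking \<open>k < pi / 2\<close> keeps the poles outside the closed strip; for \<open>k \<rightarrow> pi / 2\<close> the
  derivative of the kernel at 0 becomes \<open>beta0\<close>.
\<close>

definition tan_potential :: "(real \<Rightarrow> real) \<Rightarrow> real \<Rightarrow> real \<Rightarrow> complex \<Rightarrow> complex" where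
  "tan_potential \<phi> T k z =
     of_real (k / pi) * integral {-T..T} (\<lambda>t. of_real (\<phi> t) * tan (of_real k * (z - \<i> * of_real t)))"

context
  fixes \<phi> :: "real \<Rightarrow> real" and T k :: real
  assumes \<phi>: "continuous_on UNIV \<phi>" and T: "T \<ge> 0" and k: "1 < k" "k < pi / 2"
begin

lemma cos_shift_nonzero:
  assumes "\<bar>Re z\<bar> < pi / 2 / k"
  shows "cos (of_real k * (z - \<i> * of_real t)) \<noteq> 0"
  using assms k by (intro cos_complex_nonzero) (auto simp: abs_mult field_simps)

lemma strip_subset_domain: "z \<in> strip \<Longrightarrow> \<bar>Re z\<bar> < pi / 2 / k"
  using k by (auto simp: strip_def field_simps intro: le_less_trans[of _ "2 * k"])

text \<open>Differentiation under the integral sign on the open strip |Re z| < pi / (2k). As k <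
  pi/2, this domain contains the closed unit strip, so the potential is differentiable up to the
  boundary and at 0.\<close>

lemma has_derivative_tan_potential:
  assumes z: "\<bar>Re z\<bar> < pi / 2 / k"
  shows "(tan_potential \<phi> T k has_field_derivative
     of_real (k / pi) * integral {-T..T} (\<lambda>t. of_real (\<phi> t) *
       (of_real k * inverse ((cos (of_real k * (z - \<i> * of_real t)))\<^sup>2)))) (at z)"
proof -
  let ?U = "{z. \<bar>Re z\<bar> < pi / 2 / k}"
  have U_eq: "?U = {z. Re z < pi / 2 / k} \<inter> {z. - (pi / 2 / k) < Re z}" by auto
  have op: "open ?U" unfolding U_eq
    by (intro open_Int open_halfspace_Re_lt open_halfspace_Re_gt)
  have conv: "convex ?U" unfolding U_eq
    by (intro convex_Int convex_halfspace_Re_lt convex_halfspace_Re_gt)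
  have \<phi>': "continuous_on S \<phi>" for S using \<phi> continuous_on_subset by blast
  have "((\<lambda>z. integral (cbox (-T) T) (\<lambda>t. of_real (\<phi> t) * tan (of_real k * (z - \<i> * of_real t))))
     has_field_derivative integral (cbox (-T) T) (\<lambda>t. of_real (\<phi> t) *
       (of_real k * inverse ((cos (of_real k * (z - \<i> * of_real t)))\<^sup>2)))) (at z within ?U)"
  proof (rule leibniz_rule_field_derivative[where U = ?U])
    fix x t assume x: "x \<in> ?U"
    show "((\<lambda>x. of_real (\<phi> t) * tan (of_real k * (x - \<i> * of_real t))) has_field_derivative
       of_real (\<phi> t) * (of_real k * inverse ((cos (of_real k * (x - \<i> * of_real t)))\<^sup>2)))
       (at x within ?U)"
    proof -
      have nz: "cos (of_real k * (x - \<i> * of_real t)) \<noteq> 0"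
        using x by (intro cos_shift_nonzero) simp
      have "((\<lambda>x. of_real k * (x - \<i> * of_real t)) has_field_derivative of_real k) (at x within ?U)"
        by (auto intro!: derivative_eq_intros)
      from DERIV_cmult[OF DERIV_chain2[OF DERIV_tan[OF nz] this]] show ?thesis
        by (simp only: mult.commute[of _ "of_real k"])
    qed
  next
    fix x assume x: "x \<in> ?U"
    show "(\<lambda>t. of_real (\<phi> t) * tan (of_real k * (x - \<i> * of_real t))) integrable_on cbox (-T) T"
      unfolding tan_def using cos_shift_nonzero[of x] x
      by (intro integrable_continuous continuous_intros continuous_on_of_real \<phi>') auto
  next
    have *: "continuous_on (?U \<times> cbox (-T) T) (\<lambda>p. \<phi> (snd p))"
      by (rule continuous_on_compose2[OF \<phi> continuous_on_snd[OF continuous_on_id]]) auto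
    show "continuous_on (?U \<times> cbox (-T) T) (\<lambda>(x, t). of_real (\<phi> t) *
       (of_real k * inverse ((cos (of_real k * (x - \<i> * of_real t)))\<^sup>2)))"
      unfolding split_beta using cos_shift_nonzero
      by (intro continuous_intros *) auto
  qed (use z conv in auto)
  hence "((\<lambda>z. integral {-T..T} (\<lambda>t. of_real (\<phi> t) * tan (of_real k * (z - \<i> * of_real t))))
     has_field_derivative integral {-T..T} (\<lambda>t. of_real (\<phi> t) *
       (of_real k * inverse ((cos (of_real k * (z - \<i> * of_real t)))\<^sup>2)))) (at z)"
    using op z at_within_open[of z ?U] by simp
  thus ?thesis
    unfolding tan_potential_def[abs_def] by (rule DERIV_cmult)
qed

lemma Re_tan_potential:
  assumes z: "z \<in> strip"
  shows "Re (tan_potential \<phi> T k z)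
     = k / pi * integral {-T..T} (\<lambda>t. \<phi> t * strip_kernel (k * Re z) (k * (Im z - t)))"
proof -
  have \<phi>': "continuous_on S \<phi>" for S using \<phi> continuous_on_subset by blast
  have "(\<lambda>t. of_real (\<phi> t) * tan (of_real k * (z - \<i> * of_real t))) integrable_on {-T..T}"
    unfolding tan_def using cos_shift_nonzero[OF strip_subset_domain[OF z]]
    by (intro integrable_continuous_interval continuous_intros continuous_on_of_real \<phi>') auto
  from integral_linear[OF this bounded_linear_Re]
  have "Re (integral {-T..T} (\<lambda>t. of_real (\<phi> t) * tan (of_real k * (z - \<i> * of_real t))))
     = integral {-T..T} (\<lambda>t. \<phi> t * strip_kernel (k * Re z) (k * (Im z - t)))"
    by (simp add: o_def Re_tan_complex strip_kernel_def)
  thus ?thesis by (simp add: tan_potential_def)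
qed

text \<open>The kernel has mass at most pi / k, so the constant C survives as C, and the error E is
  integrated over an interval of length 2 T. It serves twice: with the maximum of
  \<open>\<phi>\<close> for boundedness in the strip, and with nearly \<open>\<phi> y\<close> at the
  boundary point 1 + iy.\<close>

lemma tan_potential_le:
  assumes z: "z \<in> strip" and c: "\<And>t. t \<in> {-T..T} \<Longrightarrow>
      \<phi> t * strip_kernel (k * Re z) (k * (Im z - t)) \<le> C * strip_kernel (k * Re z) (k * (Im z - t)) + E"
    and C: "C \<ge> 0"
  shows "Re (tan_potential \<phi> T k z) \<le> C + T * E * (2 * k / pi)"
proof -
  have \<phi>': "continuous_on S \<phi>" for S using \<phi> continuous_on_subset by blast
  have x: "0 \<le> k * Re z" "k * Re z < pi / 2"
    using z k strip_subset_domain[OF z] by (auto simp: strip_def field_simps)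
  note ck = continuous_on_strip_kernel[OF x]
  have "integral {-T..T} (\<lambda>t. \<phi> t * strip_kernel (k * Re z) (k * (Im z - t)))
      \<le> integral {-T..T} (\<lambda>t. C * strip_kernel (k * Re z) (k * (Im z - t)) + E)"
    by (intro integral_le integrable_continuous_interval continuous_intros ck \<phi>' c)
  also have "\<dots> = C * integral {-T..T} (\<lambda>t. strip_kernel (k * Re z) (k * (Im z - t))) + 2 * T * E"
    using T by (subst integral_add) (auto intro!: integrable_continuous_interval continuous_intros ck)
  also have "\<dots> \<le> C * (pi / k) + 2 * T * E"
    using integral_strip_kernel_le[OF x, of k T "Im z"] k T C by (intro add_right_mono mult_left_mono) auto
  finally have "k / pi * integral {-T..T} (\<lambda>t. \<phi> t * strip_kernel (k * Re z) (k * (Im z - t)))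
     \<le> k / pi * (C * (pi / k) + 2 * T * E)"
    using k by (intro mult_left_mono) auto
  also have "\<dots> = C + T * E * (2 * k / pi)" using k by (simp add: field_simps)
  finally show ?thesis by (simp add: Re_tan_potential[OF z])
qed

lemma Re_tan_potential_imag: "Re z = 0 \<Longrightarrow> Re (tan_potential \<phi> T k z) = 0"
  by (subst Re_tan_potential) (auto simp: strip_def strip_kernel_def)

text \<open>The derivative has the density k^2 / pi / cosh(k t)^2. Since k < pi/2, its cosh is
  smaller than the one in \<open>beta0\<close>, and the ratio of the prefactors k^2 / pi and pi / 4
  is (2 k / pi)^2.\<close>

lemma deriv_tan_potential_ge:
  assumes nonneg: "\<And>t. \<phi> t \<ge> 0"
  shows "Re (of_real (k / pi) * integral {-T..T} (\<lambda>t. of_real (\<phi> t) *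
       (of_real k * inverse ((cos (of_real k * (0 - \<i> * of_real t)))\<^sup>2))))
    \<ge> (2 * k / pi)\<^sup>2 * integral {-T..T} (\<lambda>t. beta0 t * \<phi> t)"
proof -
  have \<phi>': "continuous_on S \<phi>" for S using \<phi> continuous_on_subset by blast
  have ch: "cos (of_real k * (0 - \<i> * of_real t)) = of_real (cosh (k * t))" for t
    by (simp add: complex_eq_iff Re_cos Im_cos cosh_field_def)
  let ?J = "integral {-T..T} (\<lambda>t. \<phi> t * (k / (cosh (k * t))\<^sup>2))"
  have "integral {-T..T} (\<lambda>t. of_real (\<phi> t) *
       (of_real k * inverse ((cos (of_real k * (0 - \<i> * of_real t)))\<^sup>2)))
     = integral {-T..T} (\<lambda>t. complex_of_real (\<phi> t * (k / (cosh (k * t))\<^sup>2)))"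
    unfolding ch by (simp add: divide_inverse)
  also have "\<dots> = of_real ?J"
    by (intro integral_unique has_integral_of_real integrable_integral
        integrable_continuous_interval continuous_intros \<phi>') auto
  finally have eq: "Re (of_real (k / pi) * integral {-T..T} (\<lambda>t. of_real (\<phi> t) *
       (of_real k * inverse ((cos (of_real k * (0 - \<i> * of_real t)))\<^sup>2)))) = k / pi * ?J"
    by simp
  have pt: "(2 * k / pi)\<^sup>2 * (beta0 t * \<phi> t) \<le> k / pi * (\<phi> t * (k / (cosh (k * t))\<^sup>2))" for t
  proof -
    have "cosh (k * t) \<le> cosh (pi / 2 * t)"
    proof -
      have "cosh \<bar>k * t\<bar> \<le> cosh \<bar>pi / 2 * t\<bar>"
        using k mult_right_mono[of k "pi / 2" "\<bar>t\<bar>"]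
        by (subst cosh_real_nonneg_le_iff) (auto simp: abs_mult)
      thus ?thesis by (simp only: cosh_real_abs)
    qed
    hence "(cosh (k * t))\<^sup>2 \<le> (cosh (pi / 2 * t))\<^sup>2" by (intro power_mono) auto
    hence "1 / (cosh (pi / 2 * t))\<^sup>2 \<le> 1 / (cosh (k * t))\<^sup>2"
      by (intro divide_left_mono) auto
    hence "(k * k / pi * \<phi> t) * (1 / (cosh (pi / 2 * t))\<^sup>2) \<le> (k * k / pi * \<phi> t) * (1 / (cosh (k * t))\<^sup>2)"
      using k nonneg[of t] by (intro mult_left_mono) auto
    thus ?thesis by (simp add: beta0_eq power2_eq_square algebra_simps)
  qed
  have "(2 * k / pi)\<^sup>2 * integral {-T..T} (\<lambda>t. beta0 t * \<phi> t)
      = integral {-T..T} (\<lambda>t. (2 * k / pi)\<^sup>2 * (beta0 t * \<phi> t))" by simp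
  also have "\<dots> \<le> integral {-T..T} (\<lambda>t. k / pi * (\<phi> t * (k / (cosh (k * t))\<^sup>2)))"
    by (intro integral_le integrable_continuous_interval continuous_intros continuous_on_beta0 \<phi>' pt) auto
  also have "\<dots> = k / pi * ?J" by (simp only: integral_mult_right)
  finally show ?thesis unfolding eq .
qed

end

text \<open>The exponential of the tangent potential of \<open>\<phi>\<close> lifts the bound
  exp(-\<phi>) on Re z = 1 to about 1 and leaves the modulus on Re z = 0 unchanged. The maximum
  principle then controls the product, and its derivative at 0 contains the \<open>beta0\<close>
  integral up to a factor tending to 1 as k tends to pi/2.\<close>

lemma strip_log_integral_interval:
  fixes g :: "complex \<Rightarrow> complex"
  assumes hol: "g holomorphic_on UNIV"
    and bdd: "\<And>z. z \<in> strip \<Longrightarrow> norm (g z) \<le> B"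
    and left: "\<And>y. norm (g (Complex 0 y)) \<le> 1"
    and g0: "g 0 = 1"
    and \<phi>: "continuous_on UNIV \<phi>" and nonneg: "\<And>t. \<phi> t \<ge> 0"
    and right: "\<And>y. norm (g (Complex 1 y)) \<le> exp (- \<phi> y)"
    and der: "(g has_field_derivative D) (at 0)"
    and T: "T \<ge> 0"
  shows "integral {-T..T} (\<lambda>t. beta0 t * \<phi> t) \<le> - Re D"
proof -
  let ?I = "integral {-T..T} (\<lambda>t. beta0 t * \<phi> t)"
  have \<phi>': "continuous_on S \<phi>" for S using \<phi> continuous_on_subset by blast
  have "bounded (\<phi> ` {-T..T})"
    by (intro compact_imp_bounded compact_continuous_image \<phi>') auto
  then obtain M where M: "\<And>t. t \<in> {-T..T} \<Longrightarrow> \<phi> t \<le> M"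
    unfolding bounded_iff by (force simp: abs_le_iff)
  have M0: "0 \<le> M" using M[of 0] nonneg[of 0] T by auto
  have le_eps: "?I \<le> - Re D + 2 * \<epsilon>" if \<epsilon>: "\<epsilon> > 0" for \<epsilon>
  proof -
    have "uniformly_continuous_on {-T-1..T+1} \<phi>"
      by (intro compact_uniformly_continuous \<phi>') auto
    then obtain \<eta>0 where \<eta>0: "\<eta>0 > 0"
      "\<And>s t. s \<in> {-T-1..T+1} \<Longrightarrow> t \<in> {-T-1..T+1} \<Longrightarrow> dist t s < \<eta>0 \<Longrightarrow> dist (\<phi> t) (\<phi> s) < \<epsilon>"
      unfolding uniformly_continuous_on_def using \<epsilon> by metis
    \<comment> \<open>The cap at 1 confines a y close to [-T, T] to the enlarged interval on which
      \<open>\<phi>\<close> is uniformly continuous.\<close>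
    define \<eta> where "\<eta> = min \<eta>0 1"
    have \<eta>: "\<eta> > 0" "\<eta> \<le> 1" using \<eta>0 by (auto simp: \<eta>_def)
    have near: "\<phi> t \<le> \<phi> y + \<epsilon>" if "t \<in> {-T..T}" "\<bar>y - t\<bar> < \<eta>" for t y
      using \<eta>0(2)[of y t] that by (auto simp: \<eta>_def dist_real_def abs_le_iff abs_less_iff)
    have key: "(2 * k / pi)\<^sup>2 * ?I \<le> - Re D + 2 * \<epsilon>"
      if k: "1 < k" "k < pi / 2" and small: "T * (M * (cos k / \<eta>\<^sup>2)) \<le> \<epsilon>" for k
    proof -
      note ctxt = \<phi> T k
      let ?\<Phi> = "tan_potential \<phi> T k"
      \<comment> \<open>One \<open>\<epsilon>\<close> pays for the oscillation of
        \<open>\<phi>\<close> near y, the other for the tail of the kernel away from y.\<close>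
      define H where "H z = g z * exp (?\<Phi> z - ?\<Phi> 0 - of_real (2 * \<epsilon>) * z)" for z
      let ?P = "of_real (k / pi) * integral {-T..T} (\<lambda>t. of_real (\<phi> t) *
          (of_real k * inverse ((cos (of_real k * (0 - \<i> * of_real t)))\<^sup>2)))"
      have \<Phi>0: "Re (?\<Phi> 0) = 0" using Re_tan_potential_imag[OF ctxt] by simp
      have nH: "norm (H z) = norm (g z) * exp (Re (?\<Phi> z) - 2 * \<epsilon> * Re z)" for z
        by (simp add: H_def norm_mult \<Phi>0)
      have knn: "0 \<le> strip_kernel (k * Re z) (k * (Im z - t))" if "z \<in> strip" for z t
        using strip_subset_domain[OF ctxt that] that k
        by (intro strip_kernel_nonneg) (auto simp: strip_def field_simps)
      have H_le: "norm (H z) \<le> 1" if "z \<in> strip" for z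
      proof (rule strip_maximum_principle[OF _ _ _ _ that])
        show "H holomorphic_on strip"
          unfolding H_def
        proof (intro holomorphic_intros holomorphic_on_subset[OF hol])
          show "?\<Phi> holomorphic_on strip"
            unfolding holomorphic_on_def field_differentiable_def
            using has_derivative_tan_potential[OF ctxt strip_subset_domain[OF ctxt]]
              has_field_derivative_at_within by blast
        qed auto
        fix z :: complex assume z: "z \<in> strip"
        have "Re (?\<Phi> z) \<le> M + T * 0 * (2 * k / pi)"
        proof (rule tan_potential_le[OF ctxt z _ M0])
          fix t assume "t \<in> {-T..T}"
          thus "\<phi> t * strip_kernel (k * Re z) (k * (Im z - t))
             \<le> M * strip_kernel (k * Re z) (k * (Im z - t)) + 0"
            using M knn[OF z] by (simp add: mult_right_mono)
        qed
        moreover have "0 \<le> 2 * \<epsilon> * Re z" using z \<epsilon> by (simp add: strip_def)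
        ultimately have "Re (?\<Phi> z) - 2 * \<epsilon> * Re z \<le> M" by simp
        thus "norm (H z) \<le> B * exp M"
          unfolding nH using bdd[OF z] order_trans[OF norm_ge_zero bdd[OF z]] by (intro mult_mono) auto
      next
        fix y
        show "norm (H (Complex 0 y)) \<le> 1"
          unfolding nH using left[of y] Re_tan_potential_imag[OF ctxt, of "Complex 0 y"] by simp
      next
        fix y
        have z: "Complex 1 y \<in> strip" by (simp add: strip_def)
        have "Re (?\<Phi> (Complex 1 y)) \<le> (\<phi> y + \<epsilon>) + T * (M * (cos k / \<eta>\<^sup>2)) * (2 * k / pi)"
        proof (rule tan_potential_le[OF ctxt z])
          show "0 \<le> \<phi> y + \<epsilon>" using nonneg[of y] \<epsilon> by simp
          fix t assume t: "t \<in> {-T..T}"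
          have p: "0 \<le> strip_kernel k (k * (y - t))" using knn[OF z, of t] by simp
          have c: "0 \<le> cos k" using k by (intro cos_ge_zero) auto
          show "\<phi> t * strip_kernel (k * Re (Complex 1 y)) (k * (Im (Complex 1 y) - t))
             \<le> (\<phi> y + \<epsilon>) * strip_kernel (k * Re (Complex 1 y)) (k * (Im (Complex 1 y) - t))
               + M * (cos k / \<eta>\<^sup>2)"
          proof (cases "\<bar>y - t\<bar> < \<eta>")
            case True
            have "\<phi> t * strip_kernel k (k * (y - t)) \<le> (\<phi> y + \<epsilon>) * strip_kernel k (k * (y - t))"
              using near[OF t True] p by (rule mult_right_mono)
            moreover have "0 \<le> M * (cos k / \<eta>\<^sup>2)" using M0 c by simp
            ultimately show ?thesis by simp
          next
            case False
            have "\<phi> t * strip_kernel k (k * (y - t)) \<le> M * (cos k / \<eta>\<^sup>2)"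
              using strip_kernel_tail[of k \<eta> "y - t"] k False \<eta> M[OF t] M0 p
              by (intro mult_mono) auto
            moreover have "0 \<le> (\<phi> y + \<epsilon>) * strip_kernel k (k * (y - t))"
              using p nonneg[of y] \<epsilon> by simp
            ultimately show ?thesis by simp
          qed
        qed
        also have "T * (M * (cos k / \<eta>\<^sup>2)) * (2 * k / pi) \<le> \<epsilon> * 1"
          using small k \<epsilon> by (intro mult_mono) (auto simp: field_simps)
        finally have "Re (?\<Phi> (Complex 1 y)) - 2 * \<epsilon> \<le> \<phi> y" by simp
        hence "norm (H (Complex 1 y)) \<le> exp (- \<phi> y) * exp (\<phi> y)"
          unfolding nH using right[of y] by (intro mult_mono) auto
        thus "norm (H (Complex 1 y)) \<le> 1" by (simp add: exp_minus)
      qed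
      have H0: "H 0 = 1" by (simp add: H_def g0)
      have le: "Re (H (of_real x)) \<le> Re (H 0)" if "0 < x" "x < 1" for x
        using that H_le[of "of_real x"] complex_Re_le_cmod[of "H (of_real x)"]
        by (simp add: H0 strip_def)
      have "0 \<in> strip" by (simp add: strip_def)
      note dP = has_derivative_tan_potential[OF ctxt strip_subset_domain[OF ctxt this]]
      have "(H has_field_derivative D + ?P - of_real (2 * \<epsilon>)) (at 0)"
      proof -
        have "((\<lambda>z. ?\<Phi> z - ?\<Phi> 0 - of_real (2 * \<epsilon>) * z) has_field_derivative
            ?P - 0 - of_real (2 * \<epsilon>) * 1) (at 0)"
          by (intro DERIV_diff dP DERIV_const DERIV_cmult DERIV_ident)
        from DERIV_mult[OF der DERIV_chain2[OF DERIV_exp this]] show ?thesis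
          unfolding H_def[abs_def] by (simp add: g0 algebra_simps)
      qed
      from Re_deriv_nonpos[OF this le]
      have "Re D + Re ?P - 2 * \<epsilon> \<le> 0" by simp
      with deriv_tan_potential_ge[OF ctxt nonneg] show ?thesis by linarith
    qed
    have "((\<lambda>k. T * (M * (cos k / \<eta>\<^sup>2))) \<longlongrightarrow> T * (M * (cos (pi / 2) / \<eta>\<^sup>2))) (at_left (pi / 2))"
      by (intro tendsto_intros) (use \<eta> in auto)
    hence "eventually (\<lambda>k. T * (M * (cos k / \<eta>\<^sup>2)) < \<epsilon>) (at_left (pi / 2))"
      using \<epsilon> by (intro order_tendstoD(2)) auto
    moreover have "eventually (\<lambda>k. k \<in> {1<..<pi/2}) (at_left (pi / 2))"
      by (rule eventually_at_left_real) (use pi_gt3 in auto)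
    ultimately have "eventually (\<lambda>k. (2 * k / pi)\<^sup>2 * ?I \<le> - Re D + 2 * \<epsilon>) (at_left (pi / 2))"
      by eventually_elim (rule key, auto)
    moreover have lim: "((\<lambda>k. (2 * k / pi)\<^sup>2 * ?I) \<longlongrightarrow> (2 * (pi / 2) / pi)\<^sup>2 * ?I) (at_left (pi / 2))"
      by (intro tendsto_intros) auto
    ultimately have "(2 * (pi / 2) / pi)\<^sup>2 * ?I \<le> - Re D + 2 * \<epsilon>"
      by (intro tendsto_upperbound[OF lim]) auto
    thus ?thesis by simp
  qed
  show ?thesis
  proof (rule field_le_epsilon)
    fix e :: real assume "e > 0"
    thus "?I \<le> - Re D + e" using le_eps[of "e / 2"] by simp
  qed
qed

section \<open>Integrals over the whole line\<close>

lemma has_bochner_integral_beta0: "has_bochner_integral lborel beta0 1"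
proof -
  let ?F = "\<lambda>t. tanh (pi / 2 * t) / 2"
  have der: "(?F has_real_derivative beta0 t) (at t)" for t
  proof -
    have "1 - (tanh (pi / 2 * t))\<^sup>2 = 1 / (cosh (pi / 2 * t))\<^sup>2"
    proof -
      have "(cosh (pi / 2 * t))\<^sup>2 > 0" by simp
      moreover have "(sinh (pi / 2 * t))\<^sup>2 = (cosh (pi / 2 * t))\<^sup>2 - 1" by (simp add: cosh_square_eq)
      ultimately show ?thesis by (simp add: tanh_def power_divide diff_divide_distrib)
    qed
    hence "beta0 t = (1 - (tanh (pi / 2 * t))\<^sup>2) * (pi / 2) / 2"
      by (simp add: beta0_eq)
    moreover have "cosh (pi / 2 * t) \<noteq> 0" by simp
    ultimately show ?thesis
      by (auto intro!: derivative_eq_intros)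
  qed
  have lim1: "filterlim (\<lambda>t::real. pi / 2 * t) at_top at_top"
    by (intro filterlim_tendsto_pos_mult_at_top[OF tendsto_const] filterlim_ident) auto
  have lim2: "filterlim (\<lambda>t::real. pi / 2 * t) at_bot at_bot"
    by (intro filterlim_tendsto_pos_mult_at_bot[OF tendsto_const] filterlim_ident) auto
  have t1: "(?F \<longlongrightarrow> 1 / 2) at_top"
    by (intro tendsto_divide filterlim_compose[OF tanh_real_at_top lim1] tendsto_const) auto
  have t2: "(?F \<longlongrightarrow> (-1) / 2) at_bot"
    by (intro tendsto_divide filterlim_compose[OF tanh_real_at_bot lim2] tendsto_const) auto
  have c: "isCont beta0 t" for t
    using continuous_on_beta0[of UNIV] by (simp add: continuous_on_eq_continuous_at)
  have "set_integrable lborel (einterval (-\<infinity>) \<infinity>) beta0" "(LBINT t=-\<infinity>..\<infinity>. beta0 t) = 1 / 2 - (-1) / 2"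
    by (rule interval_integral_FTC_nonneg[of "-\<infinity>" \<infinity> ?F];
        use der c t1 t2 beta0_pos in \<open>auto simp: at_right_MInf at_left_PInf filterlim_filtermap o_def
          less_imp_le ereal_tendsto_simps\<close>)+
  thus ?thesis
    by (simp add: interval_lebesgue_integral_def set_integrable_def set_lebesgue_integral_def
        has_bochner_integral_iff einterval_def)
qed

lemmas integrable_beta0 = has_bochner_integral_beta0[THEN integrable.intros]

lemma integral_beta0: "(LINT t|lborel. beta0 t) = 1"
  using has_bochner_integral_beta0 by (rule has_bochner_integral_integral_eq)

context
  fixes g :: "complex \<Rightarrow> complex" and B :: real and D :: complex
  assumes hol: "g holomorphic_on UNIV"
    and bdd: "\<And>z. z \<in> strip \<Longrightarrow> norm (g z) \<le> B"
    and left: "\<And>y. norm (g (Complex 0 y)) \<le> 1"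
    and g0: "g 0 = 1"
    and der: "(g has_field_derivative D) (at 0)"
begin

text \<open>The intervals [-n, n] exhaust the line. The nonnegative integral is used because the
  integrability of \<open>beta0 t * \<phi> t\<close> is a consequence of the bound and not known
  beforehand.\<close>

lemma strip_log_nn_integral:
  assumes \<phi>: "continuous_on UNIV \<phi>" and nonneg: "\<And>t. \<phi> t \<ge> 0"
    and right: "\<And>y. norm (g (Complex 1 y)) \<le> exp (- \<phi> y)"
  shows "(\<integral>\<^sup>+t. ennreal (beta0 t * \<phi> t) \<partial>lborel) \<le> ennreal (- Re D)"
proof -
  let ?u = "\<lambda>n t. ennreal (beta0 t * \<phi> t) * indicator {- real n..real n} t"
  have \<phi>': "continuous_on S \<phi>" for S using \<phi> continuous_on_subset by blast
  have m: "(\<lambda>t. beta0 t * \<phi> t) \<in> borel_measurable borel"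
    by (intro borel_measurable_continuous_onI continuous_intros \<phi>' continuous_on_beta0)
  have "(\<integral>\<^sup>+t. ?u n t \<partial>lborel) \<le> ennreal (- Re D)" for n
  proof -
    have "((\<lambda>t. beta0 t * \<phi> t) has_integral integral {-real n..real n} (\<lambda>t. beta0 t * \<phi> t)) {-real n..real n}"
      by (intro integrable_integral integrable_continuous_interval continuous_intros continuous_on_beta0 \<phi>')
    from nn_integral_has_integral_lebesgue[OF _ this]
    have "(\<integral>\<^sup>+t. ennreal (indicator {-real n..real n} t * (beta0 t * \<phi> t)) \<partial>lborel)
       = ennreal (integral {-real n..real n} (\<lambda>t. beta0 t * \<phi> t))"
      using nonneg beta0_pos by (simp add: less_imp_le)
    also have "(\<lambda>t. ennreal (indicator {-real n..real n} t * (beta0 t * \<phi> t))) = ?u n"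
      by (auto simp: indicator_def fun_eq_iff)
    also have "integral {-real n..real n} (\<lambda>t. beta0 t * \<phi> t) \<le> - Re D"
      by (rule strip_log_integral_interval[OF hol bdd left g0 \<phi> nonneg right der]) auto
    finally show ?thesis by (simp add: ennreal_leI)
  qed
  moreover have "(\<integral>\<^sup>+t. (SUP n. ?u n t) \<partial>lborel) = (SUP n. \<integral>\<^sup>+t. ?u n t \<partial>lborel)"
    using m by (intro nn_integral_monotone_convergence_SUP)
      (auto simp: incseq_def le_fun_def indicator_def)
  moreover have "(SUP n. ?u n t) = ennreal (beta0 t * \<phi> t)" for t
  proof (rule antisym)
    show "(SUP n. ?u n t) \<le> ennreal (beta0 t * \<phi> t)"
      by (intro SUP_least) (auto simp: indicator_def)
    obtain n where "\<bar>t\<bar> \<le> real n" using real_arch_simple by blast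
    hence "ennreal (beta0 t * \<phi> t) = ?u n t" by (auto simp: indicator_def)
    also have "?u n t \<le> (SUP n. ?u n t)" by (rule SUP_upper) simp
    finally show "ennreal (beta0 t * \<phi> t) \<le> (SUP n. ?u n t)" .
  qed
  ultimately show ?thesis by (simp add: SUP_least)
qed

text \<open>The case \<open>\<phi>\<close> = 0 on the degenerate interval [0, 0]. Since
  \<open>ennreal\<close> sends negative reals to 0, a bound by \<open>ennreal (- Re D)\<close> can
  be read back in the reals only together with this sign.\<close>

lemma strip_deriv_neg:
  assumes right: "\<And>y. norm (g (Complex 1 y)) \<le> 1"
  shows "0 \<le> - Re D"
  using strip_log_integral_interval[OF hol bdd left g0 _ _ _ der, of "\<lambda>_. 0" 0] right by simp

text \<open>Cutting -log |g| off at height n makes it continuous even where g vanishes; monotone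
  convergence removes the cut. The factor 2 arises because F dominates the square of |g|.\<close>

lemma strip_log_elog_nn_integral:
  assumes right: "\<And>y. norm (g (Complex 1 y)) \<le> 1"
    and F: "\<And>y. (norm (g (Complex 1 y)))\<^sup>2 \<le> F y"
  shows "(\<integral>\<^sup>+t. e2ennreal (- (ereal (beta0 t) * elog (F t))) \<partial>lborel) \<le> ennreal (- (2 * Re D))"
proof -
  define c where "c t = norm (g (Complex 1 t))" for t
  have cc: "continuous_on S c" for S
  proof -
    have "continuous_on UNIV g" using hol by (rule holomorphic_on_imp_continuous_on)
    moreover have "continuous_on S (\<lambda>t. Complex 1 t)"
      unfolding Complex_eq by (intro continuous_intros)
    ultimately show ?thesis
      unfolding c_def by (intro continuous_on_norm continuous_on_compose2[of UNIV g S]) auto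
  qed
  define \<phi> where "\<phi> n t = - ln (max (exp (- real n)) (c t))" for n t
  have mx: "max (exp (- real n)) (c t) > 0" for n t by (simp add: less_max_iff_disj)
  have \<phi>_cont: "continuous_on S (\<phi> n)" for n S
    unfolding \<phi>_def by (intro continuous_intros cc) (metis mx less_irrefl)
  have \<phi>_nonneg: "0 \<le> \<phi> n t" for n t
    using right[of t] mx[of n t] by (simp add: \<phi>_def c_def)
  have \<phi>_right: "c t \<le> exp (- \<phi> n t)" for n t
    using mx[of n t] by (simp add: \<phi>_def)
  have \<phi>_mono: "\<phi> m t \<le> \<phi> n t" if "m \<le> n" for m n t
    using that mx[of m t] mx[of n t] by (auto simp: \<phi>_def intro: max.coboundedI1)
  let ?u = "\<lambda>n t. ennreal (2 * (beta0 t * \<phi> n t))"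
  have "(\<integral>\<^sup>+t. e2ennreal (- (ereal (beta0 t) * elog (F t))) \<partial>lborel) \<le> (\<integral>\<^sup>+t. (SUP n. ?u n t) \<partial>lborel)"
  \<comment> \<open>Monotonicity holds for arbitrary integrands, so a pointwise comparison with F is
    enough.\<close>
  proof (rule nn_integral_mono)
    fix t
    have b: "beta0 t > 0" by (rule beta0_pos)
    show "e2ennreal (- (ereal (beta0 t) * elog (F t))) \<le> (SUP n. ?u n t)"
    proof (cases "c t > 0")
      case True
      hence Fp: "F t > 0" using F[of t] by (smt (verit) c_def zero_less_power)
      have "2 * ln (c t) = ln ((c t)\<^sup>2)" using True by (simp add: ln_realpow)
      also have "\<dots> \<le> ln (F t)" using True F[of t] Fp by (simp add: c_def)
      finally have "- (beta0 t * ln (F t)) \<le> 2 * (beta0 t * (- ln (c t)))"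
        using b mult_left_mono[of "2 * ln (c t)" "ln (F t)" "beta0 t"] by (simp add: algebra_simps)
      moreover obtain n where "- ln (c t) \<le> real n" using real_arch_simple by blast
      hence "exp (- real n) \<le> c t"
        using True by (metis exp_ln exp_le_cancel_iff minus_le_iff)
      hence "\<phi> n t = - ln (c t)" by (simp add: \<phi>_def max_def)
      ultimately have "e2ennreal (- (ereal (beta0 t) * elog (F t))) \<le> ?u n t"
        using Fp by (simp add: elog_def e2ennreal_ereal ennreal_leI)
      also have "\<dots> \<le> (SUP n. ?u n t)" by (rule SUP_upper) simp
      finally show ?thesis .
    next
      case False
      hence "c t = 0" by (simp add: c_def)
      hence "\<phi> n t = real n" for n by (simp add: \<phi>_def max_def)
      hence "(SUP n. ?u n t) = (SUP n. ennreal (2 * beta0 t) * of_nat n)"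
        using b by (simp add: ennreal_mult[symmetric] ennreal_of_nat_eq_real_of_nat mult.assoc)
      also have "\<dots> = ennreal (2 * beta0 t) * (SUP n. of_nat n)"
        by (simp add: SUP_mult_left_ennreal)
      also have "\<dots> = top"
        using b by (simp add: ennreal_SUP_of_nat_eq_top ennreal_mult_eq_top_iff)
      finally show ?thesis by (simp only: top_greatest)
    qed
  qed
  also have "\<dots> = (SUP n. \<integral>\<^sup>+t. ?u n t \<partial>lborel)"
  proof (rule nn_integral_monotone_convergence_SUP)
    show "incseq ?u"
      using \<phi>_mono beta0_pos
      unfolding incseq_def le_fun_def
      by (intro allI impI ennreal_leI mult_left_mono) (auto intro: less_imp_le)
    fix n show "?u n \<in> borel_measurable lborel"
      by (intro measurable_compose[OF _ measurable_ennreal])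
        (simp, intro borel_measurable_continuous_onI continuous_intros continuous_on_beta0 \<phi>_cont)
  qed
  also have "\<dots> \<le> ennreal (- (2 * Re D))"
  proof (rule SUP_least)
    fix n
    have m: "(\<lambda>t. beta0 t * \<phi> n t) \<in> borel_measurable borel"
      by (intro borel_measurable_continuous_onI continuous_intros continuous_on_beta0 \<phi>_cont)
    have "(\<integral>\<^sup>+t. ?u n t \<partial>lborel) = (\<integral>\<^sup>+t. ennreal 2 * ennreal (beta0 t * \<phi> n t) \<partial>lborel)"
      by (subst ennreal_mult[symmetric]) (auto simp: \<phi>_nonneg beta0_pos less_imp_le)
    also have "\<dots> = ennreal 2 * (\<integral>\<^sup>+t. ennreal (beta0 t * \<phi> n t) \<partial>lborel)"
      using m by (intro nn_integral_cmult) auto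
    also have "\<dots> \<le> ennreal 2 * ennreal (- Re D)"
      by (intro mult_left_mono strip_log_nn_integral \<phi>_cont \<phi>_nonneg \<phi>_right[unfolded c_def]) auto
    also have "\<dots> = ennreal (- (2 * Re D))"
      using strip_deriv_neg[OF right] by (subst ennreal_mult[symmetric]) auto
    finally show "(\<integral>\<^sup>+t. ?u n t \<partial>lborel) \<le> ennreal (- (2 * Re D))" .
  qed
  finally show ?thesis .
qed

end

text \<open>The factor exp(-M z) replaces the exponent \<psi> by \<psi> - M \<le> 0, which reduces
  the claim to the nonnegative function M - \<psi>. The shift cancels at the end because
  \<open>beta0\<close> has total mass 1.\<close>

lemma strip_log_integral:
  fixes g :: "complex \<Rightarrow> complex"
  assumes hol: "g holomorphic_on UNIV"
    and bdd: "\<And>z. z \<in> strip \<Longrightarrow> norm (g z) \<le> B"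
    and left: "\<And>y. norm (g (Complex 0 y)) \<le> 1"
    and g0: "g 0 = 1"
    and der: "(g has_field_derivative D) (at 0)"
    and \<psi>: "continuous_on UNIV \<psi>" and bound: "\<And>t. \<bar>\<psi> t\<bar> \<le> M"
    and right: "\<And>y. norm (g (Complex 1 y)) \<le> exp (\<psi> y)"
  shows "Re D \<le> (LINT t|lborel. beta0 t * \<psi> t)"
proof -
  define h where "h z = g z * exp (- of_real M * z)" for z
  have M0: "M \<ge> 0" using bound[of 0] by linarith
  have nh: "norm (h z) = norm (g z) * exp (- M * Re z)" for z
    by (simp add: h_def norm_mult)
  have int: "integrable lborel (\<lambda>t. beta0 t * \<psi> t)"
  proof (rule Bochner_Integration.integrable_bound)
    show "integrable lborel (\<lambda>t. M * beta0 t)" using integrable_beta0 by simp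
    show "(\<lambda>t. beta0 t * \<psi> t) \<in> borel_measurable lborel"
      by (simp, intro borel_measurable_continuous_onI continuous_intros \<psi> continuous_on_beta0)
    show "AE t in lborel. norm (beta0 t * \<psi> t) \<le> norm (M * beta0 t)"
      using bound beta0_pos M0 by (auto simp: abs_mult less_imp_le mult.commute intro!: mult_right_mono)
  qed
  have h_hol: "h holomorphic_on UNIV" unfolding h_def by (intro holomorphic_intros hol)
  have h_bdd: "norm (h z) \<le> B" if "z \<in> strip" for z
  proof -
    have "norm (h z) \<le> B * 1"
      unfolding nh using bdd[OF that] that M0 order_trans[OF norm_ge_zero bdd[OF that]]
      by (intro mult_mono) (auto simp: strip_def)
    thus ?thesis by simp
  qed
  have h_left: "norm (h (Complex 0 y)) \<le> 1" for y using left[of y] by (simp add: nh)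
  have h0: "h 0 = 1" by (simp add: h_def g0)
  have "((\<lambda>z. - complex_of_real M * z) has_field_derivative - of_real M) (at 0)"
    using DERIV_cmult[OF DERIV_ident, of "- complex_of_real M" 0 UNIV] by simp
  from DERIV_mult[OF der DERIV_chain2[OF DERIV_exp this]]
  have h_der: "(h has_field_derivative D - of_real M) (at 0)"
    unfolding h_def[abs_def] by (simp add: g0)
  have h_right: "norm (h (Complex 1 y)) \<le> exp (- (M - \<psi> y))" for y
  proof -
    have "norm (h (Complex 1 y)) \<le> exp (\<psi> y) * exp (- M)"
      unfolding nh using right[of y] by (intro mult_mono) auto
    thus ?thesis by (simp add: exp_add[symmetric])
  qed
  have \<psi>_le: "\<psi> t \<le> M" for t using bound[of t] by linarith
  have "norm (h (Complex 1 y)) \<le> 1" for y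
    using order_trans[OF h_right[of y]] \<psi>_le[of y] by simp
  from strip_deriv_neg[OF h_hol h_bdd h_left h0 h_der this]
  have M_ge: "0 \<le> M - Re D" by simp
  have "(\<integral>\<^sup>+t. ennreal (beta0 t * (M - \<psi> t)) \<partial>lborel) \<le> ennreal (- Re (D - of_real M))"
    by (rule strip_log_nn_integral[OF h_hol h_bdd h_left h0 h_der _ _ h_right])
      (auto intro!: continuous_intros \<psi> simp: \<psi>_le)
  moreover have "(\<integral>\<^sup>+t. ennreal (beta0 t * (M - \<psi> t)) \<partial>lborel)
      = ennreal (LINT t|lborel. M * beta0 t - beta0 t * \<psi> t)"
  proof (subst nn_integral_eq_integral[symmetric])
    show "integrable lborel (\<lambda>t. M * beta0 t - beta0 t * \<psi> t)"
      using int integrable_beta0 by simp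
    show "AE t in lborel. 0 \<le> M * beta0 t - beta0 t * \<psi> t"
      using \<psi>_le beta0_pos by (auto simp: mult.commute[of M] less_imp_le intro!: mult_left_mono)
  qed (simp add: algebra_simps)
  moreover have "(LINT t|lborel. M * beta0 t - beta0 t * \<psi> t) = M - (LINT t|lborel. beta0 t * \<psi> t)"
    using int integrable_beta0 by (simp add: integral_beta0)
  moreover have "(LINT t|lborel. beta0 t * \<psi> t) \<le> (LINT t|lborel. beta0 t * M)"
    using int integrable_beta0 \<psi>_le beta0_pos
    by (intro integral_mono) (auto simp: less_imp_le intro!: mult_left_mono)
  hence "0 \<le> M - (LINT t|lborel. beta0 t * \<psi> t)" by (simp add: integral_beta0)
  ultimately have le: "ennreal (M - (LINT t|lborel. beta0 t * \<psi> t)) \<le> ennreal (M - Re D)" by simp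
  thus ?thesis using M_ge by (simp add: ennreal_le_iff)
qed

section \<open>The spectral theorem\<close>

lemma adj_nth [simp]: "adj A $ i $ j = cnj (A $ j $ i)"
  by (simp add: adj_def)

lemma adj_adj [simp]: "adj (adj A) = A"
  by (simp add: vec_eq_iff)

lemma matrix_mult_nth: "(A ** B) $ i $ j = (\<Sum>k\<in>UNIV. A $ i $ k * B $ k $ j)"
  by (simp add: matrix_matrix_mult_def)

lemma adj_mult: "adj (A ** B) = adj B ** adj A"
  by (simp add: vec_eq_iff matrix_mult_nth mult.commute)

lemma adj_mat_1 [simp]: "adj (mat 1) = mat 1"
  by (simp add: vec_eq_iff mat_def)

lemma adj_diag: "adj (diag d) = diag (\<lambda>i. cnj (d i))"
  by (auto simp: vec_eq_iff diag_def)

lemma diag_nth: "diag d $ i $ j = (if i = j then d i else 0)"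
  by (simp add: diag_def)

lemma diag_mult_diag: "diag d ** diag e = diag (\<lambda>i. d i * e i)"
  by (auto simp: vec_eq_iff diag_mult_left diag_nth)

section \<open>The complex inner product and orthonormal eigenvectors\<close>

definition cinner :: "complex ^ 'n \<Rightarrow> complex ^ 'n::finite \<Rightarrow> complex" where
  "cinner v w = (\<Sum>i\<in>UNIV. cnj (v $ i) * w $ i)"

lemma cinner_adj: "cinner v (A *v w) = cinner (adj A *v v) w"
proof -
  have "cinner v (A *v w) = (\<Sum>i\<in>UNIV. \<Sum>j\<in>UNIV. cnj (v $ i) * A $ i $ j * w $ j)"
    by (simp add: cinner_def matrix_vector_mult_def sum_distrib_left mult.assoc)
  also have "\<dots> = (\<Sum>j\<in>UNIV. \<Sum>i\<in>UNIV. cnj (v $ i) * A $ i $ j * w $ j)"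
    by (rule sum.swap)
  also have "\<dots> = cinner (adj A *v v) w"
    by (simp add: cinner_def matrix_vector_mult_def sum_distrib_right sum_distrib_left mult_ac)
  finally show ?thesis .
qed

lemma cinner_add_left: "cinner (u + v) w = cinner u w + cinner v w"
  and cinner_add_right: "cinner u (v + w) = cinner u v + cinner u w"
  and cinner_scale_right: "cinner u (c *s v) = c * cinner u v"
  and cinner_scale_left: "cinner (c *s u) v = cnj c * cinner u v"
  and cinner_zero_right [simp]: "cinner u 0 = 0"
  and cinner_zero_left [simp]: "cinner 0 v = 0"
  by (simp_all add: cinner_def algebra_simps sum.distrib sum_distrib_left)

lemma cinner_diff_right: "cinner u (v - w) = cinner u v - cinner u w"
  by (simp add: cinner_def algebra_simps sum_subtractf)

lemma cinner_commute: "cinner v u = cnj (cinner u v)"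
  by (simp add: cinner_def mult.commute)

lemma inner_eq_Re_cinner: "inner u v = Re (cinner u v)"
  by (simp add: inner_vec_def cinner_def inner_complex_def)

lemma cinner_self: "cinner v v = of_real ((norm v)\<^sup>2)"
proof (rule complex_eqI)
  show "Re (cinner v v) = Re (of_real ((norm v)\<^sup>2))"
    by (simp add: inner_eq_Re_cinner[symmetric] power2_norm_eq_inner)
  show "Im (cinner v v) = Im (of_real ((norm v)\<^sup>2))"
    by (simp add: cinner_def)
qed

lemma norm_scale: "norm (c *s v) = norm c * norm (v :: complex ^ 'n::finite)"
  by (simp add: norm_vec_def norm_mult L2_set_right_distrib)

text \<open>A unimodular factor on v makes the inner product real and nonnegative, which reduces the
  claim to the real Cauchy-Schwarz inequality.\<close>

lemma norm_cinner_le: "norm (cinner u v) \<le> norm u * norm v"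
proof (cases "cinner u v = 0")
  case False
  define c where "c = cnj (sgn (cinner u v))"
  have n: "norm c = 1" using False by (simp add: c_def norm_sgn)
  have e: "c * cinner u v = of_real (norm (cinner u v))"
    using False by (simp add: c_def sgn_div_norm complex_norm_square[symmetric] mult.commute
        scaleR_conv_of_real field_simps power2_eq_square)
  have "norm (cinner u v) = Re (cinner u (c *s v))"
    by (simp add: cinner_scale_right e)
  also have "\<dots> = inner u (c *s v)" by (simp add: inner_eq_Re_cinner)
  also have "\<dots> \<le> norm u * norm (c *s v)" by (rule norm_cauchy_schwarz)
  also have "norm (c *s v) = norm v"
    using n by (simp add: norm_scale)
  finally show ?thesis .
qed simp

lemma mat_vec_scale: "(A::'n::finite cmat) *v (c *s v) = c *s (A *v v)"
  by (simp add: vec_eq_iff matrix_vector_mult_def sum_distrib_left mult_ac)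

text \<open>A dimension count by determinants: the conjugated vectors are the rows with index in J,
  an index outside J gives a zero row, and the resulting singular square matrix has a
  kernel.\<close>

lemma exists_cinner_orthogonal:
  fixes e :: "'n::finite \<Rightarrow> complex ^ 'n"
  assumes "J \<noteq> UNIV"
  shows "\<exists>v. v \<noteq> 0 \<and> (\<forall>i\<in>J. cinner (e i) v = 0)"
proof -
  define A :: "'n cmat" where "A = (\<chi> i. if i \<in> J then (\<chi> k. cnj (e i $ k)) else 0)"
  obtain j where "j \<notin> J" using assms by auto
  hence "row j A = 0" by (simp add: A_def row_def vec_eq_iff)
  hence "det A = 0" by (rule det_zero_row)
  hence "\<not> invertible A" by (simp add: invertible_det_nz)
  hence "\<not> (\<forall>x. A *v x = 0 \<longrightarrow> x = 0)"
    by (simp add: invertible_left_inverse matrix_left_invertible_ker)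
  then obtain v where v: "A *v v = 0" "v \<noteq> 0" by blast
  have "cinner (e i) v = 0" if "i \<in> J" for i
    using arg_cong[OF v(1), of "\<lambda>x. x $ i"] that
    by (simp add: A_def matrix_vector_mult_def cinner_def)
  with v(2) show ?thesis by blast
qed

text \<open>The eigenvector is a maximizer of the quadratic form on the unit sphere of the subspace.\<close>

lemma exists_eigenvector_orthogonal:
  fixes A :: "'n::finite cmat" and e :: "'n \<Rightarrow> complex ^ 'n"
  assumes herm: "adj A = A" and J: "J \<noteq> UNIV"
    and eig: "\<And>i. i \<in> J \<Longrightarrow> A *v e i = of_real (d i) *s e i"
  shows "\<exists>v l. norm v = 1 \<and> (\<forall>i\<in>J. cinner (e i) v = 0) \<and> A *v v = of_real (l::real) *s v"
proof -
  define W where "W = {v. \<forall>i\<in>J. cinner (e i) v = 0}"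
  have W_scale: "c *s v \<in> W" if "v \<in> W" for c v
    using that by (simp add: W_def cinner_scale_right)
  have W_add: "u + v \<in> W" if "u \<in> W" "v \<in> W" for u v
    using that by (simp add: W_def cinner_add_right)
  have W_A: "A *v v \<in> W" if "v \<in> W" for v
    using that by (auto simp: W_def cinner_adj herm eig cinner_scale_left)
  have cont: "continuous_on S (\<lambda>v. cinner u v)" for u and S :: "(complex ^ 'n) set"
    unfolding cinner_def by (intro continuous_intros)
  define K where "K = W \<inter> sphere 0 1"
  have clW: "closed W"
  proof -
    have "W = (\<Inter>i\<in>J. {v. cinner (e i) v = 0})" by (auto simp: W_def)
    moreover have "closed {v. cinner (e i) v = 0}" for i
      using continuous_closed_preimage_constant[OF cont closed_UNIV, of "e i" 0] by simp
    ultimately show ?thesis by auto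
  qed
  have "compact K" unfolding K_def by (intro closed_Int_compact clW compact_sphere)
  moreover have "K \<noteq> {}"
  proof -
    obtain v where v: "v \<noteq> 0" "v \<in> W"
      using exists_cinner_orthogonal[OF J, of e] by (auto simp: W_def)
    have "of_real (inverse (norm v)) *s v \<in> K"
      using v W_scale by (simp add: K_def norm_scale norm_inverse)
    thus ?thesis by blast
  qed
  moreover have qc: "continuous_on S (\<lambda>v. Re (cinner v (A *v v)))" for S
    unfolding cinner_def matrix_vector_mult_def by (intro continuous_intros)
  ultimately obtain v where v: "v \<in> K" and max: "\<And>u. u \<in> K \<Longrightarrow> Re (cinner u (A *v u)) \<le> Re (cinner v (A *v v))"
    using continuous_attains_sup[of K] by blast
  define l where "l = Re (cinner v (A *v v))"
  have nv: "norm v = 1" and vW: "v \<in> W" using v by (auto simp: K_def)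
  have quad: "Re (cinner u (A *v u)) \<le> l * (norm u)\<^sup>2" if u: "u \<in> W" for u
  proof (cases "u = 0")
    case False
    define s where "s = inverse (norm u)"
    have s: "s > 0" "norm u = inverse s" using False by (auto simp: s_def)
    have "norm (complex_of_real s *s u) = 1"
      using s by (simp add: norm_scale)
    hence "complex_of_real s *s u \<in> K" using W_scale[OF u] by (simp add: K_def)
    from max[OF this] have "s\<^sup>2 * Re (cinner u (A *v u)) \<le> l"
      by (simp add: mat_vec_scale cinner_scale_left cinner_scale_right l_def power2_eq_square mult.assoc)
    thus ?thesis using s(1) unfolding s(2) by (simp add: power_inverse field_simps)
  qed (simp add: l_def)
  define r where "r = A *v v - of_real l *s v"
  have "r \<in> W"
    using W_add[OF W_A[OF vW] W_scale[OF vW, of "- of_real l"]]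
    by (simp add: r_def vec_eq_iff)
  \<comment> \<open>First variation at the maximizer in the direction of the residual r. The linear
    term is twice the squared norm of r; for small positive s a quadratic term can dominate it only
    if r = 0.\<close>
  have var: "2 * s * Re (cinner r r) \<le> s\<^sup>2 * (l * (norm r)\<^sup>2 - Re (cinner r (A *v r)))" for s
  proof -
    let ?u = "v + of_real s *s r"
    have "?u \<in> W" using vW \<open>r \<in> W\<close> W_add W_scale by blast
    from quad[OF this]
    have q: "Re (cinner ?u (A *v ?u)) \<le> l * (norm ?u)\<^sup>2" .
    have sym: "Re (cinner v (A *v r)) = Re (cinner r (A *v v))"
      using cinner_commute[of "A *v v" r] by (simp add: cinner_adj[of v] herm)
    have "Re (cinner ?u (A *v ?u)) = l + 2 * s * Re (cinner r (A *v v)) + s\<^sup>2 * Re (cinner r (A *v r))"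
      using sym by (simp add: l_def matrix_vector_right_distrib mat_vec_scale cinner_add_left cinner_add_right
          cinner_scale_left cinner_scale_right power2_eq_square algebra_simps)
    moreover have "(norm ?u)\<^sup>2 = Re (cinner ?u ?u)" by (simp add: cinner_self)
    moreover have "Re (cinner ?u ?u) = 1 + 2 * s * Re (cinner r v) + s\<^sup>2 * (norm r)\<^sup>2"
      using cinner_commute[of r v] nv
      by (simp add: cinner_add_left cinner_add_right cinner_scale_left cinner_scale_right
          cinner_self[of r] cinner_self[of v] power2_eq_square algebra_simps)
    ultimately have "2 * s * (Re (cinner r (A *v v)) - l * Re (cinner r v))
        \<le> s\<^sup>2 * (l * (norm r)\<^sup>2 - Re (cinner r (A *v r)))"
      using q by (simp add: algebra_simps)
    moreover have "Re (cinner r r) = Re (cinner r (A *v v)) - l * Re (cinner r v)"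
      by (subst (2) r_def) (simp add: cinner_diff_right cinner_scale_right)
    ultimately show ?thesis by simp
  qed
  have "Re (cinner r r) \<le> 0"
  proof (rule ccontr)
    assume "\<not> Re (cinner r r) \<le> 0"
    hence p: "Re (cinner r r) > 0" by simp
    define C where "C = \<bar>l * (norm r)\<^sup>2 - Re (cinner r (A *v r))\<bar> + 1"
    define s where "s = Re (cinner r r) / C"
    have C: "C > 0" "l * (norm r)\<^sup>2 - Re (cinner r (A *v r)) \<le> C" by (auto simp: C_def)
    have s: "s > 0" using p C by (simp add: s_def)
    have "2 * s * Re (cinner r r) \<le> s\<^sup>2 * C"
      using var[of s] C s by (meson mult_left_mono order_trans zero_le_power2)
    hence "2 * Re (cinner r r) \<le> s * C" using s by (simp add: power2_eq_square)
    thus False using p C by (simp add: s_def)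
  qed
  hence "r = 0" by (simp add: cinner_self)
  hence "A *v v = of_real l *s v" by (simp add: r_def)
  with nv vW show ?thesis by (auto simp: W_def)
qed

text \<open>Induction on a set J of basis indices that also label the eigenvectors found so far. At
  J = UNIV they are the columns of a square matrix, for which a left inverse is a right
  inverse.\<close>

lemma spectral_theorem:
  fixes A :: "'n::finite cmat"
  assumes herm: "adj A = A"
  shows "\<exists>U d. unitary U \<and> A = U ** diag (\<lambda>i. of_real (d i)) ** adj U"
proof -
  have "\<exists>e d. (\<forall>i\<in>J. A *v e i = of_real (d i :: real) *s e i)
      \<and> (\<forall>i\<in>J. \<forall>j\<in>J. cinner (e i) (e j) = (if i = j then 1 else 0))"
    if "finite J" for J :: "'n set"
    using that
  proof (induction J)
    case (insert j J)
    then obtain e d where e: "\<And>i. i \<in> J \<Longrightarrow> A *v e i = of_real (d i :: real) *s e i"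
      "\<And>i k. i \<in> J \<Longrightarrow> k \<in> J \<Longrightarrow> cinner (e i) (e k) = (if i = k then 1 else 0)"
      by blast
    have "J \<noteq> UNIV" using insert.hyps by auto
    from exists_eigenvector_orthogonal[OF herm this, of e d] e(1) obtain v l where
      v: "norm v = 1" "\<And>i. i \<in> J \<Longrightarrow> cinner (e i) v = 0" "A *v v = of_real l *s v" by blast
    have v': "cinner v (e i) = 0" if "i \<in> J" for i
      using v(2)[OF that] cinner_commute[of v "e i"] by simp
    show ?case
      using insert.hyps e v v'
      by (intro exI[of _ "e(j := v)"] exI[of _ "d(j := l)"]) (auto simp: cinner_self[of v])
  qed simp
  from this[OF finite, of UNIV] obtain e :: "'n \<Rightarrow> complex ^ 'n" and d :: "'n \<Rightarrow> real" where
    e': "\<forall>i\<in>UNIV. A *v e i = of_real (d i) *s e i"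
      "\<forall>i\<in>UNIV. \<forall>j\<in>UNIV. cinner (e i) (e j) = (if i = j then 1 else 0)"
    by blast
  have e: "A *v e i = of_real (d i) *s e i" "cinner (e i) (e k) = (if i = k then 1 else 0)" for i k
    using e' by auto
  define U :: "'n cmat" where "U = (\<chi> i j. e j $ i)"
  have "adj U ** U = mat 1"
    using e(2) by (simp add: vec_eq_iff matrix_mult_nth U_def mat_def cinner_def)
  hence U: "unitary U" unfolding unitary_def using matrix_left_right_inverse by blast
  have "A ** U = U ** diag (\<lambda>i. of_real (d i))"
  proof -
    have "(A ** U) $ i $ j = (A *v e j) $ i" for i j
      by (simp add: matrix_mult_nth U_def matrix_vector_mult_def)
    thus ?thesis by (simp add: vec_eq_iff e(1) diag_mult_right U_def mult.commute)
  qed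
  hence "A ** U ** adj U = U ** diag (\<lambda>i. of_real (d i)) ** adj U" by simp
  hence "A = U ** diag (\<lambda>i. of_real (d i)) ** adj U"
    using U by (simp add: matrix_mul_assoc[symmetric] unitary_def)
  with U show ?thesis by blast
qed

section \<open>Powers of positive semidefinite matrices\<close>

lemma trace_eq: "trace A = (\<Sum>i\<in>UNIV. A $ i $ i)"
  by (simp add: trace_def)

text \<open>This identifies \<open>norm\<close> on the nested vector type with the Hilbert-Schmidt
  norm, the matrix norm of all later estimates.\<close>

lemma trace_adj_mult_self: "trace (adj A ** A) = of_real ((norm A)\<^sup>2)"
proof -
  have "(norm A)\<^sup>2 = (\<Sum>i\<in>UNIV. \<Sum>j\<in>UNIV. (norm (A $ i $ j))\<^sup>2)"
    by (simp add: norm_vec_def L2_set_def sum_nonneg)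
  also have "complex_of_real \<dots> = (\<Sum>i\<in>UNIV. \<Sum>j\<in>UNIV. cnj (A $ i $ j) * A $ i $ j)"
    by (simp only: of_real_sum complex_norm_square mult.commute)
  also have "\<dots> = trace (adj A ** A)"
    unfolding trace_eq matrix_mult_nth by (subst sum.swap) simp
  finally show ?thesis by simp
qed

lemma norm_adj: "norm (adj A) = norm A"
proof -
  have "complex_of_real ((norm (adj A))\<^sup>2) = trace (adj (adj A) ** adj A)"
    by (rule trace_adj_mult_self[symmetric])
  also have "\<dots> = trace (adj A ** A)"
    by (simp only: adj_adj trace_mul_sym[of A "adj A"])
  also have "\<dots> = of_real ((norm A)\<^sup>2)"
    by (rule trace_adj_mult_self)
  finally have "(norm (adj A))\<^sup>2 = (norm A)\<^sup>2" by (simp only: of_real_eq_iff)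
  thus ?thesis by (rule power2_eq_imp_eq) auto
qed

lemma mult_adj_eq_0: "A ** adj A = 0 \<Longrightarrow> A = 0"
  using trace_adj_mult_self[of "adj A"] by (simp add: norm_adj trace_eq)

lemma norm_trace_mult_le: "norm (trace (A ** B)) \<le> norm A * norm (B :: 'n::finite cmat)"
proof -
  have "trace (A ** B) = (\<Sum>i\<in>UNIV. cinner (adj B $ i) (A $ i))"
    by (simp add: trace_eq matrix_mult_nth cinner_def mult.commute)
  hence "norm (trace (A ** B)) \<le> (\<Sum>i\<in>UNIV. norm (cinner (adj B $ i) (A $ i)))"
    using norm_sum by metis
  also have "\<dots> \<le> (\<Sum>i\<in>UNIV. \<bar>norm (A $ i)\<bar> * \<bar>norm (adj B $ i)\<bar>)"
    using norm_cinner_le[of "adj B $ i" "A $ i" for i] by (intro sum_mono) (simp add: mult.commute)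
  also have "\<dots> \<le> L2_set (\<lambda>i. norm (A $ i)) UNIV * L2_set (\<lambda>i. norm (adj B $ i)) UNIV"
    by (rule L2_set_mult_ineq)
  also have "\<dots> = norm A * norm B"
    using norm_adj[of B] by (simp add: norm_vec_def)
  finally show ?thesis .
qed

lemma norm_power2_eq_sum_columns: "(norm (A :: 'n::finite cmat))\<^sup>2 = (\<Sum>j\<in>UNIV. (norm (column j A))\<^sup>2)"
proof -
  have "norm (adj A $ j) = norm (column j A)" for j
    by (simp add: norm_vec_def column_def)
  moreover have "(norm (adj A))\<^sup>2 = (\<Sum>j\<in>UNIV. (norm (adj A $ j))\<^sup>2)"
    by (simp add: norm_vec_def[of "adj A"] L2_set_def sum_nonneg)
  ultimately show ?thesis by (simp add: norm_adj)
qed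

lemma column_mult: "column j (A ** B) = A *v column j B"
  by (simp add: vec_eq_iff column_def matrix_mult_nth matrix_vector_mult_def)

lemma matrix_vector_mul_assoc': "(A ** B) *v x = A *v (B *v x)"
  by (simp add: matrix_vector_mul_assoc)

text \<open>Operator norm at most 1, phrased with vectors because \<open>norm\<close> of a matrix is
  the Hilbert-Schmidt norm.\<close>

definition contraction :: "'n::finite cmat \<Rightarrow> bool" where
  "contraction C \<longleftrightarrow> (\<forall>v. norm (C *v v) \<le> norm v)"

lemma contraction_mult: "contraction A \<Longrightarrow> contraction B \<Longrightarrow> contraction (A ** B)"
  unfolding contraction_def matrix_vector_mul_assoc' using order_trans by blast

lemma contraction_mat_1: "contraction (mat 1)"
  by (simp add: contraction_def)

lemma contraction_adj:
  assumes "contraction C" shows "contraction (adj C)"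
  unfolding contraction_def
proof
  fix v
  have "(norm (adj C *v v))\<^sup>2 = norm (cinner (adj C *v v) (adj C *v v))"
    by (simp add: cinner_self norm_power)
  also have "\<dots> = norm (cinner v (C *v (adj C *v v)))"
    by (simp add: cinner_adj)
  also have "\<dots> \<le> norm v * norm (C *v (adj C *v v))" by (rule norm_cinner_le)
  also have "\<dots> \<le> norm v * norm (adj C *v v)"
    using assms by (intro mult_left_mono) (auto simp: contraction_def)
  finally show "norm (adj C *v v) \<le> norm v"
    by (cases "norm (adj C *v v) = 0") (auto simp: power2_eq_square)
qed

lemma norm_contraction_mult_left:
  fixes A C :: "'n::finite cmat"
  assumes "contraction C" shows "norm (C ** A) \<le> norm A"
proof (rule power2_le_imp_le)
  show "(norm (C ** A))\<^sup>2 \<le> (norm A)\<^sup>2"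
    unfolding norm_power2_eq_sum_columns column_mult using assms
    by (intro sum_mono power_mono) (auto simp: contraction_def)
qed simp

section \<open>Positivity and functional calculus in an eigenbasis\<close>

lemma psd_iff_cinner: "psd A \<longleftrightarrow> adj A = A \<and> (\<forall>v. 0 \<le> Re (cinner v (A *v v)))"
  by (simp add: psd_def cinner_def)

lemma psd_adj: "psd A \<Longrightarrow> adj A = A"
  by (simp add: psd_def)

lemma psd_adj_mult_self: "psd (adj B ** B)"
  unfolding psd_iff_cinner
proof (intro conjI allI)
  show "adj (adj B ** B) = adj B ** B" by (simp add: adj_mult)
  fix v
  have "cinner v ((adj B ** B) *v v) = cinner (B *v v) (B *v v)"
    by (simp add: matrix_vector_mul_assoc' cinner_adj)
  thus "0 \<le> Re (cinner v ((adj B ** B) *v v))" by (simp add: cinner_self)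
qed

definition conj_diag :: "'n::finite cmat \<Rightarrow> ('n \<Rightarrow> complex) \<Rightarrow> 'n cmat" where
  "conj_diag U d = U ** diag d ** adj U"

lemma unitary_cancel:
  assumes "unitary U"
  shows "adj U ** (U ** A) = A" "U ** (adj U ** A) = A" "adj U ** U = mat 1" "U ** adj U = mat 1"
  using assms by (simp_all add: matrix_mul_assoc unitary_def)

lemma conj_diag_mult:
  assumes "unitary U"
  shows "conj_diag U d ** conj_diag U e = conj_diag U (\<lambda>i. d i * e i)"
  unfolding conj_diag_def
  by (simp add: matrix_mul_assoc[symmetric] unitary_cancel[OF assms])
    (simp add: matrix_mul_assoc diag_mult_diag[symmetric])

lemma adj_conj_diag: "adj (conj_diag U d) = conj_diag U (\<lambda>i. cnj (d i))"
  by (simp add: conj_diag_def adj_mult adj_diag matrix_mul_assoc)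

lemma conj_diag_nth: "conj_diag U d $ i $ j = (\<Sum>k\<in>UNIV. U $ i $ k * d k * cnj (U $ j $ k))"
  unfolding conj_diag_def matrix_mult_nth[of "U ** diag d"] by (simp add: diag_mult_right)

lemma trace_conj_diag: "unitary U \<Longrightarrow> trace (conj_diag U d) = sum d UNIV"
  unfolding conj_diag_def
  by (subst trace_mul_sym) (simp add: matrix_mul_assoc unitary_cancel, simp add: trace_eq diag_nth)

lemma cinner_unitary:
  assumes "unitary U" shows "cinner (U *v v) (U *v w) = cinner v w"
  by (simp add: cinner_adj matrix_vector_mul_assoc unitary_cancel[OF assms])

lemma norm_unitary:
  assumes "unitary U" shows "norm (U *v v) = norm v"
proof -
  have "cinner (U *v v) (U *v v) = cinner v v" by (rule cinner_unitary[OF assms])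
  hence "(norm (U *v v))\<^sup>2 = (norm v)\<^sup>2"
    by (simp only: cinner_self of_real_eq_iff)
  thus ?thesis by simp
qed

lemma unitary_adj: "unitary U \<Longrightarrow> unitary (adj U)"
  by (simp add: unitary_def)

lemma contraction_conj_diag:
  assumes U: "unitary U" and d: "\<And>i. norm (d i) \<le> 1"
  shows "contraction (conj_diag U d)"
proof -
  have "norm (diag d *v v) \<le> norm v" for v
  proof -
    have "(diag d *v v) $ i = d i * v $ i" for i
      by (simp add: matrix_vector_mult_def diag_nth if_distrib[where f = "\<lambda>x. x * _"] cong: if_cong)
    moreover have "norm (d i) * norm (v $ i) \<le> norm (v $ i)" for i
      using d mult_right_mono[OF d[of i], of "norm (v $ i)"] by simp
    ultimately show ?thesis
      unfolding norm_vec_def by (intro L2_set_mono) (auto simp: norm_mult)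
  qed
  thus ?thesis
    unfolding contraction_def conj_diag_def matrix_vector_mul_assoc'
    using norm_unitary[OF U] norm_unitary[OF unitary_adj[OF U]] by metis
qed

text \<open>One diagonalization serves all f at once, so that products and derivatives of different
  functions of A can be computed in a common basis.\<close>

lemma psd_spectral:
  fixes A :: "'n::finite cmat"
  assumes "psd A"
  obtains U d where "unitary U" "\<And>i. d i \<ge> 0" "A = conj_diag U (\<lambda>i. of_real (d i))"
    "\<And>f. mfun f A = conj_diag U (\<lambda>i. f (d i))"
proof -
  obtain U d where U: "unitary U" and A: "A = U ** diag (\<lambda>i. of_real (d i)) ** adj U"
    using spectral_theorem[OF psd_adj[OF assms]] by blast
  have "d i \<ge> 0" for i
  proof -
    let ?e = "axis i 1 :: complex ^ 'n"
    have "cinner (U *v ?e) (A *v (U *v ?e)) = cinner ?e (diag (\<lambda>i. of_real (d i)) *v ?e)"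
    proof -
      have "A *v (U *v ?e) = U *v (diag (\<lambda>i. of_real (d i)) *v ?e)"
        unfolding A by (simp add: matrix_vector_mul_assoc matrix_mul_assoc[symmetric] unitary_cancel[OF U])
      thus ?thesis by (simp add: cinner_unitary[OF U])
    qed
    also have "\<dots> = of_real (d i)"
      by (simp add: cinner_def axis_def matrix_vector_mult_def diag_nth if_distrib[where f = "\<lambda>x. x * _"]
          if_distrib[where f = cnj] cong: if_cong)
    finally show ?thesis using assms by (metis psd_iff_cinner Re_complex_of_real)
  qed
  moreover have "mfun f A = conj_diag U (\<lambda>i. f (d i))" for f
    unfolding A conj_diag_def by (rule mfun_eq[OF U])
  ultimately show ?thesis using that U A unfolding conj_diag_def by blast
qed

lemma powr_of_pos: "x > 0 \<Longrightarrow> complex_of_real x powr z = exp (z * of_real (ln x))"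
  by (simp add: powr_def Ln_of_real)

section \<open>Complex powers on the support\<close>

context
  fixes A :: "'n::finite cmat"
  assumes A: "psd A"
begin

text \<open>The convention \<open>0 powr z = 0\<close> makes the law hold for all exponents,
  negative ones included; opposite exponents give the support projection \<open>mpow A 0\<close>
  instead of the identity.\<close>

lemma mpow_add: "mpow A (z + w) = mpow A z ** mpow A w"
proof -
  obtain U d where s: "unitary U" "\<And>i. d i \<ge> 0" "A = conj_diag U (\<lambda>i. of_real (d i))"
    "\<And>f. mfun f A = conj_diag U (\<lambda>i. f (d i))" using psd_spectral[OF A] by metis
  show ?thesis unfolding mpow_def s(4) conj_diag_mult[OF s(1)] powr_add ..
qed

lemma mpow_1: "mpow A 1 = A"
proof -
  obtain U d where s: "unitary U" "\<And>i. d i \<ge> 0" "A = conj_diag U (\<lambda>i. of_real (d i))"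
    "\<And>f. mfun f A = conj_diag U (\<lambda>i. f (d i))" using psd_spectral[OF A] by metis
  have "mpow A 1 = conj_diag U (\<lambda>i. of_real (d i))"
    unfolding mpow_def s(4) using s(2) by simp
  thus ?thesis using s(3) by simp
qed

lemma adj_mpow: "adj (mpow A z) = mpow A (cnj z)"
proof -
  obtain U d where s: "unitary U" "\<And>i. d i \<ge> 0" "A = conj_diag U (\<lambda>i. of_real (d i))"
    "\<And>f. mfun f A = conj_diag U (\<lambda>i. f (d i))" using psd_spectral[OF A] by metis
  have "cnj (of_real (d i) powr z) = of_real (d i) powr cnj z" for i
    using s(2)[of i] by (cases "d i = 0") (auto simp: powr_of_pos exp_cnj)
  thus ?thesis unfolding mpow_def s(4) adj_conj_diag by simp
qed

text \<open>An imaginary power is unitary on the support and 0 on its complement, hence a partial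
  isometry.\<close>

lemma contraction_mpow:
  assumes "Re z = 0" shows "contraction (mpow A z)"
proof -
  obtain U d where s: "unitary U" "\<And>i. d i \<ge> 0" "A = conj_diag U (\<lambda>i. of_real (d i))"
    "\<And>f. mfun f A = conj_diag U (\<lambda>i. f (d i))" using psd_spectral[OF A] by metis
  have "norm (of_real (d i) powr z) \<le> 1" for i
    using s(2)[of i] assms by (cases "d i = 0") (auto simp: powr_of_pos)
  thus ?thesis unfolding mpow_def s(4) by (intro contraction_conj_diag s(1))
qed

lemma msqrt_eq_mpow: "msqrt A = mpow A (1 / 2)"
proof -
  obtain U d where s: "unitary U" "\<And>i. d i \<ge> 0" "A = conj_diag U (\<lambda>i. of_real (d i))"
    "\<And>f. mfun f A = conj_diag U (\<lambda>i. f (d i))" using psd_spectral[OF A] by metis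
  have "of_real (sqrt (d i)) = complex_of_real (d i) powr (1 / 2)" for i
  proof -
    have "complex_of_real (d i) powr of_real (1 / 2) = of_real (d i powr (1 / 2))"
      using s(2)[of i] by (rule powr_of_real)
    thus ?thesis using s(2)[of i] by (simp add: powr_half_sqrt)
  qed
  thus ?thesis unfolding msqrt_def mpow_def s(4) by simp
qed

lemma mpow_0_mult [simp]: "mpow A 0 ** mpow A z = mpow A z"
  by (simp add: mpow_add[symmetric])

lemma mult_mpow_0 [simp]: "mpow A z ** mpow A 0 = mpow A z"
  by (simp add: mpow_add[symmetric])

text \<open>In an eigenbasis the entries are finite sums of exponentials of z; a zero eigenvalue
  contributes the constant 0, in agreement with the formula. The matrix \<open>mat k\<close> plays
  the scalar k.\<close>

lemma has_derivative_mpow: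
  "((\<lambda>z. mpow A (c + k * z) $ i $ j) has_field_derivative (mat k ** (mlog A ** mpow A (c + k * z))) $ i $ j) (at z)"
proof -
  obtain U d where s: "unitary U" "\<And>i. d i \<ge> 0" "A = conj_diag U (\<lambda>i. of_real (d i))"
    "\<And>f. mfun f A = conj_diag U (\<lambda>i. f (d i))" using psd_spectral[OF A] by metis
  have d: "((\<lambda>z. complex_of_real (d m) powr (c + k * z)) has_field_derivative
      k * (of_real (ln (d m)) * of_real (d m) powr (c + k * z))) (at z)" for m
  proof (cases "d m = 0")
    case False
    hence p: "d m > 0" using s(2)[of m] by simp
    show ?thesis unfolding powr_of_pos[OF p]
      by (auto intro!: derivative_eq_intros)
  qed simp
  have "((\<lambda>z. conj_diag U (\<lambda>m. of_real (d m) powr (c + k * z)) $ i $ j) has_field_derivative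
     (\<Sum>m\<in>UNIV. U $ i $ m * (k * (of_real (ln (d m)) * of_real (d m) powr (c + k * z))) * cnj (U $ j $ m))) (at z)"
    unfolding conj_diag_nth by (intro DERIV_sum DERIV_cmult_right DERIV_cmult d)
  also have "(\<Sum>m\<in>UNIV. U $ i $ m * (k * (of_real (ln (d m)) * of_real (d m) powr (c + k * z))) * cnj (U $ j $ m))
     = k * conj_diag U (\<lambda>m. of_real (ln (d m)) * of_real (d m) powr (c + k * z)) $ i $ j"
    unfolding conj_diag_nth by (simp add: sum_distrib_left mult_ac)
  finally show ?thesis
    unfolding mpow_def mlog_def s(4) conj_diag_mult[OF s(1)]
    by (simp add: matrix_mult_nth mat_def if_distrib[where f = "\<lambda>x. x * _"] cong: if_cong)
qed

lemma mpow_bounded: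
  "\<exists>B. \<forall>z. \<bar>Re z\<bar> \<le> r \<longrightarrow> norm (mpow A z $ i $ j) \<le> B"
proof -
  obtain U d where s: "unitary U" "\<And>i. d i \<ge> 0" "A = conj_diag U (\<lambda>i. of_real (d i))"
    "\<And>f. mfun f A = conj_diag U (\<lambda>i. f (d i))" using psd_spectral[OF A] by metis
  have b: "norm (complex_of_real (d m) powr z) \<le> exp (r * \<bar>ln (d m)\<bar>)" if "\<bar>Re z\<bar> \<le> r" for m z
  proof (cases "d m = 0")
    case False
    hence p: "d m > 0" using s(2)[of m] by simp
    have "Re z * ln (d m) \<le> \<bar>Re z\<bar> * \<bar>ln (d m)\<bar>" by (metis abs_ge_self abs_mult)
    also have "\<dots> \<le> r * \<bar>ln (d m)\<bar>" using that by (rule mult_right_mono) simp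
    finally show ?thesis by (simp add: powr_of_pos[OF p])
  qed simp
  have "norm (mpow A z $ i $ j) \<le> (\<Sum>m\<in>UNIV. norm (U $ i $ m) * exp (r * \<bar>ln (d m)\<bar>) * norm (U $ j $ m))"
    if "\<bar>Re z\<bar> \<le> r" for z
    unfolding mpow_def s(4) conj_diag_nth
    by (rule order_trans[OF norm_sum])
      (auto simp: norm_mult intro!: sum_mono mult_mono b that)
  thus ?thesis by blast
qed

end

lemma norm_mpow_half: "psd A \<Longrightarrow> (norm (mpow A (1 / 2)))\<^sup>2 = Re (trace A)"
  using trace_adj_mult_self[of "mpow A (1 / 2)"]
  by (simp add: adj_mpow mpow_add[symmetric] mpow_1)

section \<open>Trace norm and fidelity\<close>

text \<open>Expanding the trace in an eigenbasis of \<open>adj Z ** Z\<close> avoids polar decompositions.\<close>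

lemma norm_trace_contraction_le_trace_norm:
  fixes V Z :: "'n::finite cmat"
  assumes V: "contraction V"
  shows "norm (trace (V ** Z)) \<le> trace_norm Z"
proof -
  obtain U d where s: "unitary U" "\<And>i. d i \<ge> 0" "adj Z ** Z = conj_diag U (\<lambda>i. of_real (d i))"
    "\<And>f. mfun f (adj Z ** Z) = conj_diag U (\<lambda>i. f (d i))"
    using psd_spectral[OF psd_adj_mult_self] by metis
  have tn: "trace_norm Z = (\<Sum>i\<in>UNIV. sqrt (d i))"
    unfolding trace_norm_def msqrt_def s(4) trace_conj_diag[OF s(1)] by simp
  \<comment> \<open>The columns of \<open>Z ** U\<close> are orthogonal, and their lengths are the
    singular values of Z.\<close>
  have col: "norm (column i (Z ** U)) = sqrt (d i)" for i
  proof -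
    have "adj (Z ** U) ** (Z ** U) = adj U ** (adj Z ** Z) ** U"
      by (simp add: adj_mult matrix_mul_assoc)
    also have "\<dots> = diag (\<lambda>i. of_real (d i))"
      unfolding s(3) conj_diag_def
      by (simp add: matrix_mul_assoc[symmetric] unitary_cancel[OF s(1)])
    finally have "(adj (Z ** U) ** (Z ** U)) $ i $ i = of_real (d i)" by (simp add: diag_nth)
    hence "cinner (column i (Z ** U)) (column i (Z ** U)) = of_real (d i)"
      by (subst (asm) matrix_mult_nth) (simp add: cinner_def column_def)
    hence "(norm (column i (Z ** U)))\<^sup>2 = d i" by (simp only: cinner_self of_real_eq_iff)
    thus ?thesis by (metis norm_ge_zero real_sqrt_abs abs_of_nonneg)
  qed
  have colU: "norm (column i U) = 1" for i
  proof -
    have "(adj U ** U) $ i $ i = 1" using s(1) by (simp add: unitary_def mat_def)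
    hence "cinner (column i U) (column i U) = 1"
      by (subst (asm) matrix_mult_nth) (simp add: cinner_def column_def)
    hence "(norm (column i U))\<^sup>2 = 1" by (simp only: cinner_self of_real_eq_1_iff)
    thus ?thesis by (simp add: power2_eq_1_iff) (metis norm_ge_zero not_one_le_zero neg_0_le_iff_le)
  qed
  have "trace (V ** Z) = trace (adj U ** (V ** (Z ** U)))"
    by (subst trace_mul_sym) (simp add: matrix_mul_assoc[symmetric] unitary_cancel[OF s(1)])
  also have "\<dots> = (\<Sum>i\<in>UNIV. cinner (column i U) (V *v column i (Z ** U)))"
    unfolding trace_eq matrix_mult_nth[of "adj U"] column_mult[symmetric]
    by (simp add: cinner_def column_def)
  finally have "norm (trace (V ** Z)) \<le> (\<Sum>i\<in>UNIV. norm (cinner (column i U) (V *v column i (Z ** U))))"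
    by (simp add: norm_sum)
  also have "\<dots> \<le> (\<Sum>i\<in>UNIV. sqrt (d i))"
  proof (rule sum_mono)
    fix i
    have "norm (cinner (column i U) (V *v column i (Z ** U))) \<le> 1 * norm (V *v column i (Z ** U))"
      using norm_cinner_le colU by metis
    also have "\<dots> \<le> sqrt (d i)" using V col by (metis contraction_def mult_1)
    finally show "norm (cinner (column i U) (V *v column i (Z ** U))) \<le> sqrt (d i)" .
  qed
  finally show ?thesis by (simp add: tn)
qed

lemma matrix_diff_mult_diff:
  fixes X Y X' Y' :: "'n::finite cmat"
  shows "(X - Y) ** (X' - Y') = X ** X' - X ** Y' - Y ** X' + Y ** Y'"
  by (simp add: vec_eq_iff matrix_mult_nth algebra_simps sum.distrib sum_subtractf)

text \<open>A polar decomposition with a generalized inverse: \<open>C ** adj C\<close> is the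
  support projection of \<open>W ** adj W\<close>, so \<open>adj C\<close> is a contraction, and
  with it C.\<close>

lemma mult_adj_factor:
  fixes W :: "'n::finite cmat"
  obtains C where "contraction C" "W = msqrt (W ** adj W) ** C"
proof -
  define R where "R = W ** adj W"
  have R: "psd R" using psd_adj_mult_self[of "adj W"] by (simp add: R_def)
  define C where "C = mpow R (- (1 / 2)) ** W"
  have "contraction (adj C)"
  proof -
    have "C ** adj C = mpow R (- (1 / 2)) ** (W ** adj W) ** mpow R (- (1 / 2))"
      by (simp add: C_def adj_mult adj_mpow[OF R] matrix_mul_assoc)
    also have "W ** adj W = mpow R 1" using mpow_1[OF R] by (simp add: R_def)
    also have "mpow R (- (1 / 2)) ** mpow R 1 ** mpow R (- (1 / 2)) = mpow R 0" by (simp add: mpow_add[OF R, symmetric])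
    finally have e: "C ** adj C = mpow R 0" .
    show ?thesis unfolding contraction_def
    proof
      fix v
      have "(norm (adj C *v v))\<^sup>2 = norm (cinner (adj C *v v) (adj C *v v))"
        by (simp add: cinner_self norm_power)
      also have "cinner (adj C *v v) (adj C *v v) = cinner v (mpow R 0 *v v)"
        unfolding e[symmetric] matrix_vector_mul_assoc' by (rule cinner_adj[symmetric])
      also have "norm (cinner v (mpow R 0 *v v)) \<le> norm v * norm (mpow R 0 *v v)"
        by (rule norm_cinner_le)
      also have "\<dots> \<le> norm v * norm v"
        using contraction_mpow[OF R, of 0] by (intro mult_left_mono) (auto simp: contraction_def)
      finally show "norm (adj C *v v) \<le> norm v"
        by (simp add: power2_eq_square[symmetric])
    qed
  qed
  hence C: "contraction C" using contraction_adj by fastforce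
  \<comment> \<open>The part of W outside the support of R. With P the support projection,
    \<open>N ** adj N\<close> is (1 - P) R (1 - P) = 0.\<close>
  define N where "N = W - mpow R 0 ** W"
  have "N ** adj N = R - R ** mpow R 0 - mpow R 0 ** R + mpow R 0 ** R ** mpow R 0"
  proof -
    have "adj N = adj W - adj W ** mpow R 0"
      using adj_mult[of "mpow R 0" W] by (simp add: N_def vec_eq_iff adj_mpow[OF R])
    thus ?thesis by (simp add: N_def matrix_diff_mult_diff R_def matrix_mul_assoc)
  qed
  also have "\<dots> = 0"
    using mpow_0_mult[OF R, of 1] mult_mpow_0[OF R, of 1] by (simp add: mpow_1[OF R])
  finally have "N = 0" by (rule mult_adj_eq_0)
  hence "W = mpow R (1 / 2 + - (1 / 2)) ** W" by (simp add: N_def)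
  hence "W = msqrt R ** C"
    unfolding mpow_add[OF R] C_def msqrt_eq_mpow[OF R] by (simp add: matrix_mul_assoc)
  with C show ?thesis using that unfolding R_def by blast
qed

text \<open>One half of Uhlmann's theorem. After W is factored as its positive part times a
  contraction, cycling the trace leaves a contraction against the product of the two square roots,
  which the trace norm bounds.\<close>

lemma norm_trace_le_fidelity:
  fixes W V \<rho> :: "'n::finite cmat"
  assumes V: "contraction V"
  shows "(norm (trace (W ** V ** msqrt \<rho>)))\<^sup>2 \<le> fidelity \<rho> (W ** adj W)"
proof -
  obtain C where C: "contraction C" "W = msqrt (W ** adj W) ** C" by (rule mult_adj_factor)
  let ?S = "msqrt (W ** adj W)"
  have "trace (W ** V ** msqrt \<rho>) = trace (?S ** (C ** V ** msqrt \<rho>))"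
    by (subst C(2)) (simp add: matrix_mul_assoc)
  also have "\<dots> = trace ((C ** V) ** (msqrt \<rho> ** ?S))"
    by (subst trace_mul_sym) (simp add: matrix_mul_assoc)
  finally have "norm (trace (W ** V ** msqrt \<rho>)) \<le> trace_norm (msqrt \<rho> ** ?S)"
    using norm_trace_contraction_le_trace_norm[OF contraction_mult[OF C(1) V]] by simp
  thus ?thesis unfolding fidelity_def by (intro power_mono) auto
qed

section \<open>Products of complex powers\<close>

lemma norm_matrix_mult_le: "norm (A ** B) \<le> norm A * norm (B :: 'n::finite cmat)"
proof (rule power2_le_imp_le)
  have "(norm (A ** B))\<^sup>2 = (\<Sum>i\<in>UNIV. \<Sum>j\<in>UNIV. (norm ((A ** B) $ i $ j))\<^sup>2)"
    by (simp add: norm_vec_def L2_set_def sum_nonneg)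
  also have "\<dots> \<le> (\<Sum>i\<in>UNIV. \<Sum>j\<in>UNIV. (norm (A $ i))\<^sup>2 * (norm (column j B))\<^sup>2)"
  proof (intro sum_mono)
    fix i j
    have "(A ** B) $ i $ j = cinner (\<chi> k. cnj (A $ i $ k)) (column j B)"
      by (simp add: cinner_def matrix_mult_nth column_def)
    moreover have "norm (\<chi> k. cnj (A $ i $ k)) = norm (A $ i)" by (simp add: norm_vec_def)
    ultimately have "norm ((A ** B) $ i $ j) \<le> norm (A $ i) * norm (column j B)"
      using norm_cinner_le by metis
    thus "(norm ((A ** B) $ i $ j))\<^sup>2 \<le> (norm (A $ i))\<^sup>2 * (norm (column j B))\<^sup>2"
      unfolding power_mult_distrib[symmetric] by (intro power_mono) auto
  qed
  also have "\<dots> = (\<Sum>i\<in>UNIV. (norm (A $ i))\<^sup>2) * (norm B)\<^sup>2"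
    by (simp add: norm_power2_eq_sum_columns sum_product)
  also have "(\<Sum>i\<in>UNIV. (norm (A $ i))\<^sup>2) = (norm A)\<^sup>2"
    by (simp add: norm_vec_def[of A] L2_set_def sum_nonneg)
  finally show "(norm (A ** B))\<^sup>2 \<le> (norm A * norm B)\<^sup>2" by (simp add: power_mult_distrib)
qed simp

lemma norm_matrix_le_sum: "norm (A :: 'n::finite cmat) \<le> (\<Sum>i\<in>UNIV. \<Sum>j\<in>UNIV. norm (A $ i $ j))"
proof -
  have "norm A \<le> (\<Sum>i\<in>UNIV. norm (A $ i))"
    unfolding norm_vec_def[of A] by (rule L2_set_le_sum) simp
  also have "\<dots> \<le> (\<Sum>i\<in>UNIV. \<Sum>j\<in>UNIV. norm (A $ i $ j))"
    unfolding norm_vec_def[of "A $ _"] by (intro sum_mono L2_set_le_sum) simp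
  finally show ?thesis .
qed

text \<open>Entrywise, because holomorphy and field derivatives concern complex-valued
  functions.\<close>

definition mat_entire :: "(complex \<Rightarrow> 'n::finite cmat) \<Rightarrow> bool" where
  "mat_entire F \<longleftrightarrow> (\<forall>i j. (\<lambda>z. F z $ i $ j) holomorphic_on UNIV)"

definition strip_bounded :: "(complex \<Rightarrow> 'n::finite cmat) \<Rightarrow> bool" where
  "strip_bounded F \<longleftrightarrow> (\<exists>B. \<forall>z\<in>strip. norm (F z) \<le> B)"

definition has_mat_deriv :: "(complex \<Rightarrow> 'n::finite cmat) \<Rightarrow> 'n cmat \<Rightarrow> bool" where
  "has_mat_deriv F D \<longleftrightarrow> (\<forall>i j. ((\<lambda>z. F z $ i $ j) has_field_derivative D $ i $ j) (at 0))"

lemma mat_entire_mult: "mat_entire F \<Longrightarrow> mat_entire G \<Longrightarrow> mat_entire (\<lambda>z. F z ** G z)"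
  unfolding mat_entire_def matrix_mult_nth by (auto intro!: holomorphic_intros)

lemma mat_entire_const: "mat_entire (\<lambda>z. A)"
  by (simp add: mat_entire_def)

lemma strip_bounded_mult:
  assumes "strip_bounded F" "strip_bounded G" shows "strip_bounded (\<lambda>z. F z ** G z)"
proof -
  obtain B C where B: "\<And>z. z \<in> strip \<Longrightarrow> norm (F z) \<le> B" "\<And>z. z \<in> strip \<Longrightarrow> norm (G z) \<le> C"
    using assms unfolding strip_bounded_def by blast
  have "norm (F z ** G z) \<le> B * C" if "z \<in> strip" for z
    using norm_matrix_mult_le[of "F z" "G z"] mult_mono[OF B(1)[OF that] B(2)[OF that]]
      order_trans[OF norm_ge_zero B(1)[OF that]] by simp
  thus ?thesis unfolding strip_bounded_def by blast
qed

lemma strip_bounded_const: "strip_bounded (\<lambda>z. A)"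
  unfolding strip_bounded_def by blast

lemma strip_bounded_entries:
  fixes F :: "complex \<Rightarrow> 'n::finite cmat"
  assumes "\<And>i j. \<exists>B. \<forall>z\<in>strip. norm (F z $ i $ j) \<le> B"
  shows "strip_bounded F"
proof -
  obtain B where B: "\<And>i j z. z \<in> strip \<Longrightarrow> norm (F z $ i $ j) \<le> B i j"
    using assms by metis
  have "norm (F z) \<le> (\<Sum>i\<in>UNIV. \<Sum>j\<in>UNIV. B i j)" if "z \<in> strip" for z
    by (rule order_trans[OF norm_matrix_le_sum]) (intro sum_mono B that)
  thus ?thesis unfolding strip_bounded_def by blast
qed

lemma has_mat_deriv_mult:
  fixes F G :: "complex \<Rightarrow> 'n::finite cmat"
  assumes "has_mat_deriv F D" "has_mat_deriv G E"
  shows "has_mat_deriv (\<lambda>z. F z ** G z) (D ** G 0 + F 0 ** E)"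
proof -
  have "((\<lambda>z. (F z ** G z) $ i $ j) has_field_derivative (D ** G 0 + F 0 ** E) $ i $ j) (at 0)" for i j
  proof -
    have "((\<lambda>z. \<Sum>k\<in>UNIV. F z $ i $ k * G z $ k $ j) has_field_derivative
      (\<Sum>k\<in>UNIV. F 0 $ i $ k * E $ k $ j + D $ i $ k * G 0 $ k $ j)) (at 0)"
      using assms unfolding has_mat_deriv_def by (intro DERIV_sum DERIV_mult') auto
    also have "(\<Sum>k\<in>UNIV. F 0 $ i $ k * E $ k $ j + D $ i $ k * G 0 $ k $ j)
      = (D ** G 0 + F 0 ** E) $ i $ j"
      unfolding sum.distrib vector_add_component matrix_mult_nth by (rule add.commute)
    finally show ?thesis unfolding matrix_mult_nth .
  qed
  thus ?thesis unfolding has_mat_deriv_def by blast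
qed

lemma has_mat_deriv_const: "has_mat_deriv (\<lambda>z. A) 0"
  by (simp add: has_mat_deriv_def)

lemma has_mat_deriv_trace:
  assumes "has_mat_deriv F D"
  shows "((\<lambda>z. trace (F z)) has_field_derivative trace D) (at 0)"
  using assms unfolding has_mat_deriv_def trace_eq by (intro DERIV_sum) auto

lemma mat_entire_trace: "mat_entire F \<Longrightarrow> (\<lambda>z. trace (F z)) holomorphic_on UNIV"
  unfolding mat_entire_def trace_eq by (intro holomorphic_intros) auto

lemma strip_bounded_trace:
  assumes "strip_bounded F"
  obtains B where "\<And>z. z \<in> strip \<Longrightarrow> norm (trace (F z)) \<le> B"
proof -
  obtain C where C: "\<And>z. z \<in> strip \<Longrightarrow> norm (F z) \<le> C"
    using assms unfolding strip_bounded_def by blast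
  have "norm (trace (F z)) \<le> norm (mat 1 :: 'a cmat) * C" if "z \<in> strip" for z
    using norm_trace_mult_le[of "mat 1" "F z"] mult_left_mono[OF C[OF that], of "norm (mat 1 :: 'a cmat)"]
    by simp
  thus ?thesis using that by blast
qed

lemma mat_entire_mpow: "psd A \<Longrightarrow> mat_entire (\<lambda>z. mpow A (c + k * z))"
  unfolding mat_entire_def holomorphic_on_def field_differentiable_def
  using has_derivative_mpow has_field_derivative_at_within by blast

lemma has_mat_deriv_mpow: "psd A \<Longrightarrow> has_mat_deriv (\<lambda>z. mpow A (c + k * z)) (mat k ** (mlog A ** mpow A c))"
  unfolding has_mat_deriv_def using has_derivative_mpow[of A c k _ _ 0] by simp

lemma strip_bounded_mpow:
  assumes A: "psd A" and k: "k \<in> \<real>" shows "strip_bounded (\<lambda>z. mpow A (c + k * z))"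
proof (rule strip_bounded_entries)
  fix i j
  obtain r where r: "k = of_real r" using k by (auto elim: Reals_cases)
  obtain B where B: "\<And>z. \<bar>Re z\<bar> \<le> \<bar>Re c\<bar> + \<bar>r\<bar> \<Longrightarrow> norm (mpow A z $ i $ j) \<le> B"
    using mpow_bounded[OF A] by blast
  have "norm (mpow A (c + k * z) $ i $ j) \<le> B" if "z \<in> strip" for z
  proof (rule B)
    have "\<bar>r * Re z\<bar> \<le> \<bar>r\<bar>"
      using that by (simp add: strip_def abs_mult mult_left_le)
    thus "\<bar>Re (c + k * z)\<bar> \<le> \<bar>Re c\<bar> + \<bar>r\<bar>" by (simp add: r)
  qed
  thus "\<exists>B. \<forall>z\<in>strip. norm (mpow A (c + k * z) $ i $ j) \<le> B" by blast
qed

lemma trace_mat_mult: "trace (mat k ** A) = k * trace A"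
  by (simp add: trace_eq matrix_mult_nth mat_def if_distrib[where f = "\<lambda>x. x * _"] sum_distrib_left cong: if_cong)

lemma matrix_mult_add_right: "(A + B) ** C = A ** C + B ** (C :: 'n::finite cmat)"
  by (simp add: vec_eq_iff matrix_mult_nth distrib_right sum.distrib)

lemma trace_mult_cycle: "trace (A ** B ** C) = trace (B ** C ** (A :: 'n::finite cmat))"
  by (metis matrix_mul_assoc trace_mul_sym)

text \<open>The list form lets growth, holomorphy and derivative of the five-factor product W be
  proved by one induction each.\<close>

fun mpow_prod :: "('n::finite cmat \<times> complex) list \<Rightarrow> complex \<Rightarrow> 'n cmat" where
  "mpow_prod [] z = mat 1"
| "mpow_prod ((A, k) # L) z = mpow A (k * z) ** mpow_prod L z"

lemma mpow_prod_fun: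
  "mpow_prod [] = (\<lambda>z. mat 1)"
  "mpow_prod ((A, k) # L) = (\<lambda>z. mpow A (k * z) ** mpow_prod L z)"
  by (simp_all add: fun_eq_iff)

text \<open>The support of A contains that of \<open>\<rho>\<close>. The projection to which a power
  of A degenerates at exponent 0 is then absorbed by \<open>\<rho>\<close> on either side.\<close>

definition supported :: "'n::finite cmat \<Rightarrow> 'n cmat \<Rightarrow> bool" where
  "supported \<rho> A \<longleftrightarrow> psd A \<and> mpow A 0 ** \<rho> = \<rho> \<and> \<rho> ** mpow A 0 = \<rho>"

context
  fixes L :: "('n::finite cmat \<times> complex) list" and \<rho> :: "'n cmat"
  assumes L: "\<forall>(A, k)\<in>set L. supported \<rho> A \<and> k \<in> \<real>"
begin

lemma mat_entire_mpow_prod: "mat_entire (mpow_prod L)"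
  using L
proof (induction L)
  case (Cons a L)
  obtain A k where a: "a = (A, k)" by fastforce
  show ?case
    using mat_entire_mult[OF mat_entire_mpow[of A 0 k] Cons.IH] Cons.prems
    by (simp add: a supported_def mpow_prod_fun)
qed (simp add: mat_entire_const mpow_prod_fun)

lemma strip_bounded_mpow_prod: "strip_bounded (mpow_prod L)"
  using L
proof (induction L)
  case (Cons a L)
  obtain A k where a: "a = (A, k)" by fastforce
  show ?case
    using strip_bounded_mult[OF strip_bounded_mpow[of A k 0] Cons.IH] Cons.prems
    by (simp add: a supported_def mpow_prod_fun)
qed (simp add: strip_bounded_const mpow_prod_fun)

lemma contraction_mpow_prod: "Re z = 0 \<Longrightarrow> contraction (mpow_prod L z)"
  using L
proof (induction L)
  case (Cons a L)
  obtain A k where a: "a = (A, k)" by fastforce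
  have "Re (k * z) = 0" using Cons.prems by (auto simp: a elim!: Reals_cases)
  thus ?case
    using contraction_mult[OF contraction_mpow[of A "k * z"] Cons.IH] Cons.prems
    by (simp add: a supported_def)
qed (simp add: contraction_mat_1)

lemma mpow_prod_0: "mpow_prod L 0 ** \<rho> = \<rho>" "\<rho> ** mpow_prod L 0 = \<rho>"
  using L
proof (induction L)
  case (Cons a L)
  obtain A k where a: "a = (A, k)" by fastforce
  { case 1 thus ?case using Cons.IH by (simp add: a supported_def matrix_mul_assoc[symmetric]) }
  { case 2 thus ?case using Cons.IH by (simp add: a supported_def matrix_mul_assoc) }
qed simp_all

end

text \<open>By the product rule each summand has one logarithm surrounded by support projections.
  Under the trace against \<open>\<rho>\<close> those on the right are absorbed directly and those
  on the left by cyclicity, so noncommuting factors contribute additively.\<close>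

lemma has_mat_deriv_mpow_prod:
  assumes "\<forall>(A, k)\<in>set L. supported \<rho> A \<and> k \<in> \<real>"
  shows "\<exists>D. has_mat_deriv (mpow_prod L) D \<and> trace (D ** \<rho>) = (\<Sum>(A, k)\<leftarrow>L. k * trace (\<rho> ** mlog A))"
  using assms
proof (induction L)
  case Nil
  show ?case using has_mat_deriv_const[of "mat 1"]
    by (intro exI[of _ 0]) (simp add: trace_eq mpow_prod_fun)
next
  case (Cons a L)
  obtain A k where a: "a = (A, k)" by fastforce
  have A: "psd A" "mpow A 0 ** \<rho> = \<rho>" "\<rho> ** mpow A 0 = \<rho>"
    using Cons.prems by (auto simp: a supported_def)
  obtain D where D: "has_mat_deriv (mpow_prod L) D" "trace (D ** \<rho>) = (\<Sum>(A, k)\<leftarrow>L. k * trace (\<rho> ** mlog A))"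
    using Cons by auto
  let ?D = "mat k ** (mlog A ** mpow A 0) ** mpow_prod L 0 + mpow A 0 ** D"
  have "has_mat_deriv (mpow_prod (a # L)) ?D"
    using has_mat_deriv_mult[OF has_mat_deriv_mpow[OF A(1), of 0 k] D(1)] by (simp add: a mpow_prod_fun)
  moreover have "trace (?D ** \<rho>) = (\<Sum>(A, k)\<leftarrow>a # L. k * trace (\<rho> ** mlog A))"
  proof -
    have "mat k ** (mlog A ** mpow A 0) ** mpow_prod L 0 ** \<rho> = mat k ** (mlog A ** \<rho>)"
      using mpow_prod_0(1)[of L \<rho>] Cons.prems A(2) by (simp add: matrix_mul_assoc[symmetric])
    moreover have "trace (mpow A 0 ** D ** \<rho>) = trace (D ** \<rho>)"
      by (subst trace_mult_cycle) (simp add: matrix_mul_assoc[symmetric] A(3))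
    ultimately show ?thesis
      by (simp add: matrix_mult_add_right trace_add trace_mat_mult D(2) a trace_mul_sym[of "mlog A"])
  qed
  ultimately show ?case by blast
qed

text \<open>Combinations with complex coefficients over an index set; they serve both for weighted
  POVM effects and for expansions in matrix units.\<close>

definition mat_comb :: "'i set \<Rightarrow> ('i \<Rightarrow> complex) \<Rightarrow> ('i \<Rightarrow> 'n::finite cmat) \<Rightarrow> 'n cmat" where
  "mat_comb I c E = (\<chi> r s. \<Sum>i\<in>I. c i * E i $ r $ s)"

lemma cinner_mat_comb: "cinner w (mat_comb I c E *v v) = (\<Sum>i\<in>I. c i * cinner w (E i *v v))"
proof -
  have "mat_comb I c E *v v = (\<Sum>i\<in>I. c i *s (E i *v v))"
    by (simp add: vec_eq_iff mat_comb_def matrix_vector_mult_def sum_distrib_left sum_distrib_right mult.assoc)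
      (intro allI sum.swap)
  moreover have "cinner w (\<Sum>i\<in>I. f i) = (\<Sum>i\<in>I. cinner w (f i))" for f
    by (induction I rule: infinite_finite_induct) (auto simp: cinner_add_right)
  ultimately show ?thesis by (simp add: cinner_scale_right)
qed

text \<open>Kadison's inequality for the unital positive map sending the unit vectors to the effects.\<close>

lemma norm_mat_comb_povm:
  assumes I: "finite I" and E: "\<And>i. i \<in> I \<Longrightarrow> psd (E i)" and one: "mat_comb I (\<lambda>_. 1) E = mat 1"
  shows "(norm (mat_comb I c E *v v))\<^sup>2 \<le> (\<Sum>i\<in>I. (norm (c i))\<^sup>2 * Re (cinner v (E i *v v)))"
proof -
  define w where "w = mat_comb I c E *v v"
  let ?q = "\<lambda>i. mpow (E i) (1 / 2)"
  have half: "cinner x (E i *v y) = cinner (?q i *v x) (?q i *v y)" if "i \<in> I" for i x y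
  proof -
    have "E i = ?q i ** ?q i"
      using E[OF that] by (simp add: mpow_add[symmetric] mpow_1)
    moreover have "adj (?q i) = ?q i" using E[OF that] by (simp add: adj_mpow)
    ultimately show ?thesis by (metis cinner_adj matrix_vector_mul_assoc)
  qed
  have sq: "(norm (?q i *v x))\<^sup>2 = Re (cinner x (E i *v x))" if "i \<in> I" for i x
    by (simp add: half[OF that] cinner_self)
  have total: "(\<Sum>i\<in>I. (norm (?q i *v x))\<^sup>2) = (norm x)\<^sup>2" for x
  proof -
    have "cinner x x = (\<Sum>i\<in>I. cinner x (E i *v x))"
      using cinner_mat_comb[of x I "\<lambda>_. 1" E x] by (simp add: one)
    hence "(norm x)\<^sup>2 = (\<Sum>i\<in>I. Re (cinner x (E i *v x)))"
      by (metis Re_complex_of_real Re_sum cinner_self)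
    thus ?thesis by (simp add: sq)
  qed
  let ?X = "\<Sum>i\<in>I. (norm (c i))\<^sup>2 * Re (cinner v (E i *v v))"
  \<comment> \<open>Splitting each effect into two square roots and applying Cauchy-Schwarz over the
    effects leaves the norm of w as one factor, since the effects sum to the identity.\<close>
  have "(norm w)\<^sup>2 = norm (cinner w w)" by (simp add: cinner_self norm_power)
  also have "\<dots> = norm (\<Sum>i\<in>I. c i * cinner w (E i *v v))"
    by (subst (2) w_def) (simp add: cinner_mat_comb)
  also have "\<dots> \<le> (\<Sum>i\<in>I. \<bar>norm (c i) * norm (?q i *v v)\<bar> * \<bar>norm (?q i *v w)\<bar>)"
  proof (rule order_trans[OF norm_sum], rule sum_mono)
    fix i assume i: "i \<in> I"
    show "norm (c i * cinner w (E i *v v)) \<le> \<bar>norm (c i) * norm (?q i *v v)\<bar> * \<bar>norm (?q i *v w)\<bar>"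
      using mult_left_mono[OF norm_cinner_le[of "?q i *v w" "?q i *v v"], of "norm (c i)"]
      by (simp add: half[OF i] norm_mult mult_ac)
  qed
  also have "\<dots> \<le> L2_set (\<lambda>i. norm (c i) * norm (?q i *v v)) I * L2_set (\<lambda>i. norm (?q i *v w)) I"
    by (rule L2_set_mult_ineq)
  also have "L2_set (\<lambda>i. norm (?q i *v w)) I = norm w"
    by (simp add: L2_set_def total)
  also have "L2_set (\<lambda>i. norm (c i) * norm (?q i *v v)) I = sqrt ?X"
    by (simp add: L2_set_def power_mult_distrib sq)
  finally have "(norm w)\<^sup>2 \<le> sqrt ?X * norm w" .
  hence "norm w \<le> sqrt ?X"
    by (cases "norm w = 0") (auto simp: power2_eq_square intro!: sum_nonneg mult_nonneg_nonneg
        dest: E[unfolded psd_iff_cinner])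
  moreover have "0 \<le> ?X"
    using E by (intro sum_nonneg mult_nonneg_nonneg) (auto simp: psd_iff_cinner)
  ultimately show ?thesis
    using power_mono[of "norm w" "sqrt ?X" 2] by (simp add: w_def)
qed

lemma contraction_mat_comb_povm:
  assumes I: "finite I" and E: "\<And>i. i \<in> I \<Longrightarrow> psd (E i)" and one: "mat_comb I (\<lambda>_. 1) E = mat 1"
    and c: "\<And>i. i \<in> I \<Longrightarrow> norm (c i) = 1"
  shows "contraction (mat_comb I c E)"
  unfolding contraction_def
proof (intro allI, rule power2_le_imp_le)
  fix v
  have "(norm (mat_comb I c E *v v))\<^sup>2 \<le> (\<Sum>i\<in>I. (norm (c i))\<^sup>2 * Re (cinner v (E i *v v)))"
    by (rule norm_mat_comb_povm[OF I E one])
  also have "\<dots> = Re (\<Sum>i\<in>I. 1 * cinner v (E i *v v))" using c by simp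
  also have "\<dots> = Re (cinner v v)" by (simp only: cinner_mat_comb[symmetric] one matrix_vector_mul_lid)
  finally show "(norm (mat_comb I c E *v v))\<^sup>2 \<le> (norm v)\<^sup>2" by (simp add: cinner_self)
qed simp

lemma norm_mat_comb_povm_mult:
  assumes I: "finite I" and E: "\<And>i. i \<in> I \<Longrightarrow> psd (E i)" and one: "mat_comb I (\<lambda>_. 1) E = mat 1"
  shows "(norm (mat_comb I c E ** W))\<^sup>2 \<le> (\<Sum>i\<in>I. (norm (c i))\<^sup>2 * Re (trace (W ** adj W ** E i)))"
proof -
  have "(norm (mat_comb I c E ** W))\<^sup>2
      \<le> (\<Sum>j\<in>UNIV. \<Sum>i\<in>I. (norm (c i))\<^sup>2 * Re (cinner (column j W) (E i *v column j W)))"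
    unfolding norm_power2_eq_sum_columns column_mult
    by (intro sum_mono norm_mat_comb_povm[OF I E one])
  also have "\<dots> = (\<Sum>i\<in>I. (norm (c i))\<^sup>2 * (\<Sum>j\<in>UNIV. Re (cinner (column j W) (E i *v column j W))))"
    by (subst sum.swap) (simp add: sum_distrib_left)
  also have "\<dots> = (\<Sum>i\<in>I. (norm (c i))\<^sup>2 * Re (trace (W ** adj W ** E i)))"
  proof (rule sum.cong[OF refl])
    fix i
    have "trace (W ** adj W ** E i) = trace (adj W ** (E i ** W))"
      by (subst trace_mult_cycle) (simp only: matrix_mul_assoc)
    also have "\<dots> = (\<Sum>j\<in>UNIV. cinner (column j W) (E i *v column j W))"
      unfolding trace_eq matrix_mult_nth[of "adj W"] column_mult[symmetric]
      by (simp add: cinner_def column_def)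
    finally show "(norm (c i))\<^sup>2 * (\<Sum>j\<in>UNIV. Re (cinner (column j W) (E i *v column j W)))
      = (norm (c i))\<^sup>2 * Re (trace (W ** adj W ** E i))" by simp
  qed
  finally show ?thesis .
qed

section \<open>The interpolating function\<close>

lemma mat_entire_mat_comb: "mat_entire (\<lambda>z. mat_comb I (\<lambda>i. exp (z * c i)) E)"
  unfolding mat_entire_def mat_comb_def vec_lambda_beta by (intro allI holomorphic_intros)

lemma strip_bounded_mat_comb:
  "strip_bounded (\<lambda>z. mat_comb I (\<lambda>i. exp (z * of_real (c i))) (E :: 'i \<Rightarrow> 'n::finite cmat))"
proof (rule strip_bounded_entries)
  fix r s
  have "norm (mat_comb I (\<lambda>i. exp (z * of_real (c i))) E $ r $ s) \<le> (\<Sum>i\<in>I. exp \<bar>c i\<bar> * norm (E i $ r $ s))"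
    if "z \<in> strip" for z
    unfolding mat_comb_def vec_lambda_beta
  proof (rule order_trans[OF norm_sum], rule sum_mono)
    fix i
    have "Re z * c i \<le> \<bar>Re z\<bar> * \<bar>c i\<bar>" by (metis abs_ge_self abs_mult)
    also have "\<dots> \<le> 1 * \<bar>c i\<bar>" using that by (intro mult_right_mono) (auto simp: strip_def)
    finally have "norm (exp (z * of_real (c i))) \<le> exp \<bar>c i\<bar>" by simp
    thus "norm (exp (z * of_real (c i)) * E i $ r $ s) \<le> exp \<bar>c i\<bar> * norm (E i $ r $ s)"
      unfolding norm_mult by (intro mult_right_mono) auto
  qed
  thus "\<exists>B. \<forall>z\<in>strip. norm (mat_comb I (\<lambda>i. exp (z * of_real (c i))) E $ r $ s) \<le> B" by blast
qed

lemma has_mat_deriv_mat_comb: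
  "has_mat_deriv (\<lambda>z. mat_comb I (\<lambda>i. exp (z * c i)) E) (mat_comb I c E)"
proof -
  have "((\<lambda>z. \<Sum>i\<in>I. exp (z * c i) * E i $ r $ s) has_field_derivative (\<Sum>i\<in>I. c i * E i $ r $ s)) (at 0)" for r s
  proof (intro DERIV_sum DERIV_cmult_right)
    fix i
    show "((\<lambda>z. exp (z * c i)) has_field_derivative c i) (at 0)"
      by (auto intro!: derivative_eq_intros)
  qed
  thus ?thesis unfolding has_mat_deriv_def mat_comb_def vec_lambda_beta by blast
qed

lemma trace_mat_comb_mult: "trace (mat_comb I c E ** B) = (\<Sum>i\<in>I. c i * trace (E i ** B))"
proof -
  have "trace (mat_comb I c E ** B) = (\<Sum>r\<in>UNIV. \<Sum>s\<in>UNIV. \<Sum>i\<in>I. c i * (E i $ r $ s * B $ s $ r))"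
    by (simp add: trace_eq matrix_mult_nth mat_comb_def sum_distrib_right mult.assoc)
  also have "\<dots> = (\<Sum>r\<in>UNIV. \<Sum>i\<in>I. \<Sum>s\<in>UNIV. c i * (E i $ r $ s * B $ s $ r))"
    by (intro sum.cong[OF refl] sum.swap)
  also have "\<dots> = (\<Sum>i\<in>I. \<Sum>r\<in>UNIV. \<Sum>s\<in>UNIV. c i * (E i $ r $ s * B $ s $ r))"
    by (rule sum.swap)
  finally show ?thesis by (simp add: trace_eq matrix_mult_nth sum_distrib_left)
qed

text \<open>The derivative at 0 of the interpolating function for all weights equal to 0; the last
  term comes from the factor rho^(1 - z/2).\<close>

definition log_deriv :: "('n::finite cmat \<times> complex) list \<Rightarrow> 'n cmat \<Rightarrow> complex" where
  "log_deriv L \<rho> = (\<Sum>(A, k)\<leftarrow>L. k * trace (\<rho> ** mlog A)) - trace (\<rho> ** mlog \<rho>) / 2"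

text \<open>The halves are tuned to Re z = 1: there exp(z a_i / 2) has squared modulus exp(a_i), and
  rho^(1 - z/2) has Hilbert-Schmidt norm at most 1.\<close>

definition interpolant :: "('n::finite cmat \<times> complex) list \<Rightarrow> 'n cmat \<Rightarrow>
    'i set \<Rightarrow> ('i \<Rightarrow> real) \<Rightarrow> ('i \<Rightarrow> 'n cmat) \<Rightarrow> complex \<Rightarrow> complex" where
  "interpolant L \<rho> I a E z =
     trace (mat_comb I (\<lambda>i. exp (z * of_real (a i / 2))) E ** mpow_prod L z ** mpow \<rho> (1 + (- 1 / 2) * z))"

context
  fixes L :: "('n::finite cmat \<times> complex) list" and \<rho> :: "'n cmat"
    and I :: "'i set" and a :: "'i \<Rightarrow> real" and E :: "'i \<Rightarrow> 'n cmat"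
  assumes L: "\<forall>(A, k)\<in>set L. supported \<rho> A \<and> k \<in> \<real>"
    and \<rho>: "psd \<rho>" "trace \<rho> = 1"
    and I: "finite I" and E: "\<forall>i\<in>I. psd (E i)" and one: "mat_comb I (\<lambda>_. 1) E = mat 1"
begin

lemma norm_sqrt_state: "norm (mpow \<rho> (1 / 2)) = 1"
proof -
  have "(norm (mpow \<rho> (1 / 2)))\<^sup>2 = 1" using norm_mpow_half[OF \<rho>(1)] \<rho>(2) by simp
  thus ?thesis by (metis norm_ge_zero power2_eq_imp_eq one_power2 zero_le_one)
qed

lemma interpolant_holomorphic: "interpolant L \<rho> I a E holomorphic_on UNIV"
  unfolding interpolant_def[abs_def]
  by (intro mat_entire_trace mat_entire_mult mat_entire_mat_comb mat_entire_mpow_prod[OF L]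
      mat_entire_mpow \<rho>)

lemma interpolant_bounded:
  obtains B where "\<And>z. z \<in> strip \<Longrightarrow> norm (interpolant L \<rho> I a E z) \<le> B"
proof -
  have "strip_bounded (\<lambda>z. mat_comb I (\<lambda>i. exp (z * of_real (a i / 2))) E ** mpow_prod L z
      ** mpow \<rho> (1 + (- 1 / 2) * z))"
    by (intro strip_bounded_mult strip_bounded_mat_comb strip_bounded_mpow_prod[OF L]
        strip_bounded_mpow \<rho>) simp
  from strip_bounded_trace[OF this] show ?thesis
    using that unfolding interpolant_def by metis
qed

text \<open>On Re z = 0 the last factor is a contraction between two copies of the square root of
  \<open>\<rho>\<close>. These have Hilbert-Schmidt norm 1, all other factors are contractions, and
  Cauchy-Schwarz for the trace applies.\<close>

lemma interpolant_left: "norm (interpolant L \<rho> I a E (Complex 0 y)) \<le> 1"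
proof -
  let ?z = "Complex 0 y"
  let ?\<Omega> = "mat_comb I (\<lambda>i. exp (?z * of_real (a i / 2))) E"
  let ?W = "mpow_prod L ?z" and ?h = "mpow \<rho> (1 / 2)" and ?U = "mpow \<rho> (- ?z / 2)"
  have c: "contraction ?\<Omega>" "contraction ?W" "contraction ?U"
  proof -
    show "contraction ?\<Omega>" by (rule contraction_mat_comb_povm[OF I bspec[OF E] one]) (simp_all only: norm_exp_eq_Re, simp)
    show "contraction ?W" by (rule contraction_mpow_prod[OF L]) simp
    show "contraction ?U" by (rule contraction_mpow[OF \<rho>(1)]) simp
  qed
  have "mpow \<rho> (1 + (- 1 / 2) * ?z) = mpow \<rho> (1 / 2 + (- ?z / 2 + 1 / 2))" by (simp add: add.commute)
  also have "\<dots> = ?h ** (?U ** ?h)" unfolding mpow_add[OF \<rho>(1)] ..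
  finally have "interpolant L \<rho> I a E ?z = trace (?\<Omega> ** (?W ** ?h) ** (?U ** ?h))"
    by (simp add: interpolant_def matrix_mul_assoc)
  hence "norm (interpolant L \<rho> I a E ?z) \<le> norm (?\<Omega> ** (?W ** ?h)) * norm (?U ** ?h)"
    using norm_trace_mult_le by metis
  also have "\<dots> \<le> norm ?h * norm ?h"
    using norm_contraction_mult_left[OF c(1), of "?W ** ?h"] norm_contraction_mult_left[OF c(2), of ?h]
      norm_contraction_mult_left[OF c(3), of ?h]
    by (intro mult_mono) auto
  finally show ?thesis by (simp add: norm_sqrt_state)
qed

lemma interpolant_0: "interpolant L \<rho> I a E 0 = 1"
  by (simp add: interpolant_def one mpow_1[OF \<rho>(1)] mpow_prod_0[OF L] \<rho>(2))

lemma interpolant_deriv: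
  "(interpolant L \<rho> I a E has_field_derivative
     (\<Sum>i\<in>I. of_real (a i / 2) * trace (E i ** \<rho>)) + log_deriv L \<rho>) (at 0)"
proof -
  obtain D where D: "has_mat_deriv (mpow_prod L) D"
    "trace (D ** \<rho>) = (\<Sum>(A, k)\<leftarrow>L. k * trace (\<rho> ** mlog A))"
    using has_mat_deriv_mpow_prod[OF L] by blast
  let ?\<Omega>' = "mat_comb I (\<lambda>i. of_real (a i / 2)) E"
  let ?T = "(?\<Omega>' ** mpow_prod L 0 + mat 1 ** D) ** \<rho>
      + mat 1 ** mpow_prod L 0 ** (mat (- 1 / 2) ** (mlog \<rho> ** \<rho>))"
  have "(interpolant L \<rho> I a E has_field_derivative trace ?T) (at 0)"
    unfolding interpolant_def[abs_def]
    using has_mat_deriv_trace[OF has_mat_deriv_mult[OF has_mat_deriv_mult[OF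
          has_mat_deriv_mat_comb[of I "\<lambda>i. of_real (a i / 2)" E] D(1)]
        has_mat_deriv_mpow[OF \<rho>(1), of 1 "- 1 / 2"]]]
    by (simp add: one mpow_1[OF \<rho>(1)])
  moreover have "trace ?T = (\<Sum>i\<in>I. of_real (a i / 2) * trace (E i ** \<rho>)) + log_deriv L \<rho>"
  proof -
    have "?\<Omega>' ** mpow_prod L 0 ** \<rho> = ?\<Omega>' ** \<rho>"
      by (simp add: matrix_mul_assoc[symmetric] mpow_prod_0[OF L])
    moreover have "trace (mpow_prod L 0 ** (mat (- 1 / 2) ** (mlog \<rho> ** \<rho>)))
        = - 1 / 2 * trace (\<rho> ** mlog \<rho>)"
    proof -
      have "trace (mpow_prod L 0 ** (mat (- 1 / 2) ** (mlog \<rho> ** \<rho>)))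
          = trace (mat (- 1 / 2) ** (mlog \<rho> ** \<rho>) ** mpow_prod L 0)"
        by (rule trace_mul_sym)
      also have "\<dots> = trace (mat (- 1 / 2) ** (mlog \<rho> ** \<rho>))"
        by (simp add: matrix_mul_assoc[symmetric] mpow_prod_0[OF L])
      finally show ?thesis by (simp add: trace_mat_mult trace_mul_sym[of "mlog \<rho>"])
    qed
    ultimately show ?thesis
      by (simp add: matrix_mult_add_right trace_add trace_mat_comb_mult D(2) log_deriv_def)
  qed
  ultimately show ?thesis by simp
qed

lemma interpolant_right:
  "norm (interpolant L \<rho> I a E (Complex 1 y)) \<le>
     norm (mat_comb I (\<lambda>i. exp (Complex 1 y * of_real (a i / 2))) E ** mpow_prod L (Complex 1 y))"
proof -
  let ?z = "Complex 1 y"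
  let ?\<Omega> = "mat_comb I (\<lambda>i. exp (?z * of_real (a i / 2))) E"
  let ?W = "mpow_prod L ?z" and ?h = "mpow \<rho> (1 / 2)" and ?U = "mpow \<rho> (Complex 0 (- y / 2))"
  have "1 + (- 1 / 2) * ?z = Complex 0 (- y / 2) + 1 / 2" by (simp add: complex_eq_iff)
  hence "mpow \<rho> (1 + (- 1 / 2) * ?z) = ?U ** ?h" by (simp only: mpow_add[OF \<rho>(1)])
  hence "norm (interpolant L \<rho> I a E ?z) \<le> norm (?\<Omega> ** ?W) * norm (?U ** ?h)"
    unfolding interpolant_def using norm_trace_mult_le[of "?\<Omega> ** ?W" "?U ** ?h"] by simp
  also have "\<dots> \<le> norm (?\<Omega> ** ?W) * 1"
    using norm_contraction_mult_left[OF contraction_mpow[OF \<rho>(1)], of "Complex 0 (- y / 2)" ?h]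
    by (intro mult_left_mono) (auto simp: norm_sqrt_state)
  finally show ?thesis by simp
qed

end

section \<open>The two integral inequalities for a general product of powers\<close>

definition rotated :: "('n::finite cmat \<times> complex) list \<Rightarrow> real \<Rightarrow> 'n cmat" where
  "rotated L t = mpow_prod L (Complex 1 t) ** adj (mpow_prod L (Complex 1 t))"

lemma continuous_on_matrixI:
  fixes F :: "'s::topological_space \<Rightarrow> 'n::finite cmat"
  assumes "\<And>i j. continuous_on S (\<lambda>t. F t $ i $ j)"
  shows "continuous_on S F"
proof -
  have "continuous_on S (\<lambda>t. \<chi> i j. F t $ i $ j)"
    by (intro continuous_on_vec_lambda assms)
  thus ?thesis by simp
qed

lemma bounded_linear_Re_trace_mult: "bounded_linear (\<lambda>X. Re (trace (X ** (B :: 'n::finite cmat))))"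
proof (rule bounded_linear_intro)
  fix X Y :: "'n cmat" and r :: real
  show "Re (trace ((X + Y) ** B)) = Re (trace (X ** B)) + Re (trace (Y ** B))"
    by (simp add: matrix_mult_add_right trace_add)
  show "Re (trace (r *\<^sub>R X ** B)) = r *\<^sub>R Re (trace (X ** B))"
    by (simp add: trace_eq matrix_mult_nth sum_distrib_left)
  show "norm (Re (trace (X ** B))) \<le> norm X * norm B"
    using abs_Re_le_cmod norm_trace_mult_le order_trans by (metis real_norm_def)
qed

context
  fixes L :: "('n::finite cmat \<times> complex) list" and \<rho> :: "'n cmat"
  assumes L: "\<forall>(A, k)\<in>set L. supported \<rho> A \<and> k \<in> \<real>"
    and \<rho>: "psd \<rho>" "trace \<rho> = 1"
begin

lemma continuous_on_rotated: "continuous_on S (rotated L)"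
proof -
  have c: "continuous_on S (\<lambda>t. mpow_prod L (Complex 1 t) $ i $ j)" for i j
  proof -
    have "continuous_on UNIV (\<lambda>z. mpow_prod L z $ i $ j)"
      using mat_entire_mpow_prod[OF L] unfolding mat_entire_def
      by (blast intro: holomorphic_on_imp_continuous_on)
    moreover have "continuous_on S (\<lambda>t. Complex 1 t)"
      unfolding Complex_eq by (intro continuous_intros)
    ultimately show ?thesis by (rule continuous_on_compose2) auto
  qed
  show ?thesis
    unfolding rotated_def by (rule continuous_on_matrixI)
      (unfold matrix_mult_nth adj_nth, intro continuous_on_sum continuous_on_mult continuous_on_cnj c)
qed

lemma rotated_bounded:
  obtains B where "B \<ge> 0" "\<And>t. norm (rotated L t) \<le> B"
proof -
  obtain B where B: "\<And>z. z \<in> strip \<Longrightarrow> norm (mpow_prod L z) \<le> B"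
    using strip_bounded_mpow_prod[OF L] unfolding strip_bounded_def by blast
  have z: "Complex 1 t \<in> strip" for t by (simp add: strip_def)
  have "norm (rotated L t) \<le> B * B" for t
    using norm_matrix_mult_le[of "mpow_prod L (Complex 1 t)" "adj (mpow_prod L (Complex 1 t))"]
      mult_mono[OF B[OF z[of t]] B[OF z[of t]]] order_trans[OF norm_ge_zero B[OF z[of t]]]
    by (simp add: rotated_def norm_adj)
  moreover have "B * B \<ge> 0" by simp
  ultimately show ?thesis using that by blast
qed

lemma integrable_rotated: "integrable lborel (\<lambda>t. beta0 t *\<^sub>R rotated L t)"
proof -
  obtain B where B: "B \<ge> 0" "\<And>t. norm (rotated L t) \<le> B"
    using rotated_bounded by blast
  show ?thesis
  proof (rule Bochner_Integration.integrable_bound)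
    show "integrable lborel (\<lambda>t. B * beta0 t)" using integrable_beta0 by simp
    have "(\<lambda>t. beta0 t *\<^sub>R rotated L t) \<in> borel_measurable borel"
      by (intro borel_measurable_continuous_onI continuous_on_scaleR continuous_on_beta0 continuous_on_rotated)
    thus "(\<lambda>t. beta0 t *\<^sub>R rotated L t) \<in> borel_measurable lborel" by simp
    show "AE t in lborel. norm (beta0 t *\<^sub>R rotated L t) \<le> norm (B * beta0 t)"
      using B beta0_pos by (auto simp: less_imp_le mult.commute[of B] intro!: mult_left_mono)
  qed
qed

text \<open>Let x be the weighted outcome sum for the rotated state. Kadison's inequality gives
  |g|^2 \<le> x \<le> exp(x - 1), so (x - 1) / 2 is an admissible continuous majorant of log |g|. As
  it is affine in the rotated state, the integral over t moves inside the trace. With all p_i > 0,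
  at the optimal weights log(p_i / q_i) the right-hand side is 0, so linearizing the logarithm loses
  nothing.\<close>

lemma measured_variational_bound:
  assumes I: "finite I" and E: "\<forall>i\<in>I. psd (E i)" and one: "mat_comb I (\<lambda>_. 1) E = mat 1"
  shows "(\<Sum>i\<in>I. a i * Re (trace (\<rho> ** E i))) + 2 * Re (log_deriv L \<rho>)
    \<le> (\<Sum>i\<in>I. exp (a i) * Re (trace ((LINT t|lborel. beta0 t *\<^sub>R rotated L t) ** E i))) - 1"
proof -
  note ctxt = L \<rho> I E one
  let ?g = "interpolant L \<rho> I a E"
  let ?D = "(\<Sum>i\<in>I. of_real (a i / 2) * trace (E i ** \<rho>)) + log_deriv L \<rho>"
  define x where "x t = (\<Sum>i\<in>I. exp (a i) * Re (trace (rotated L t ** E i)))" for t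
  define \<psi> where "\<psi> t = (x t - 1) / 2" for t
  obtain B where B: "B \<ge> 0" "\<And>t. norm (rotated L t) \<le> B"
    using rotated_bounded by blast
  obtain C where C: "\<And>z. z \<in> strip \<Longrightarrow> norm (?g z) \<le> C" 
    using interpolant_bounded[OF ctxt, where a = a] by blast
  note bl = bounded_linear_Re_trace_mult
  have "Re ?D \<le> (LINT t|lborel. beta0 t * \<psi> t)"
  proof (rule strip_log_integral[OF interpolant_holomorphic[OF ctxt] C interpolant_left[OF ctxt]
        interpolant_0[OF ctxt] interpolant_deriv[OF ctxt]])
    show "continuous_on UNIV \<psi>"
      unfolding \<psi>_def x_def
      by (intro continuous_intros bounded_linear.continuous_on[OF bl] continuous_on_rotated) auto
    show "\<bar>\<psi> t\<bar> \<le> ((\<Sum>i\<in>I. exp (a i) * (B * norm (E i))) + 1) / 2" for t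
    proof -
      have "\<bar>x t\<bar> \<le> (\<Sum>i\<in>I. exp (a i) * (B * norm (E i)))"
        unfolding x_def
      proof (rule order_trans[OF sum_abs], rule sum_mono)
        fix i
        have "\<bar>Re (trace (rotated L t ** E i))\<bar> \<le> norm (rotated L t) * norm (E i)"
          using abs_Re_le_cmod norm_trace_mult_le order_trans by metis
        also have "\<dots> \<le> B * norm (E i)" using B by (intro mult_right_mono) auto
        finally show "\<bar>exp (a i) * Re (trace (rotated L t ** E i))\<bar> \<le> exp (a i) * (B * norm (E i))"
          by (simp add: abs_mult)
      qed
      thus ?thesis by (simp add: \<psi>_def)
    qed
    show "norm (?g (Complex 1 y)) \<le> exp (\<psi> y)" for y
    proof (rule power2_le_imp_le)
      let ?\<Omega> = "mat_comb I (\<lambda>i. exp (Complex 1 y * of_real (a i / 2))) E"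
      have "(norm (?g (Complex 1 y)))\<^sup>2 \<le> (norm (?\<Omega> ** mpow_prod L (Complex 1 y)))\<^sup>2"
        by (intro power_mono interpolant_right[OF ctxt]) simp
      also have "\<dots> \<le> (\<Sum>i\<in>I. (norm (exp (Complex 1 y * of_real (a i / 2))))\<^sup>2 *
          Re (trace (rotated L y ** E i)))"
        unfolding rotated_def by (rule norm_mat_comb_povm_mult[OF I bspec[OF E] one])
      also have "\<dots> = x y"
        unfolding x_def norm_exp_eq_Re by (simp add: power2_eq_square exp_add[symmetric])
      also have "\<dots> \<le> exp (x y - 1)" using exp_ge_add_one_self[of "x y - 1"] by simp
      also have "\<dots> = (exp (\<psi> y))\<^sup>2" by (simp add: \<psi>_def power2_eq_square exp_add[symmetric])
      finally show "(norm (?g (Complex 1 y)))\<^sup>2 \<le> (exp (\<psi> y))\<^sup>2" .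
    qed simp
  qed
  also have "(LINT t|lborel. beta0 t * \<psi> t)
    = ((\<Sum>i\<in>I. exp (a i) * Re (trace ((LINT t|lborel. beta0 t *\<^sub>R rotated L t) ** E i))) - 1) / 2"
  proof -
    have int: "integrable lborel (\<lambda>t. Re (trace (beta0 t *\<^sub>R rotated L t ** E i)))" for i
      by (rule integrable_bounded_linear[OF bl integrable_rotated])
    have "beta0 t * \<psi> t
      = ((\<Sum>i\<in>I. exp (a i) * Re (trace (beta0 t *\<^sub>R rotated L t ** E i))) - beta0 t) / 2" for t
      unfolding \<psi>_def x_def linear_cmul[OF bounded_linear.linear[OF bl]]
      by (simp add: sum_distrib_left algebra_simps)
    hence "(LINT t|lborel. beta0 t * \<psi> t) = (LINT t|lborel.
        ((\<Sum>i\<in>I. exp (a i) * Re (trace (beta0 t *\<^sub>R rotated L t ** E i))) - beta0 t) / 2)"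
      by (simp only:)
    hence "(LINT t|lborel. beta0 t * \<psi> t)
      = ((\<Sum>i\<in>I. exp (a i) * (LINT t|lborel. Re (trace (beta0 t *\<^sub>R rotated L t ** E i)))) - 1) / 2"
      using int integrable_beta0 by (simp add: integral_beta0)
    thus ?thesis by (simp add: integral_bounded_linear[OF bl integrable_rotated])
  qed
  finally show ?thesis
    by (simp add: trace_mul_sym[of _ \<rho>] sum_divide_distrib[symmetric])
qed

text \<open>The measurement has the identity as its only effect. The Hilbert-Schmidt bound makes |g|
  \<le> 1 on Re z = 1, so that -log |g| is nonnegative.\<close>

lemma fidelity_nn_integral_bound:
  assumes le1: "\<And>y. norm (mpow_prod L (Complex 1 y)) \<le> 1"
  shows "Re (log_deriv L \<rho>) \<le> 0"
    and "(\<integral>\<^sup>+t. e2ennreal (- (ereal (beta0 t) * elog (fidelity \<rho> (rotated L t)))) \<partial>lborel)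
    \<le> ennreal (- (2 * Re (log_deriv L \<rho>)))"
proof -
  let ?I = "{()}" and ?a = "\<lambda>_::unit. 0::real" and ?E = "\<lambda>_::unit. mat 1 :: 'n cmat"
  have p: "psd (mat 1 :: 'n cmat)" using psd_adj_mult_self[of "mat 1"] by simp
  have one: "mat_comb ?I (\<lambda>i. 1) ?E = mat 1"
    by (simp add: mat_comb_def vec_eq_iff)
  have ctxt: "finite ?I" "\<forall>i\<in>?I. psd (?E i)" "mat_comb ?I (\<lambda>i. 1) ?E = mat 1"
    using p one by simp_all
  note ctxt = L \<rho> ctxt
  let ?g = "interpolant L \<rho> ?I ?a ?E"
  have one': "mat_comb ?I (\<lambda>i. exp (z * of_real (?a i / 2))) ?E = mat 1" for z
    by (simp add: one)
  obtain C where C: "\<And>z. z \<in> strip \<Longrightarrow> norm (?g z) \<le> C" 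
    using interpolant_bounded[OF ctxt, where a = ?a] by blast
  note g = interpolant_holomorphic[OF ctxt] C interpolant_left[OF ctxt]
    interpolant_0[OF ctxt] interpolant_deriv[OF ctxt]
  have right: "norm (?g (Complex 1 y)) \<le> 1" for y
    using interpolant_right[OF ctxt, of ?a y] le1[of y] unfolding one' by simp
  show "Re (log_deriv L \<rho>) \<le> 0"
    using strip_deriv_neg[OF g right] by simp
  have "(\<integral>\<^sup>+t. e2ennreal (- (ereal (beta0 t) * elog (fidelity \<rho> (rotated L t)))) \<partial>lborel)
    \<le> ennreal (- (2 * Re ((\<Sum>i\<in>?I. of_real (?a i / 2) * trace (?E i ** \<rho>)) + log_deriv L \<rho>)))"
  proof (rule strip_log_elog_nn_integral[OF g right])
    fix y
    let ?U = "mpow \<rho> (Complex 0 (- y / 2))"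
    have "1 + (- 1 / 2) * Complex 1 y = Complex 0 (- y / 2) + 1 / 2" by (simp add: complex_eq_iff)
    hence "mpow \<rho> (1 + (- 1 / 2) * Complex 1 y) = ?U ** msqrt \<rho>"
      by (simp only: mpow_add[OF \<rho>(1)] msqrt_eq_mpow[OF \<rho>(1)])
    hence "?g (Complex 1 y) = trace (mpow_prod L (Complex 1 y) ** ?U ** msqrt \<rho>)"
      unfolding interpolant_def one' by (simp add: matrix_mul_assoc)
    moreover have "contraction ?U" by (rule contraction_mpow[OF \<rho>(1)]) simp
    ultimately show "(norm (?g (Complex 1 y)))\<^sup>2 \<le> fidelity \<rho> (rotated L y)"
      unfolding rotated_def by (simp only: norm_trace_le_fidelity)
  qed
  thus "(\<integral>\<^sup>+t. e2ennreal (- (ereal (beta0 t) * elog (fidelity \<rho> (rotated L t)))) \<partial>lborel)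
    \<le> ennreal (- (2 * Re (log_deriv L \<rho>)))" by simp
qed

end

section \<open>Partial traces\<close>

text \<open>
  \<open>E\<close> is the inclusion of the operators on a subsystem, \<open>m\<close> the dual partial trace, and \<open>p\<close> the
  induced map of basis indices.
\<close>

definition embedding ::
  "('m::finite cmat \<Rightarrow> 'n::finite cmat) \<Rightarrow> ('n cmat \<Rightarrow> 'm cmat) \<Rightarrow> ('n \<Rightarrow> 'm) \<Rightarrow> bool" where
  "embedding E m p \<longleftrightarrow>
     (\<forall>A B. E (A ** B) = E A ** E B) \<and> (\<forall>A. E (adj A) = adj (E A)) \<and> E (mat 1) = mat 1 \<and>
     (\<forall>d. E (diag d) = diag (\<lambda>i. d (p i))) \<and> (\<forall>\<rho>. m (adj \<rho>) = adj (m \<rho>)) \<and>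
     (\<forall>\<rho> A. trace (\<rho> ** E A) = trace (m \<rho> ** A))"

lemma trace_mult_matrix_unit: "trace (A ** matrix_unit i j) = (A :: 'n::finite cmat) $ j $ i"
proof -
  have "trace (A ** matrix_unit i j) = (\<Sum>k\<in>UNIV. \<Sum>l\<in>UNIV. if l = i then if k = j then A $ k $ l else 0 else 0)"
    unfolding trace_eq matrix_mult_nth matrix_unit_def by (intro sum.cong) auto
  also have "\<dots> = A $ j $ i"
    by (simp add: sum.delta cong: if_cong)
  finally show ?thesis .
qed

lemma matrix_eqI_trace:
  fixes A B :: "'n::finite cmat"
  assumes "\<And>X. trace (A ** X) = trace (B ** X)" shows "A = B"
  unfolding vec_eq_iff using assms[of "matrix_unit _ _"] by (simp only: trace_mult_matrix_unit) simp

lemma psd_eq_adj_mult_self: "psd A \<Longrightarrow> A = adj (mpow A (1 / 2)) ** mpow A (1 / 2)"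
  by (simp add: adj_mpow mpow_add[symmetric] mpow_1)

context
  fixes E :: "'m::finite cmat \<Rightarrow> 'n::finite cmat" and m p
  assumes emb: "embedding E m p"
begin

lemma embedding_simps:
  "E (A ** B) = E A ** E B" "E (adj A) = adj (E A)" "E (mat 1) = mat 1"
  "E (diag d) = diag (\<lambda>i. d (p i))" "m (adj \<rho>) = adj (m \<rho>)" "trace (\<rho> ** E A) = trace (m \<rho> ** A)"
  using emb unfolding embedding_def by blast+

text \<open>The inclusion maps a diagonalization to a diagonalization, with the eigenvalues repeated
  along p.\<close>

lemma embedding_mfun:
  assumes "adj A = A" shows "mfun f (E A) = E (mfun f A)"
proof -
  obtain U d where U: "unitary U" and A: "A = U ** diag (\<lambda>i. of_real (d i)) ** adj U"
    using spectral_theorem[OF assms] by blast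
  have EU: "unitary (E U)"
    using U unfolding unitary_def by (simp add: embedding_simps flip: embedding_simps(1,2))
  have EA: "E A = E U ** diag (\<lambda>i. of_real (d (p i))) ** adj (E U)"
    unfolding A by (simp add: embedding_simps)
  have "mfun f A = U ** diag (\<lambda>i. f (d i)) ** adj U" unfolding A by (rule mfun_eq[OF U])
  hence "E (mfun f A) = E U ** diag (\<lambda>i. f (d (p i))) ** adj (E U)"
    by (simp add: embedding_simps)
  moreover have "mfun f (E A) = E U ** diag (\<lambda>i. f (d (p i))) ** adj (E U)"
    unfolding EA by (rule mfun_eq[OF EU])
  ultimately show ?thesis by simp
qed

lemma embedding_psd: "psd A \<Longrightarrow> psd (E A)"
  using psd_adj_mult_self[of "E (mpow A (1 / 2))"] psd_eq_adj_mult_self[of A]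
  by (metis embedding_simps(1,2))

lemma embedding_mpow: "psd A \<Longrightarrow> mpow (E A) z = E (mpow A z)"
  unfolding mpow_def by (rule embedding_mfun[OF psd_adj])

lemma embedding_trace: "trace (m \<rho>) = trace \<rho>"
  using embedding_simps(6)[of \<rho> "mat 1"] by (simp add: embedding_simps(3))

text \<open>Tested against all Z: cyclicity merges the included X and Y with the included Z before
  duality is applied.\<close>

lemma embedding_bimodule: "m (E X ** \<rho> ** E Y) = X ** m \<rho> ** Y"
proof (rule matrix_eqI_trace)
  fix Z
  have "trace (m (E X ** \<rho> ** E Y) ** Z) = trace (E X ** (\<rho> ** E Y ** E Z))"
    by (simp add: embedding_simps(6)[symmetric] matrix_mul_assoc)
  also have "\<dots> = trace (\<rho> ** E (Y ** Z ** X))"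
    by (subst trace_mul_sym) (simp add: embedding_simps(1) matrix_mul_assoc)
  also have "\<dots> = trace (m \<rho> ** Y ** Z ** X)"
    by (simp add: embedding_simps(6) matrix_mul_assoc)
  also have "\<dots> = trace (X ** m \<rho> ** Y ** Z)"
    by (subst trace_mul_sym) (simp add: matrix_mul_assoc)
  finally show "trace (m (E X ** \<rho> ** E Y) ** Z) = trace (X ** m \<rho> ** Y ** Z)" .
qed

lemma psd_marginal:
  assumes \<rho>: "psd \<rho>" shows "psd (m \<rho>)"
  unfolding psd_iff_cinner
proof (intro conjI allI)
  show "adj (m \<rho>) = m \<rho>" using psd_adj[OF \<rho>] by (metis embedding_simps(5))
  fix v :: "complex ^ 'm"
  \<comment> \<open>An arbitrary index. Placing v in this single column turns the quadratic form
    into a trace, to which duality applies.\<close>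
  define i0 :: 'm where "i0 = undefined"
  define V :: "'m cmat" where "V = (\<chi> i j. if j = i0 then v $ i else 0)"
  have "cinner v (m \<rho> *v v) = (adj V ** (m \<rho> ** V)) $ i0 $ i0"
    by (simp add: cinner_def matrix_mult_nth V_def matrix_vector_mult_def)
  also have "\<dots> = trace (adj V ** (m \<rho> ** V))"
  proof -
    have "(adj V ** (m \<rho> ** V)) $ i $ i = 0" if "i \<noteq> i0" for i
    proof -
      have "V $ k $ i = 0" for k using that by (simp add: V_def)
      thus ?thesis by (simp add: matrix_mult_nth[of "adj V"])
    qed
    hence "trace (adj V ** (m \<rho> ** V)) = (\<Sum>i\<in>UNIV. if i = i0 then (adj V ** (m \<rho> ** V)) $ i0 $ i0 else 0)"
      unfolding trace_eq by (intro sum.cong) auto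
    thus ?thesis by simp
  qed
  also have "\<dots> = trace (m (E (adj V) ** \<rho> ** E V))"
    by (simp add: embedding_bimodule matrix_mul_assoc)
  also have "\<dots> = trace (adj (mpow \<rho> (1 / 2) ** E V) ** (mpow \<rho> (1 / 2) ** E V))"
    unfolding embedding_trace embedding_simps(2)
    by (subst psd_eq_adj_mult_self[OF \<rho>]) (simp only: adj_mult matrix_mul_assoc)
  finally show "0 \<le> Re (cinner v (m \<rho> *v v))" by (simp add: trace_adj_mult_self)
qed

text \<open>Duality gives P, the included support projection of the marginal, full weight in the
  state: tr(rho P) = tr(rho). Hence the square root of \<open>\<rho>\<close> times 1 - P has
  Hilbert-Schmidt norm 0.\<close>

lemma supported_marginal:
  assumes \<rho>: "psd \<rho>" shows "supported \<rho> (E (m \<rho>))"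
proof -
  define P where "P = mpow (E (m \<rho>)) 0"
  define h where "h = mpow \<rho> (1 / 2)"
  have m: "psd (m \<rho>)" by (rule psd_marginal[OF \<rho>])
  have Em: "psd (E (m \<rho>))" by (rule embedding_psd[OF m])
  have P: "adj P = P" "P ** P = P" by (simp_all add: P_def adj_mpow[OF Em] mpow_0_mult[OF Em])
  have h: "adj h = h" "h ** h = \<rho>"
    using \<rho> by (simp_all add: h_def adj_mpow mpow_add[symmetric] mpow_1)
  have tP: "trace (\<rho> ** P) = trace \<rho>"
    using mult_mpow_0[OF m, of 1]
    by (simp add: P_def embedding_mpow[OF m] embedding_simps(6) mpow_1[OF m] embedding_trace)
  define N where "N = h - h ** P"
  have aN: "adj N = h - P ** h"
    using adj_mult[of h P] h(1) P(1) by (simp add: N_def vec_eq_iff)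
  have "N ** adj N = \<rho> - h ** P ** h"
  proof -
    have "h ** P ** P ** h = h ** P ** h" using P(2) by (simp add: matrix_mul_assoc[symmetric])
    thus ?thesis unfolding aN unfolding N_def matrix_diff_mult_diff by (simp add: matrix_mul_assoc h(2))
  qed
  moreover have "trace (h ** P ** h) = trace (\<rho> ** P)"
    by (subst trace_mul_sym) (simp add: matrix_mul_assoc h(2))
  ultimately have "trace (adj (adj N) ** adj N) = 0" by (simp add: trace_sub tP)
  hence "adj N = 0" by (simp only: trace_adj_mult_self of_real_eq_0_iff) simp
  hence "h = P ** h" by (simp add: aN)
  hence l: "\<rho> = P ** \<rho>" using h(2) by (metis matrix_mul_assoc)
  hence "\<rho> = \<rho> ** P" using adj_mult[of P \<rho>] P(1) psd_adj[OF \<rho>] by simp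
  with l Em show ?thesis unfolding supported_def P_def by simp
qed

lemma trace_mlog_marginal:
  assumes "psd \<rho>" shows "trace (\<rho> ** mlog (E (m \<rho>))) = trace (m \<rho> ** mlog (m \<rho>))"
  using embedding_mfun[OF psd_adj[OF psd_marginal[OF assms]]] embedding_simps(6)
  unfolding mlog_def by simp

end

lemma embedding_compose:
  assumes "embedding E m p" "embedding E' m' p'"
  shows "embedding (\<lambda>A. E (E' A)) (\<lambda>\<rho>. m' (m \<rho>)) (\<lambda>i. p' (p i))"
  using assms unfolding embedding_def by simp

section \<open>Kronecker products and the concrete marginals\<close>

lemma sum_UNIV_prod: "(\<Sum>x\<in>UNIV. f x) = (\<Sum>i\<in>UNIV. \<Sum>j\<in>UNIV. f (i, j))"
  unfolding UNIV_Times_UNIV[symmetric] by (simp add: sum.cartesian_product)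

lemma kron_nth: "kron A B $ p $ q = A $ fst p $ fst q * B $ snd p $ snd q"
  by (simp add: kron_def)

lemma kron_mult: "kron A B ** kron C D = kron (A ** C) (B ** D)"
  by (simp add: vec_eq_iff matrix_mult_nth kron_nth sum_UNIV_prod sum_product mult_ac)

lemma adj_kron: "adj (kron A B) = kron (adj A) (adj B)"
  by (simp add: vec_eq_iff kron_nth)

lemma mat_1_nth: "mat 1 $ i $ j = (if i = j then 1 else 0)"
  by (simp add: mat_def)

lemma kron_mat_1: "kron (mat 1) (mat 1) = mat 1"
  by (simp add: vec_eq_iff kron_nth mat_1_nth prod_eq_iff)

lemma embedding_fst: "embedding (\<lambda>A. kron A (mat 1)) marg_fst (fst :: 'a::finite \<times> 'b::finite \<Rightarrow> 'a)"
  unfolding embedding_def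
proof (intro conjI allI)
  fix A :: "'a cmat" and \<rho> :: "('a \<times> 'b) cmat"
  have "trace (\<rho> ** kron A (mat 1)) = (\<Sum>i\<in>UNIV. \<Sum>y\<in>UNIV. \<Sum>j\<in>UNIV. \<rho> $ (i, y) $ (j, y) * A $ j $ i)"
    by (simp add: trace_eq matrix_mult_nth kron_nth sum_UNIV_prod mat_1_nth
        if_distrib[where f = "\<lambda>x. _ * x"] cong: if_cong)
  also have "\<dots> = (\<Sum>i\<in>UNIV. \<Sum>j\<in>UNIV. \<Sum>y\<in>UNIV. \<rho> $ (i, y) $ (j, y) * A $ j $ i)"
    by (intro sum.cong[OF refl] sum.swap)
  finally show "trace (\<rho> ** kron A (mat 1)) = trace (marg_fst \<rho> ** A)"
    by (simp add: trace_eq matrix_mult_nth marg_fst_def sum_distrib_right)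
qed (simp_all add: kron_mult adj_kron kron_mat_1 vec_eq_iff kron_nth mat_1_nth diag_nth marg_fst_def
    prod_eq_iff)

lemma embedding_snd: "embedding (\<lambda>A. kron (mat 1) A) marg_snd (snd :: 'a::finite \<times> 'b::finite \<Rightarrow> 'b)"
  unfolding embedding_def
proof (intro conjI allI)
  fix A :: "'b cmat" and \<rho> :: "('a \<times> 'b) cmat"
  have "trace (\<rho> ** kron (mat 1) A) = (\<Sum>x\<in>UNIV. \<Sum>i\<in>UNIV. \<Sum>j\<in>UNIV. \<rho> $ (x, i) $ (x, j) * A $ j $ i)"
  proof -
    have inner: "(\<Sum>j\<in>UNIV. \<rho> $ (x, i) $ (x', j) * ((if x' = x then 1 else 0) * A $ j $ i))
      = (if x' = x then \<Sum>j\<in>UNIV. \<rho> $ (x, i) $ (x, j) * A $ j $ i else 0)" for x i x'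
      by simp
    show ?thesis
      unfolding trace_eq matrix_mult_nth kron_nth sum_UNIV_prod mat_1_nth fst_conv snd_conv inner
      by simp
  qed
  also have "\<dots> = (\<Sum>i\<in>UNIV. \<Sum>x\<in>UNIV. \<Sum>j\<in>UNIV. \<rho> $ (x, i) $ (x, j) * A $ j $ i)"
    by (rule sum.swap)
  also have "\<dots> = (\<Sum>i\<in>UNIV. \<Sum>j\<in>UNIV. \<Sum>x\<in>UNIV. \<rho> $ (x, i) $ (x, j) * A $ j $ i)"
    by (intro sum.cong[OF refl] sum.swap)
  finally show "trace (\<rho> ** kron (mat 1) A) = trace (marg_snd \<rho> ** A)"
    by (simp add: trace_eq matrix_mult_nth marg_snd_def sum_distrib_right)
qed (simp_all add: kron_mult adj_kron kron_mat_1 vec_eq_iff kron_nth mat_1_nth diag_nth marg_snd_def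
    prod_eq_iff)

definition reindex :: "('n \<Rightarrow> 'm) \<Rightarrow> 'm::finite cmat \<Rightarrow> 'n::finite cmat" where
  "reindex \<pi> A = (\<chi> i j. A $ \<pi> i $ \<pi> j)"

lemma embedding_reindex:
  assumes "bij \<pi>"
  shows "embedding (reindex \<pi>) (reindex (inv \<pi>)) \<pi>"
proof -
  have inj: "\<pi> i = \<pi> j \<longleftrightarrow> i = j" for i j using assms by (meson bij_def injD)
  have s: "(\<Sum>k\<in>UNIV. f (\<pi> k)) = (\<Sum>k\<in>UNIV. f k)" for f :: "_ \<Rightarrow> complex"
    by (rule sum.reindex_bij_betw) (use assms in simp)
  have i: "inv \<pi> (\<pi> k) = k" for k using assms by (simp add: bij_is_inj)
  have "trace (\<rho> ** reindex \<pi> A) = trace (reindex (inv \<pi>) \<rho> ** A)" for \<rho> A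
  proof -
    have "trace (reindex (inv \<pi>) \<rho> ** A)
        = (\<Sum>i\<in>UNIV. \<Sum>j\<in>UNIV. \<rho> $ inv \<pi> i $ inv \<pi> j * A $ j $ i)"
      by (simp add: trace_eq matrix_mult_nth reindex_def)
    also have "\<dots> = (\<Sum>i\<in>UNIV. \<Sum>j\<in>UNIV. \<rho> $ inv \<pi> (\<pi> i) $ inv \<pi> j * A $ j $ \<pi> i)"
      by (rule s[symmetric])
    also have "\<dots> = (\<Sum>i\<in>UNIV. \<Sum>j\<in>UNIV. \<rho> $ inv \<pi> (\<pi> i) $ inv \<pi> (\<pi> j) * A $ \<pi> j $ \<pi> i)"
      by (intro sum.cong[OF refl] s[symmetric])
    also have "\<dots> = (\<Sum>i\<in>UNIV. \<Sum>j\<in>UNIV. \<rho> $ i $ j * A $ \<pi> j $ \<pi> i)"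
      by (simp add: i)
    finally show ?thesis by (simp add: trace_eq matrix_mult_nth reindex_def)
  qed
  moreover have "reindex \<pi> (A ** B) = reindex \<pi> A ** reindex \<pi> B" for A B
    by (simp add: vec_eq_iff reindex_def matrix_mult_nth s[where f = "\<lambda>k. A $ _ $ k * B $ k $ _"])
  ultimately show ?thesis
    unfolding embedding_def by (simp add: vec_eq_iff reindex_def mat_1_nth diag_nth inj)
qed

text \<open>Regrouping the unbarred and the barred parties turns the inclusion of the two barred
  parties, which are not adjacent, into that of a second tensor factor.\<close>

definition bars_index :: "('a \<times> 'ab) \<times> ('b \<times> 'bb) \<Rightarrow> ('a \<times> 'b) \<times> ('ab \<times> 'bb)" where
  "bars_index = (\<lambda>((a, i), (b, j)). ((a, b), (i, j)))"

definition emb_bars ::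
  "('ab::finite \<times> 'bb::finite) cmat \<Rightarrow> (('a::finite \<times> 'ab) \<times> ('b::finite \<times> 'bb)) cmat" where
  "emb_bars Y = reindex bars_index (kron (mat 1) Y)"

lemma inv_bars_index: "inv bars_index = (\<lambda>((a, b), (i, j)). ((a, i), (b, j)))"
  and bij_bars_index: "bij bars_index"
proof -
  have *: "bars_index \<circ> (\<lambda>((a, b), (i, j)). ((a, i), (b, j))) = id"
    "(\<lambda>((a, b), (i, j)). ((a, i), (b, j))) \<circ> bars_index = id"
    by (auto simp: bars_index_def fun_eq_iff)
  show "bij bars_index" using * by (rule o_bij[rotated])
  show "inv bars_index = (\<lambda>((a, b), (i, j)). ((a, i), (b, j)))"
    using * by (rule inv_unique_comp)
qed

lemma marg_snd_reindex_bars: "marg_snd (reindex (inv bars_index) \<rho>) = marg_bars \<rho>"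
  by (simp add: vec_eq_iff marg_snd_def marg_bars_def reindex_def inv_bars_index sum_UNIV_prod split_beta)

lemma embedding_bars: "embedding emb_bars marg_bars (\<lambda>x. snd (bars_index x))"
  using embedding_compose[OF embedding_reindex[OF bij_bars_index] embedding_snd]
  unfolding emb_bars_def[abs_def] marg_snd_reindex_bars .

lemma emb_bars_kron: "emb_bars (kron A B) = kron (kron (mat 1) A) (kron (mat 1) B)"
  by (simp add: vec_eq_iff emb_bars_def reindex_def bars_index_def kron_nth mat_1_nth split_beta prod_eq_iff)

lemma marg_bars_kron: "marg_bars (kron A B) = kron (marg_snd A) (marg_snd B)"
  by (simp add: vec_eq_iff marg_bars_def kron_nth marg_snd_def sum_product)

section \<open>Recovery maps\<close>

lemma mult_adj_mult: "(K ** Y) ** adj (K ** Y) = K ** (Y ** adj Y) ** adj (K :: 'n::finite cmat)"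
  by (simp only: adj_mult matrix_mul_assoc)

lemma mat_comb_mult:
  fixes G :: "'i \<Rightarrow> 'n::finite cmat"
  shows "K ** mat_comb I c G ** K' = mat_comb I c (\<lambda>i. K ** G i ** K')"
proof (rule matrix_eqI_trace)
  fix X
  have "trace (K ** mat_comb I c G ** K' ** X) = trace (mat_comb I c G ** (K' ** X ** K))"
  proof -
    have "trace (K ** mat_comb I c G ** K' ** X) = trace (K ** (mat_comb I c G ** K' ** X))"
      by (simp only: matrix_mul_assoc)
    also have "\<dots> = trace ((mat_comb I c G ** K' ** X) ** K)" by (rule trace_mul_sym)
    finally show ?thesis by (simp only: matrix_mul_assoc)
  qed
  also have "\<dots> = (\<Sum>i\<in>I. c i * trace (G i ** (K' ** X ** K)))"
    by (rule trace_mat_comb_mult)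
  also have "\<dots> = (\<Sum>i\<in>I. c i * trace (K ** G i ** K' ** X))"
  proof (intro sum.cong[OF refl] arg_cong[where f = "\<lambda>x. _ * x"])
    fix i
    have "trace (G i ** (K' ** X ** K)) = trace ((G i ** K' ** X) ** K)" by (simp only: matrix_mul_assoc)
    also have "\<dots> = trace (K ** (G i ** K' ** X))" by (rule trace_mul_sym)
    finally show "trace (G i ** (K' ** X ** K)) = trace (K ** G i ** K' ** X)" by (simp only: matrix_mul_assoc)
  qed
  also have "\<dots> = trace (mat_comb I c (\<lambda>i. K ** G i ** K') ** X)"
    by (rule trace_mat_comb_mult[symmetric])
  finally show "trace (K ** mat_comb I c G ** K' ** X) = trace (mat_comb I c (\<lambda>i. K ** G i ** K') ** X)" .
qed

definition quad_coeff :: "('x \<times> 'y) cmat \<Rightarrow> 'x::finite \<times> 'x \<times> 'y::finite \<times> 'y \<Rightarrow> complex" where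
  "quad_coeff X = (\<lambda>(i, j, k, l). X $ (i, k) $ (j, l))"

lemma tensor_map_eq_mat_comb:
  "tensor_map R S X = mat_comb UNIV (quad_coeff X)
     (\<lambda>(i, j, k, l). kron (R (matrix_unit i j)) (S (matrix_unit k l)))"
  by (simp add: vec_eq_iff tensor_map_def mat_comb_def quad_coeff_def sum_UNIV_prod)

lemma emb_bars_mat_comb: "emb_bars (mat_comb I c G) = mat_comb I c (\<lambda>x. emb_bars (G x))"
  by (simp add: vec_eq_iff emb_bars_def reindex_def mat_comb_def kron_nth sum_distrib_left mult_ac)

text \<open>Same coefficients and index set as in \<open>tensor_map_eq_mat_comb\<close>, so the two
  expansions can be compared summand by summand.\<close>

lemma emb_bars_eq_mat_comb:
  "emb_bars X = mat_comb UNIV (quad_coeff X)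
     (\<lambda>(i, j, k, l). kron (kron (mat 1) (matrix_unit i j)) (kron (mat 1) (matrix_unit k l)))"
proof -
  have "X = mat_comb UNIV (quad_coeff X) (\<lambda>(i, j, k, l). kron (matrix_unit i j) (matrix_unit k l))"
  proof -
    have "(\<Sum>i\<in>UNIV. \<Sum>j\<in>UNIV. \<Sum>k\<in>UNIV. \<Sum>l\<in>UNIV.
        X $ (i, k) $ (j, l) * (matrix_unit i j $ a $ b * matrix_unit k l $ c $ d)) = X $ (a, c) $ (b, d)"
      for a b c d
    proof -
      have "X $ (i, k) $ (j, l) * (matrix_unit i j $ a $ b * matrix_unit k l $ c $ d)
        = (if l = d then if k = c then if j = b then if i = a then X $ (i, k) $ (j, l) else 0 else 0 else 0 else 0)"
        for i j k l
        by (auto simp: matrix_unit_def)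
      thus ?thesis by (simp cong: if_cong)
    qed
    thus ?thesis
      by (simp add: vec_eq_iff mat_comb_def quad_coeff_def sum_UNIV_prod kron_nth)
  qed
  from arg_cong[OF this, of emb_bars]
  have "emb_bars X = mat_comb UNIV (quad_coeff X)
      (\<lambda>x. emb_bars (case x of (i, j, k, l) \<Rightarrow> kron (matrix_unit i j) (matrix_unit k l)))"
    unfolding emb_bars_mat_comb .
  also have "(\<lambda>x. emb_bars (case x of (i, j, k, l) \<Rightarrow> kron (matrix_unit i j) (matrix_unit k l)))
    = (\<lambda>(i, j, k, l). kron (kron (mat 1) (matrix_unit i j)) (kron (mat 1) (matrix_unit k l)))"
    by (auto simp: fun_eq_iff emb_bars_kron)
  finally show ?thesis .
qed

text \<open>On each pair of matrix units the conjugations factor over the tensor product. The tensor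
  map, defined through a basis, thus becomes one conjugation to which trace identities
  apply.\<close>

lemma tensor_map_conj:
  assumes R: "\<And>X. R X = K ** kron (mat 1) X ** adj K" and S: "\<And>X. S X = L ** kron (mat 1) X ** adj L"
  shows "tensor_map R S X = kron K L ** emb_bars X ** adj (kron K L)"
  unfolding tensor_map_eq_mat_comb emb_bars_eq_mat_comb mat_comb_mult R S
  by (rule arg_cong[where f = "mat_comb UNIV (quad_coeff X)"])
    (auto simp: fun_eq_iff adj_kron kron_mult)

text \<open>Test the hypothesis on the log-likelihood ratios, sent to minus infinity where \<open>p\<close> vanishes.\<close>

lemma sum_rel_term_le_variational:
  fixes p q :: "'i \<Rightarrow> real"
  assumes I: "finite I" and p: "\<And>i. i \<in> I \<Longrightarrow> p i \<ge> 0" "sum p I = 1"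
    and var: "\<And>a. (\<Sum>i\<in>I. a i * p i) - C \<le> (\<Sum>i\<in>I. exp (a i) * q i) - 1"
  shows "(\<Sum>i\<in>I. rel_term (p i) (q i)) \<le> ereal C"
proof -
  have q: "q j > 0" if j: "j \<in> I" "p j \<noteq> 0" for j
  proof (rule ccontr)
    assume "\<not> q j > 0"
    hence qj: "q j \<le> 0" by simp
    have pj: "p j > 0" using p(1)[OF j(1)] j(2) by simp
    \<comment> \<open>The left-hand side of the hypothesis becomes the sum of the other q; with
      \<open>q j\<close> \<le> 0 this would leave 0 \<le> -1. So the infinite value of
      \<open>rel_term\<close> cannot occur.\<close>
    define s where "s = (C + sum q (I - {j})) / p j"
    let ?a = "\<lambda>i. if i = j then s else 0"
    have "(\<Sum>i\<in>I. ?a i * p i) = s * p j"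
      using I j by (simp add: if_distrib[where f = "\<lambda>x. x * _"] cong: if_cong)
    moreover have "(\<Sum>i\<in>I. exp (?a i) * q i) = exp s * q j + sum q (I - {j})"
      using sum.remove[OF I j(1), of "\<lambda>i. exp (?a i) * q i"] by simp
    ultimately have "s * p j - C \<le> exp s * q j + sum q (I - {j}) - 1"
      using var[of ?a] by simp
    moreover have "exp s * q j \<le> 0" using qj by (simp add: mult_nonneg_nonpos)
    moreover have "s * p j = C + sum q (I - {j})" using pj by (simp add: s_def)
    ultimately show False by simp
  qed
  define Z where "Z = {i \<in> I. p i = 0}"
  have Z: "finite Z" "Z \<subseteq> I" using I by (auto simp: Z_def)
  let ?K = "\<Sum>i\<in>I. if p i = 0 then 0 else p i * ln (p i / q i)"
  have bound: "?K - C \<le> exp (- real n) * sum q Z" for n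
  proof -
    let ?a = "\<lambda>i. if p i = 0 then - real n else ln (p i / q i)"
    have "(\<Sum>i\<in>I. ?a i * p i) = ?K" by (intro sum.cong) auto
    moreover have "(\<Sum>i\<in>I. exp (?a i) * q i) = (\<Sum>i\<in>I. p i + (if p i = 0 then exp (- real n) * q i else 0))"
    proof (rule sum.cong[OF refl])
      fix i assume i: "i \<in> I"
      show "exp (?a i) * q i = p i + (if p i = 0 then exp (- real n) * q i else 0)"
        using q[OF i] p(1)[OF i] by (cases "p i = 0") auto
    qed
    moreover have "(\<Sum>i\<in>I. p i + (if p i = 0 then exp (- real n) * q i else 0)) = 1 + exp (- real n) * sum q Z"
      unfolding sum.distrib p(2) Z_def sum_distrib_left using I by (simp add: sum.inter_filter)
    ultimately show ?thesis using var[of ?a] by simp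
  qed
  have "(\<lambda>n. exp (- real n) * sum q Z) \<longlonglongrightarrow> 0 * sum q Z"
  proof (intro tendsto_mult tendsto_const)
    show "(\<lambda>n. exp (- real n)) \<longlonglongrightarrow> 0"
      by (intro filterlim_compose[OF exp_at_bot] filterlim_compose[OF filterlim_uminus_at_bot_at_top]
          filterlim_real_sequentially)
  qed
  hence "?K - C \<le> 0 * sum q Z"
    by (rule tendsto_lowerbound) (use bound in auto)
  hence K: "?K \<le> C" by simp
  have "(\<Sum>i\<in>I. rel_term (p i) (q i)) = (\<Sum>i\<in>I. ereal (if p i = 0 then 0 else p i * ln (p i / q i)))"
  proof (rule sum.cong[OF refl])
    fix i assume "i \<in> I"
    thus "rel_term (p i) (q i) = ereal (if p i = 0 then 0 else p i * ln (p i / q i))"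
      using q[of i] by (cases "p i = 0") (auto simp: rel_term_def)
  qed
  also have "\<dots> = ereal ?K" by (rule sum_ereal)
  finally show ?thesis using K by simp
qed

text \<open>The single Kraus operator of the map \<open>recovery t \<sigma>\<close>.\<close>

definition half_rotation :: "real \<Rightarrow> ('x::finite \<times> 'y::finite) cmat \<Rightarrow> ('x \<times> 'y) cmat" where
  "half_rotation t \<sigma> = mpow \<sigma> ((1 + \<i> * of_real t) / 2)
     ** kron (mat 1) (mpow (marg_snd \<sigma>) (- ((1 + \<i> * of_real t) / 2)))"

lemma recovery_eq_conj:
  assumes \<sigma>: "psd \<sigma>"
  shows "recovery t \<sigma> X = half_rotation t \<sigma> ** kron (mat 1) X ** adj (half_rotation t \<sigma>)"
proof -
  note E = embedding_snd
  have m: "psd (marg_snd \<sigma>)" by (rule psd_marginal[OF E \<sigma>])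
  show ?thesis
    unfolding recovery_def half_rotation_def
    by (simp add: adj_mult adj_kron adj_mpow[OF \<sigma>] adj_mpow[OF m] matrix_mul_assoc embedding_simps(1)[OF E])
qed

text \<open>The dual map applied to the identity: it says that recovery preserves the trace of
  operators living on the support of the marginal. The exponents around the marginal add up to
  0.\<close>

lemma marg_snd_half_rotation:
  assumes \<sigma>: "psd \<sigma>"
  shows "marg_snd (adj (half_rotation t \<sigma>) ** half_rotation t \<sigma>) = mpow (marg_snd \<sigma>) 0"
proof -
  let ?c = "(1 + \<i> * of_real t) / 2"
  note E = embedding_snd
  have m: "psd (marg_snd \<sigma>)" by (rule psd_marginal[OF E \<sigma>])
  have c: "cnj ?c + ?c = 1" by (simp add: complex_eq_iff)
  have "adj (half_rotation t \<sigma>) ** half_rotation t \<sigma>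
    = kron (mat 1) (mpow (marg_snd \<sigma>) (- cnj ?c)) ** (mpow \<sigma> (cnj ?c) ** mpow \<sigma> ?c)
      ** kron (mat 1) (mpow (marg_snd \<sigma>) (- ?c))"
    unfolding half_rotation_def by (simp add: adj_mult adj_kron adj_mpow[OF \<sigma>] adj_mpow[OF m] matrix_mul_assoc)
  also have "mpow \<sigma> (cnj ?c) ** mpow \<sigma> ?c = \<sigma>"
    by (simp only: mpow_add[OF \<sigma>, symmetric] c mpow_1[OF \<sigma>])
  finally have "marg_snd (adj (half_rotation t \<sigma>) ** half_rotation t \<sigma>)
    = mpow (marg_snd \<sigma>) (- cnj ?c) ** marg_snd \<sigma> ** mpow (marg_snd \<sigma>) (- ?c)"
    by (simp only: embedding_bimodule[OF E])
  also have "\<dots> = mpow (marg_snd \<sigma>) (- cnj ?c) ** mpow (marg_snd \<sigma>) 1 ** mpow (marg_snd \<sigma>) (- ?c)"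
    by (simp only: mpow_1[OF m])
  also have "\<dots> = mpow (marg_snd \<sigma>) (- cnj ?c + 1 + - ?c)"
    by (simp only: mpow_add[OF m])
  also have "- cnj ?c + 1 + - ?c = 0" using c by (simp add: algebra_simps)
  finally show ?thesis .
qed

lemmas emb_A_bar = embedding_compose[OF embedding_fst embedding_snd]
lemmas emb_B_bar = embedding_compose[OF embedding_snd embedding_snd]

section \<open>The four-party state\<close>

context
  fixes \<rho> :: "(('a::finite \<times> 'ab::finite) \<times> ('b::finite \<times> 'bb::finite)) cmat"
  assumes state: "quantum_state \<rho>"
begin

text \<open>Up to the factor 1/2, the exponents are the signs with which the entropies enter the
  conditional mutual information. In this order the first four factors combine into the tensor
  product of the two Kraus operators, acting on a root of the barred marginal.\<close>

definition local_states :: "((('a \<times> 'ab) \<times> ('b \<times> 'bb)) cmat \<times> complex) list" where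
  "local_states =
    [(kron (marg_fst \<rho>) (mat 1), 1 / 2),
     (kron (mat 1) (marg_snd \<rho>), 1 / 2),
     (kron (kron (mat 1) (marg_snd (marg_fst \<rho>))) (mat 1), - 1 / 2),
     (kron (mat 1) (kron (mat 1) (marg_snd (marg_snd \<rho>))), - 1 / 2),
     (emb_bars (marg_bars \<rho>), 1 / 2)]"

lemma psd_state: "psd \<rho>" and trace_state: "trace \<rho> = 1"
  using state by (auto simp: quantum_state_def)

lemmas psd_marginals =
  psd_marginal[OF embedding_fst psd_state] psd_marginal[OF embedding_snd psd_state]
  psd_marginal[OF emb_A_bar psd_state] psd_marginal[OF emb_B_bar psd_state]
  psd_marginal[OF embedding_bars psd_state]

lemma supported_local_states: "\<forall>(A, k)\<in>set local_states. supported \<rho> A \<and> k \<in> \<real>"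
  using supported_marginal[OF embedding_fst psd_state] supported_marginal[OF embedding_snd psd_state]
    supported_marginal[OF emb_A_bar psd_state] supported_marginal[OF emb_B_bar psd_state]
    supported_marginal[OF embedding_bars psd_state]
  by (simp add: local_states_def)

lemma log_deriv_local_states: "- (2 * Re (log_deriv local_states \<rho>)) = bipartite_cond_mutual_info \<rho>"
proof -
  \<comment> \<open>The information of the barred pair uses marginals of
    \<open>marg_bars \<rho>\<close>, while \<open>local_states\<close> reaches the same parties
    through the two halves.\<close>
  have "marg_fst (marg_bars \<rho>) = marg_snd (marg_fst \<rho>)"
    unfolding vec_eq_iff marg_fst_def marg_bars_def marg_snd_def
    by (simp add: sum_UNIV_prod) (intro allI, subst sum.swap, intro sum.cong refl sum.swap)
  moreover have "marg_snd (marg_bars \<rho>) = marg_snd (marg_snd \<rho>)"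
    unfolding vec_eq_iff marg_bars_def marg_snd_def
    by (simp add: sum_UNIV_prod) (intro allI, rule trans[OF sum.cong[OF refl sum.swap]],
        rule trans[OF sum.swap], rule sum.cong[OF refl sum.swap])
  ultimately show ?thesis
    using trace_mlog_marginal[OF embedding_fst psd_state] trace_mlog_marginal[OF embedding_snd psd_state]
      trace_mlog_marginal[OF emb_A_bar psd_state] trace_mlog_marginal[OF emb_B_bar psd_state]
      trace_mlog_marginal[OF embedding_bars psd_state]
    by (simp add: log_deriv_def local_states_def bipartite_cond_mutual_info_def mutual_info_def entropy_def)
qed

lemma mpow_prod_local_states:
  "mpow_prod local_states (Complex 1 t) =
     kron (half_rotation t (marg_fst \<rho>)) (half_rotation t (marg_snd \<rho>))
     ** emb_bars (mpow (marg_bars \<rho>) ((1 + \<i> * of_real t) / 2))"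
proof -
  have z: "Complex 1 t = 1 + \<i> * of_real t" by (simp add: complex_eq_iff)
  show ?thesis
    by (simp add: embedding_mpow[OF embedding_fst psd_marginals(1)] embedding_mpow[OF embedding_snd psd_marginals(2)]
        embedding_mpow[OF emb_A_bar psd_marginals(3)] embedding_mpow[OF emb_B_bar psd_marginals(4)]
        embedding_mpow[OF embedding_bars psd_marginals(5)]
        local_states_def half_rotation_def z matrix_mul_assoc kron_mult)
qed

text \<open>The last factor and its adjoint have exponents adding up to 1, so together they give the
  barred marginal; conjugation by the Kraus operators remains.\<close>

lemma rotated_local_states: "rotated local_states t = recovered t \<rho>"
proof -
  let ?c = "(1 + \<i> * of_real t) / 2"
  let ?Y = "emb_bars (mpow (marg_bars \<rho>) ?c) :: (('a \<times> 'ab) \<times> ('b \<times> 'bb)) cmat"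
  have "mpow (marg_bars \<rho>) ?c ** adj (mpow (marg_bars \<rho>) ?c) = mpow (marg_bars \<rho>) (?c + cnj ?c)"
    by (simp only: adj_mpow[OF psd_marginals(5)] mpow_add[OF psd_marginals(5)])
  also have "?c + cnj ?c = 1" by (simp add: complex_eq_iff)
  finally have "?Y ** adj ?Y = emb_bars (marg_bars \<rho>)"
    by (simp add: embedding_simps(1,2)[OF embedding_bars, symmetric] mpow_1[OF psd_marginals(5)])
  hence "rotated local_states t = kron (half_rotation t (marg_fst \<rho>)) (half_rotation t (marg_snd \<rho>))
      ** emb_bars (marg_bars \<rho>) ** adj (kron (half_rotation t (marg_fst \<rho>)) (half_rotation t (marg_snd \<rho>)))"
    unfolding rotated_def mpow_prod_local_states mult_adj_mult by (simp only:)
  thus ?thesis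
    unfolding recovered_def
    using tensor_map_conj[OF recovery_eq_conj[OF psd_marginals(1)] recovery_eq_conj[OF psd_marginals(2)]]
    by simp
qed

text \<open>The squared norm is the trace of the recovered state. Trace preservation reduces it to
  the weight of the two local support projections in the state; both are absorbed, so it equals
  1.\<close>

lemma norm_mpow_prod_local_states: "norm (mpow_prod local_states (Complex 1 t)) \<le> 1"
proof -
  let ?W = "mpow_prod local_states (Complex 1 t)"
  let ?K = "kron (half_rotation t (marg_fst \<rho>)) (half_rotation t (marg_snd \<rho>))"
  let ?PA = "mpow (marg_snd (marg_fst \<rho>)) 0" and ?PB = "mpow (marg_snd (marg_snd \<rho>)) 0"
  have "complex_of_real ((norm ?W)\<^sup>2) = trace (rotated local_states t)"
    using trace_adj_mult_self[of "adj ?W"] by (simp add: rotated_def norm_adj)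
  also have "\<dots> = trace (?K ** emb_bars (marg_bars \<rho>) ** adj ?K)"
    unfolding rotated_local_states recovered_def
    using tensor_map_conj[OF recovery_eq_conj[OF psd_marginals(1)] recovery_eq_conj[OF psd_marginals(2)]]
    by simp
  also have "\<dots> = trace (adj ?K ** ?K ** emb_bars (marg_bars \<rho>))"
    by (subst trace_mul_sym) (simp only: matrix_mul_assoc)
  also have "\<dots> = trace (marg_bars (adj ?K ** ?K) ** marg_bars \<rho>)"
    by (rule embedding_simps(6)[OF embedding_bars])
  also have "marg_bars (adj ?K ** ?K) = kron ?PA ?PB"
    by (simp add: adj_kron kron_mult marg_bars_kron marg_snd_half_rotation psd_marginals(1,2))
  also have "trace (kron ?PA ?PB ** marg_bars \<rho>) = trace (marg_bars \<rho> ** kron ?PA ?PB)"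
    by (rule trace_mul_sym)
  also have "\<dots> = trace (\<rho> ** emb_bars (kron ?PA ?PB))"
    by (rule embedding_simps(6)[OF embedding_bars, symmetric])
  also have "emb_bars (kron ?PA ?PB) = kron (kron (mat 1) ?PA) (mat 1) ** kron (mat 1) (kron (mat 1) ?PB)"
    by (simp add: emb_bars_kron kron_mult)
  also have "\<dots> = mpow (kron (kron (mat 1) (marg_snd (marg_fst \<rho>))) (mat 1)) 0
      ** mpow (kron (mat 1) (kron (mat 1) (marg_snd (marg_snd \<rho>)))) 0"
    by (simp only: embedding_mpow[OF emb_A_bar psd_marginals(3)] embedding_mpow[OF emb_B_bar psd_marginals(4)])
  also have "trace (\<rho> ** \<dots>) = trace \<rho>"
    using supported_local_states by (simp add: local_states_def supported_def matrix_mul_assoc)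
  finally have "(norm ?W)\<^sup>2 = 1" by (simp only: trace_state of_real_eq_1_iff)
  thus ?thesis using power2_le_imp_le[of "norm ?W" 1] by simp
qed

lemma measured_rel_entropy_recovered_le:
  "measured_rel_entropy \<rho> (LINT t|lborel. beta0 t *\<^sub>R recovered t \<rho>)
     \<le> ereal (bipartite_cond_mutual_info \<rho>)"
  unfolding measured_rel_entropy_def
proof (rule SUP_least)
  fix M :: "(('a \<times> 'ab) \<times> ('b \<times> 'bb)) cmat list"
  let ?\<sigma> = "LINT t|lborel. beta0 t *\<^sub>R recovered t \<rho>"
  \<comment> \<open>Positions index the outcomes, since an effect may occur repeatedly in the
    list.\<close>
  let ?I = "{..<length M}"
  assume "M \<in> {M. povm M}"
  hence M: "\<And>i. i < length M \<Longrightarrow> psd (M ! i)" "sum_list M = mat 1"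
    by (auto simp: povm_def)
  have one: "mat_comb ?I (\<lambda>_. 1) ((!) M) = mat 1"
    using M(2) by (simp add: sum_list_sum_nth atLeast0LessThan vec_eq_iff mat_comb_def)
  have var: "(\<Sum>i\<in>?I. a i * Re (trace (\<rho> ** M ! i))) - bipartite_cond_mutual_info \<rho>
      \<le> (\<Sum>i\<in>?I. exp (a i) * Re (trace (?\<sigma> ** M ! i))) - 1" for a
    using measured_variational_bound[OF supported_local_states psd_state trace_state _ _ one, of a] M(1)
      log_deriv_local_states
    by (simp add: rotated_local_states)
  have total: "(\<Sum>i\<in>?I. Re (trace (\<rho> ** M ! i))) = 1"
    using trace_mat_comb_mult[of ?I "\<lambda>_. 1" "(!) M" \<rho>]
    by (simp add: one trace_state trace_mul_sym[of \<rho>] flip: Re_sum)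
  have nonneg: "0 \<le> Re (trace (\<rho> ** M ! i))" if "i < length M" for i
  proof -
    let ?h = "mpow \<rho> (1 / 2)" and ?k = "mpow (M ! i) (1 / 2)"
    have "trace (\<rho> ** M ! i) = trace (adj (?h ** ?k) ** (?h ** ?k))"
    proof -
      have "trace (adj (?h ** ?k) ** (?h ** ?k)) = trace (adj ?k ** (adj ?h ** ?h ** ?k))"
        by (simp only: adj_mult matrix_mul_assoc)
      also have "\<dots> = trace (\<rho> ** (?k ** adj ?k))"
        by (subst trace_mul_sym) (simp only: psd_eq_adj_mult_self[OF psd_state, symmetric] matrix_mul_assoc)
      also have "?k ** adj ?k = M ! i"
        using M(1)[OF that] by (simp add: adj_mpow mpow_add[symmetric] mpow_1)
      finally show ?thesis by simp
    qed
    thus ?thesis by (simp add: trace_adj_mult_self)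
  qed
  have "(\<Sum>E\<leftarrow>M. rel_term (Re (trace (\<rho> ** E))) (Re (trace (?\<sigma> ** E))))
      = (\<Sum>i\<in>?I. rel_term (Re (trace (\<rho> ** M ! i))) (Re (trace (?\<sigma> ** M ! i))))"
    by (simp add: sum_list_sum_nth atLeast0LessThan)
  also have "\<dots> \<le> ereal (bipartite_cond_mutual_info \<rho>)"
    by (rule sum_rel_term_le_variational[OF _ _ total var]) (simp_all add: nonneg)
  finally show "(\<Sum>E\<leftarrow>M. rel_term (Re (trace (\<rho> ** E))) (Re (trace (?\<sigma> ** E))))
      \<le> ereal (bipartite_cond_mutual_info \<rho>)" .
qed

lemma fidelity_recovered_le:
  "- eintegral lborel (\<lambda>t. ereal (beta0 t) * elog (fidelity \<rho> (recovered t \<rho>)))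
     \<le> ereal (bipartite_cond_mutual_info \<rho>)"
proof -
  note ctxt = supported_local_states psd_state trace_state norm_mpow_prod_local_states
  let ?f = "\<lambda>t. ereal (beta0 t) * elog (fidelity \<rho> (recovered t \<rho>))"
  let ?P = "enn2ereal (\<integral>\<^sup>+ t. e2ennreal (?f t) \<partial>lborel)"
  let ?N = "enn2ereal (\<integral>\<^sup>+ t. e2ennreal (- ?f t) \<partial>lborel)"
  have I: "0 \<le> bipartite_cond_mutual_info \<rho>"
    using fidelity_nn_integral_bound(1)[OF ctxt] log_deriv_local_states by simp
  have "?N \<le> enn2ereal (ennreal (bipartite_cond_mutual_info \<rho>))"
    using fidelity_nn_integral_bound(2)[OF ctxt] log_deriv_local_states
    by (simp add: rotated_local_states less_eq_ennreal.rep_eq)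
  hence N: "?N \<le> ereal (bipartite_cond_mutual_info \<rho>)" using I by simp
  \<comment> \<open>The positive part of the integral enters the negated integral with a minus sign
    and is dropped.\<close>
  have "0 - ?N \<le> ?P - ?N" by (intro ereal_minus_mono) auto
  hence "- (?P - ?N) \<le> ?N" by (simp add: ereal_uminus_le_reorder)
  thus ?thesis unfolding eintegral_def using N by (rule order_trans)
qed

end

theorem proposition8:
  fixes \<rho> :: "(('a::finite \<times> 'ab::finite) \<times> ('b::finite \<times> 'bb::finite)) cmat"
  assumes "quantum_state \<rho>"
  shows "ereal (bipartite_cond_mutual_info \<rho>)
           \<ge> measured_rel_entropy \<rho> (LINT t|lborel. beta0 t *\<^sub>R recovered t \<rho>)
       \<and> ereal (bipartite_cond_mutual_info \<rho>)
           \<ge> - eintegral lborel (\<lambda>t. ereal (beta0 t) * elog (fidelity \<rho> (recovered t \<rho>)))"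
  using measured_rel_entropy_recovered_le[OF assms] fidelity_recovered_le[OF assms] by blast

end
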